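(* Let $A(z)$ be an $n\times n$ Hermite matrix of Laurent polynomials such that $\det A(z)$ is not identically zero, and let $m_1,m_2\ge0$ be integers, $m=m_1+m_2$. Then there exists an $n\times m$ matrix $U(z)$ of Laurent polynomials with $A(z)=U(z)\operatorname{diag}(I_{m_1},-I_{m_2})U^\star(z)$ if and only if $$m_1\ge\max_{z\in\mathbb{T}}\nu_+(A(z))\quad\text{and}\quad m_2\ge\max_{z\in\mathbb{T}}\nu_-(A(z)).$$
   Context: For a matrix $U(z)=\sum_k U_k z^k$ of Laurent polynomials, $U^\star(z):=\sum_k\overline{U_k}^T z^{-k}$. A square matrix $A(z)$ of Laurent polynomials is a Hermite matrix of Laurent polynomials if $A^\star(z)=A(z)$. $\mathbb{T}$ is the unit circle. For a Hermitian matrix $H$, $\nu_+(H)$, $\nu_-(H)$ are the numbers of its positive and negative eigenvalues. *)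

theory Defs
  imports "HOL-Computational_Algebra.Formal_Laurent_Series" "Jordan_Normal_Form.Char_Poly"
begin

definition lp_support :: "complex fls \<Rightarrow> int set" where
  "lp_support f = {k. fls_nth f k \<noteq> 0}"

definition is_lpoly :: "complex fls \<Rightarrow> bool" where
  "is_lpoly f \<longleftrightarrow> finite (lp_support f)"

definition is_lpoly_mat :: "complex fls mat \<Rightarrow> bool" where
  "is_lpoly_mat A \<longleftrightarrow> (\<forall>i < dim_row A. \<forall>j < dim_col A. is_lpoly (A $$ (i,j)))"

definition lp_star :: "complex fls \<Rightarrow> complex fls" where
  "lp_star f = (\<Sum>k\<in>lp_support f. fls_const (cnj (fls_nth f k)) * fls_X_intpow (-k))"

definition lp_mat_star :: "complex fls mat \<Rightarrow> complex fls mat" where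
  "lp_mat_star U = mat (dim_col U) (dim_row U) (\<lambda>(i,j). lp_star (U $$ (j,i)))"

definition lp_eval :: "complex fls \<Rightarrow> complex \<Rightarrow> complex" where
  "lp_eval f z = (\<Sum>k\<in>lp_support f. fls_nth f k * z powi k)"

definition lp_mat_eval :: "complex fls mat \<Rightarrow> complex \<Rightarrow> complex mat" where
  "lp_mat_eval A z = map_mat (\<lambda>f. lp_eval f z) A"

definition sig_mat :: "nat \<Rightarrow> nat \<Rightarrow> complex fls mat" where
  "sig_mat m1 m2 = four_block_mat (1\<^sub>m m1) (0\<^sub>m m1 m2) (0\<^sub>m m2 m1) (- 1\<^sub>m m2)"

definition nu_pos :: "complex mat \<Rightarrow> nat" where
  "nu_pos H = size (filter_mset (\<lambda>x. Im x = 0 \<and> Re x > 0) (proots (char_poly H)))"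

definition nu_neg :: "complex mat \<Rightarrow> nat" where
  "nu_neg H = size (filter_mset (\<lambda>x. Im x = 0 \<and> Re x < 0) (proots (char_poly H)))"

definition unit_circle :: "complex set" where
  "unit_circle = {z. cmod z = 1}"

end

theory Submission
  imports Defs "HOL-Computational_Algebra.Fundamental_Theorem_Algebra"
    "Jordan_Normal_Form.Schur_Decomposition"
begin

text \<open>
  Necessity is the law of inertia at each point of the circle. Conversely, the signature is constant on
  the arcs between the zeros of \<open>det A\<close> on the circle, so enlarging \<open>A\<close> to a block diagonal matrix by
  Hermitian scalar Laurent polynomials with suitable signs on these arcs gives a matrix of size
  \<open>m1 + m2\<close> whose signature is \<open>(m1, m2)\<close> at almost every point; a factorization of the enlarged matrix
  restricts to one of \<open>A\<close>.

  For constant signature, a root \<open>a\<close> of the determinant is split off with the help of a vector \<open>v\<close> in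
  the left kernel of \<open>A(a)\<close>. For \<open>a\<close> on the circle, \<open>v\<close> must also be isotropic for the derivative of
  \<open>A\<close> along the circle; if there were no such \<open>v\<close>, this form would be definite on the kernel and the
  signature would change at \<open>a\<close>. What remains is a Hermitian matrix with constant determinant. Lowering its
  row degrees makes some diagonal entry a nonzero constant or zero; in the latter case
  its row contains a monomial, and adding a multiple of this row to another one creates a
  diagonal entry \<open>1\<close>. A Schur complement then reduces the size.
\<close>

section \<open>Unitary diagonalization of Hermitian matrices\<close>

text \<open>A zero \<open>a\<close> of \<open>det A\<close> on the circle is the delicate case:
  \<open>lroot a * lstar (lroot a)\<close> vanishes there to second order, so the diagonal entry
  produced by \<open>v\<close> needs a double zero, which is the isotropy condition. Off the circle
  the second zero is the reflected point and follows from Hermitian symmetry. The contradiction in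
  the definite case is a count: on one side of \<open>a\<close> there are at least as many positive
  eigenvalues as \<open>A(a)\<close> has nonnegative ones, on the other at least as many negative
  ones as it has nonpositive ones, and the kernel is counted twice.

  Eigenvalue counts are treated as maximal dimensions of definite subspaces. These survive small
  perturbations and cannot increase under any congruence, even a singular one, so eigenvalues never
  have to be followed.

  The signature is controlled only off a finite set \<open>F\<close> that may grow, since the scalar
  blocks and the determinants have zeros on the circle. The unimodular case yields some
  \<open>p'\<close>, \<open>q'\<close> with \<open>p' + q' = n\<close>; the inertia bounds at one
  good point identify them.\<close>

definition hadj :: "('a \<Rightarrow> 'a) \<Rightarrow> 'a mat \<Rightarrow> 'a mat" where
  "hadj \<sigma> A = mat (dim_col A) (dim_row A) (\<lambda>(i,j). \<sigma> (A $$ (j,i)))"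

lemma hadj_dim [simp]: "dim_row (hadj \<sigma> A) = dim_col A" "dim_col (hadj \<sigma> A) = dim_row A"
  by (auto simp: hadj_def)

lemma hadj_carrier [simp, intro]: "A \<in> carrier_mat n m \<Longrightarrow> hadj \<sigma> A \<in> carrier_mat m n"
  by (auto simp: hadj_def)

lemma hadj_index [simp]: "i < dim_col A \<Longrightarrow> j < dim_row A \<Longrightarrow> hadj \<sigma> A $$ (i,j) = \<sigma> (A $$ (j,i))"
  by (auto simp: hadj_def)

lemma index_mult_sum:
  assumes "A \<in> carrier_mat n m" "B \<in> carrier_mat m l" "i < n" "j < l"
  shows "(A * B) $$ (i,j) = (\<Sum>k<m. A $$ (i,k) * B $$ (k,j))"
  using assms by (auto simp: scalar_prod_def atLeast0LessThan intro!: sum.cong)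

lemma hadj_mult:
  assumes "comm_ring_hom \<sigma>" and "A \<in> carrier_mat n m" "B \<in> carrier_mat m l"
  shows "hadj \<sigma> (A * B) = hadj \<sigma> B * hadj \<sigma> A"
proof (rule eq_matI)
  interpret comm_ring_hom \<sigma> by fact
  fix i j assume "i < dim_row (hadj \<sigma> B * hadj \<sigma> A)" "j < dim_col (hadj \<sigma> B * hadj \<sigma> A)"
  then have ij: "i < l" "j < n" using assms by auto
  have "hadj \<sigma> (A * B) $$ (i,j) = \<sigma> ((A * B) $$ (j,i))"
    using ij assms by simp
  also have "(A * B) $$ (j,i) = (\<Sum>k<m. A $$ (j,k) * B $$ (k,i))"
    by (rule index_mult_sum) (use assms ij in auto)
  also have "\<sigma> \<dots> = (\<Sum>k<m. \<sigma> (B $$ (k,i)) * \<sigma> (A $$ (j,k)))"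
    by (simp add: hom_sum hom_mult mult.commute)
  also have "\<dots> = (hadj \<sigma> B * hadj \<sigma> A) $$ (i,j)"
    by (subst index_mult_sum[of _ l m _ n]) (use assms ij in auto)
  finally show "hadj \<sigma> (A * B) $$ (i,j) = (hadj \<sigma> B * hadj \<sigma> A) $$ (i,j)" .
qed (use assms in auto)

lemma hadj_one: "comm_ring_hom \<sigma> \<Longrightarrow> hadj \<sigma> (1\<^sub>m n) = 1\<^sub>m n"
proof -
  assume "comm_ring_hom \<sigma>"
  then interpret comm_ring_hom \<sigma> .
  show ?thesis by (rule eq_matI) auto
qed

lemma hadj_hadj: "(\<And>x. \<sigma> (\<sigma> x) = x) \<Longrightarrow> hadj \<sigma> (hadj \<sigma> A) = A"
  by (rule eq_matI) auto

interpretation cnj_hom: comm_ring_hom cnj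
  by unfold_locales auto

lemma hadj_cnj_cnj [simp]: "hadj cnj (hadj cnj A) = A"
  by (rule hadj_hadj) simp

text \<open>Gram-Schmidt keeps its first vector, so after normalizing the columns the first one is
  still a multiple of \<open>v\<close>. With an eigenvector as \<open>v\<close> this is the
  deflation step of the spectral theorem.\<close>

lemma unitary_completion:
  fixes v :: "complex vec"
  assumes v: "v \<in> carrier_vec n" and v0: "v \<noteq> 0\<^sub>v n"
  shows "\<exists>W c. W \<in> carrier_mat n n \<and> hadj cnj W * W = 1\<^sub>m n \<and> col W 0 = c \<cdot>\<^sub>v v"
proof -
  interpret cof_vec_space n "TYPE(complex)" .
  define ws where "ws = gram_schmidt n (basis_completion v)"
  note bc = basis_completion[OF v v0]
  have len: "length ws = n" and ws: "set ws \<subseteq> carrier_vec n" and orth: "corthogonal ws"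
    using gram_schmidt_result[OF bc(2) bc(4) bc(5) ws_def] bc(6) by auto
  have n: "n \<noteq> 0"
    using v v0 by auto
  have "basis_completion v = hd (basis_completion v) # tl (basis_completion v)"
    using bc(6) n by (metis hd_Cons_tl length_0_conv)
  then have hd: "hd ws = v"
    unfolding ws_def using bc(7) v gram_schmidt_hd by metis
  have wsc: "ws ! i \<in> carrier_vec n" if "i < n" for i
    using ws len that by (meson nth_mem subset_iff)
  define N where "N i = (\<Sum>k<n. (cmod ((ws ! i) $ k))\<^sup>2)" for i
  have ip: "(ws ! i) \<bullet>c (ws ! j) = (\<Sum>k<n. (ws ! i) $ k * cnj ((ws ! j) $ k))"
    if "i < n" "j < n" for i j
    using wsc[OF that(1)] wsc[OF that(2)] by (auto simp: scalar_prod_def atLeast0LessThan)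
  have ipN: "(ws ! i) \<bullet>c (ws ! i) = of_real (N i)" if "i < n" for i
    by (simp add: ip[OF that that] N_def complex_norm_square[symmetric] flip: of_real_power)
  have Npos: "N i > 0" if "i < n" for i
  proof -
    have "N i \<noteq> 0"
      using corthogonalD[OF orth, of i i] that len ipN[OF that] by auto
    moreover have "N i \<ge> 0"
      unfolding N_def by (intro sum_nonneg) auto
    ultimately show ?thesis by simp
  qed
  define W where "W = mat n n (\<lambda>(k,i). (ws ! i) $ k / of_real (sqrt (N i)))"
  have W: "W \<in> carrier_mat n n" by (simp add: W_def)
  have "hadj cnj W * W = 1\<^sub>m n"
  proof (rule eq_matI)
    fix i j assume "i < dim_row (1\<^sub>m n :: complex mat)" "j < dim_col (1\<^sub>m n :: complex mat)"
    then have ij: "i < n" "j < n" by auto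
    have "(hadj cnj W * W) $$ (i,j) = (\<Sum>k<n. cnj (W $$ (k,i)) * W $$ (k,j))"
      by (subst index_mult_sum[of _ n n _ n]) (use W ij in auto)
    also have "\<dots> = (\<Sum>k<n. (ws ! j) $ k * cnj ((ws ! i) $ k)) / (of_real (sqrt (N i)) * of_real (sqrt (N j)))"
      unfolding sum_divide_distrib by (intro sum.cong refl) (use ij in \<open>auto simp: W_def\<close>)
    also have "\<dots> = (ws ! j) \<bullet>c (ws ! i) / (of_real (sqrt (N i)) * of_real (sqrt (N j)))"
      using ip ij by simp
    also have "\<dots> = (if i = j then 1 else 0)"
    proof (cases "i = j")
      case True
      have "of_real (sqrt (N j)) * of_real (sqrt (N j)) = (of_real (N j) :: complex)"
        using Npos[OF ij(2)] by (simp flip: of_real_mult)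
      then show ?thesis
        using True ipN[OF ij(2)] Npos[OF ij(2)] by simp
    next
      case False
      then show ?thesis using corthogonalD[OF orth, of j i] len ij by auto
    qed
    finally show "(hadj cnj W * W) $$ (i,j) = 1\<^sub>m n $$ (i,j)" using ij by auto
  qed (use W in auto)
  moreover have "col W 0 = (1 / of_real (sqrt (N 0))) \<cdot>\<^sub>v v"
  proof (rule eq_vecI)
    have "ws ! 0 = v" using hd n len by (metis hd_conv_nth length_0_conv)
    then show "col W 0 $ i = ((1 / of_real (sqrt (N 0))) \<cdot>\<^sub>v v) $ i"
      if "i < dim_vec ((1 / of_real (sqrt (N 0))) \<cdot>\<^sub>v v)" for i
      using that v n by (auto simp: W_def)
  qed (use W v in auto)
  ultimately show ?thesis using W by blast
qed

lemma hadj_four_block: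
  assumes "A \<in> carrier_mat nr1 nc1" "B \<in> carrier_mat nr1 nc2"
    "C \<in> carrier_mat nr2 nc1" "D \<in> carrier_mat nr2 nc2"
  shows "hadj \<sigma> (four_block_mat A B C D) = four_block_mat (hadj \<sigma> A) (hadj \<sigma> C) (hadj \<sigma> B) (hadj \<sigma> D)"
  by (rule eq_matI, insert assms, auto)

lemma hadj_zero [simp]: "\<sigma> 0 = 0 \<Longrightarrow> hadj \<sigma> (0\<^sub>m n m) = 0\<^sub>m m n"
  by (rule eq_matI) auto

text \<open>An eigenvector in the first column of \<open>W\<close> makes the first column of
  \<open>B\<close> a multiple of the first unit vector; symmetry does the same for the first row.
  Hence \<open>B\<close> splits into a real 1 by 1 block and a smaller Hermitian matrix
  \<open>B3\<close>.\<close>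

lemma hermitian_unitary_diag:
  fixes H :: "complex mat"
  assumes "H \<in> carrier_mat n n" "hadj cnj H = H"
  shows "\<exists>W e. W \<in> carrier_mat n n \<and> hadj cnj W * W = 1\<^sub>m n \<and>
     H = W * mat_diag n (\<lambda>i. of_real (e i)) * hadj cnj W"
  using assms
proof (induction n arbitrary: H)
  case 0
  then show ?case by (intro exI[of _ "1\<^sub>m 0"] exI[of _ "\<lambda>_. 0"]) auto
next
  case (Suc m)
  let ?n = "Suc m"
  have H: "H \<in> carrier_mat ?n ?n" and herm: "hadj cnj H = H" by fact+
  have "degree (char_poly H) \<noteq> 0" using degree_monic_char_poly[OF H] by auto
  then obtain l where "poly (char_poly H) l = 0"
    using fundamental_theorem_of_algebra[of "char_poly H"] by (auto simp: constant_degree)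
  then obtain v where v: "v \<in> carrier_vec ?n" "v \<noteq> 0\<^sub>v ?n" "H *\<^sub>v v = l \<cdot>\<^sub>v v"
    using eigenvalue_root_char_poly[OF H] H by (auto simp: eigenvalue_def eigenvector_def)
  obtain W c where W: "W \<in> carrier_mat ?n ?n" and WW: "hadj cnj W * W = 1\<^sub>m ?n" and W0: "col W 0 = c \<cdot>\<^sub>v v"
    using unitary_completion[OF v(1,2)] by blast
  have W': "hadj cnj W \<in> carrier_mat ?n ?n" using W by auto
  have WW': "W * hadj cnj W = 1\<^sub>m ?n" by (rule mat_mult_left_right_inverse[OF W' W WW])
  define B where "B = hadj cnj W * (H * W)"
  have HW: "H * W \<in> carrier_mat ?n ?n" using H W by auto
  have B: "B \<in> carrier_mat ?n ?n" unfolding B_def using HW W' by auto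
  have hB: "hadj cnj B = B"
    unfolding B_def hadj_mult[OF cnj_hom.comm_ring_hom_axioms W' HW] hadj_mult[OF cnj_hom.comm_ring_hom_axioms H W] using herm H W W'
    by (simp add: assoc_mult_mat[of _ ?n ?n _ ?n _ ?n] mult_carrier_mat[of _ ?n ?n _ ?n])
  have HB: "H = W * B * hadj cnj W"
  proof -
    have "W * B * hadj cnj W = W * hadj cnj W * H * (W * hadj cnj W)"
      unfolding B_def using H W W' HW by (simp add: assoc_mult_mat[of _ ?n ?n _ ?n _ ?n] mult_carrier_mat[of _ ?n ?n _ ?n])
    then show ?thesis using WW' H by simp
  qed
  have col0: "B $$ (i,0) = (if i = 0 then l else 0)" if i: "i < ?n" for i
  proof -
    have "B $$ (i,0) = (\<Sum>k<?n. hadj cnj W $$ (i,k) * (H * W) $$ (k,0))"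
      unfolding B_def by (rule index_mult_sum[OF W' HW]) (use i in auto)
    also have "\<dots> = (\<Sum>k<?n. hadj cnj W $$ (i,k) * (l * W $$ (k,0)))"
    proof (intro sum.cong refl arg_cong2[where f = "(*)"])
      fix k assume "k \<in> {..<?n}"
      then have k: "k < ?n" by auto
      have "(H * W) $$ (k,0) = row H k \<bullet> col W 0" using H W k by auto
      also have "\<dots> = c * (row H k \<bullet> v)" unfolding W0 using H k v by simp
      also have "row H k \<bullet> v = (H *\<^sub>v v) $ k" using H k by auto
      also have "c * \<dots> = l * col W 0 $ k" unfolding v(3) W0 using k v by simp
      finally show "(H * W) $$ (k,0) = l * W $$ (k,0)" using W k by simp
    qed
    also have "\<dots> = l * (\<Sum>k<?n. hadj cnj W $$ (i,k) * W $$ (k,0))"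
      unfolding sum_distrib_left by (intro sum.cong refl) (simp add: mult_ac)
    also have "(\<Sum>k<?n. hadj cnj W $$ (i,k) * W $$ (k,0)) = (hadj cnj W * W) $$ (i,0)"
      by (rule index_mult_sum[OF W' W, symmetric]) (use i in auto)
    finally show ?thesis unfolding WW using i by auto
  qed
  have Bsym: "B $$ (i,j) = cnj (B $$ (j,i))" if "i < ?n" "j < ?n" for i j
    using arg_cong[OF hB, of "\<lambda>M. M $$ (i,j)"] that B by auto
  have lre: "l = of_real (Re l)"
    using Bsym[of 0 0] col0[of 0] by (simp add: complex_eq_iff)
  define B3 where "B3 = mat m m (\<lambda>(i,j). B $$ (Suc i, Suc j))"
  have B3: "B3 \<in> carrier_mat m m" by (simp add: B3_def)
  have hB3: "hadj cnj B3 = B3"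
    by (rule eq_matI) (auto simp: B3_def Bsym[of "Suc _" "Suc _", symmetric])
  define L where "L = mat 1 1 (\<lambda>_. l)"
  have L: "L \<in> carrier_mat 1 1" by (simp add: L_def)
  have Bblock: "B = four_block_mat L (0\<^sub>m 1 m) (0\<^sub>m m 1) B3"
  proof (rule eq_matI)
    fix i j assume "i < dim_row (four_block_mat L (0\<^sub>m 1 m) (0\<^sub>m m 1) B3)" "j < dim_col (four_block_mat L (0\<^sub>m 1 m) (0\<^sub>m m 1) B3)"
    then have ij: "i < ?n" "j < ?n" by (auto simp: L_def B3_def)
    show "B $$ (i,j) = four_block_mat L (0\<^sub>m 1 m) (0\<^sub>m m 1) B3 $$ (i,j)"
      using ij col0[of i] col0[of j] Bsym[of 0 j] by (auto simp: L_def B3_def)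
  qed (use B in \<open>auto simp: L_def B3_def\<close>)
  obtain V e where V: "V \<in> carrier_mat m m" and VV: "hadj cnj V * V = 1\<^sub>m m"
    and BV: "B3 = V * mat_diag m (\<lambda>i. of_real (e i)) * hadj cnj V"
    using Suc.IH[OF B3 hB3] by blast
  define F where "F = four_block_mat (1\<^sub>m 1) (0\<^sub>m 1 m) (0\<^sub>m m 1) V"
  have F: "F \<in> carrier_mat ?n ?n" using V by (auto simp: F_def)
  have hF: "hadj cnj F = four_block_mat (1\<^sub>m 1) (0\<^sub>m 1 m) (0\<^sub>m m 1) (hadj cnj V)"
    unfolding F_def by (subst hadj_four_block[of _ 1 1 _ m _ m]) (use V in auto)
  have F': "hadj cnj F \<in> carrier_mat ?n ?n" using F by auto
  have V': "hadj cnj V \<in> carrier_mat m m" using V by auto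
  have FF: "hadj cnj F * F = 1\<^sub>m ?n"
    unfolding hF unfolding F_def
    by (subst mult_four_block_mat[of _ 1 1 _ m _ m _ _ 1 _ m]) (use V V' VV in \<open>auto\<close>)
  define d where "d i = (case i of 0 \<Rightarrow> Re l | Suc k \<Rightarrow> e k)" for i
  let ?D = "mat_diag m (\<lambda>i. complex_of_real (e i))"
  have Dblock: "mat_diag ?n (\<lambda>i. complex_of_real (d i)) = four_block_mat L (0\<^sub>m 1 m) (0\<^sub>m m 1) ?D"
    by (rule eq_matI) (auto simp: mat_diag_def L_def d_def lre[symmetric] split: nat.split)
  have D: "?D \<in> carrier_mat m m" by simp
  have VD: "V * ?D \<in> carrier_mat m m" using V D by auto
  have FD: "F * mat_diag ?n (\<lambda>i. complex_of_real (d i)) = four_block_mat L (0\<^sub>m 1 m) (0\<^sub>m m 1) (V * ?D)"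
    unfolding F_def Dblock
    by (subst mult_four_block_mat[of _ 1 1 _ m _ m _ _ 1 _ m]) (use V V' L D in \<open>auto simp: left_mult_zero_mat[OF D] right_mult_zero_mat[OF V]\<close>)
  have BF: "B = F * mat_diag ?n (\<lambda>i. complex_of_real (d i)) * hadj cnj F"
    unfolding FD hF
    by (subst mult_four_block_mat[of _ 1 1 _ m _ m _ _ 1 _ m]) (use V V' L D VD Bblock BV in \<open>auto simp: left_mult_zero_mat[OF V'] right_mult_zero_mat[OF VD]\<close>)
  let ?Dn = "mat_diag ?n (\<lambda>i. complex_of_real (d i))"
  have Dn: "?Dn \<in> carrier_mat ?n ?n" by simp
  define X where "X = W * F"
  have X: "X \<in> carrier_mat ?n ?n" using W F by (auto simp: X_def)
  have hX: "hadj cnj X = hadj cnj F * hadj cnj W"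
    unfolding X_def by (rule hadj_mult[OF cnj_hom.comm_ring_hom_axioms W F])
  have "hadj cnj X * X = hadj cnj F * (hadj cnj W * W) * F"
    unfolding hX unfolding X_def using W F W' F' by (simp add: assoc_mult_mat[of _ ?n ?n _ ?n _ ?n] mult_carrier_mat[of _ ?n ?n _ ?n])
  then have XX: "hadj cnj X * X = 1\<^sub>m ?n" using WW FF F F' by simp
  have "H = X * ?Dn * hadj cnj X"
    unfolding hX unfolding X_def using W F W' F' Dn HB BF
    by (simp add: assoc_mult_mat[of _ ?n ?n _ ?n _ ?n] mult_carrier_mat[of _ ?n ?n _ ?n])
  then show ?case using X XX by blast
qed

section \<open>Positive definite forms and inertia\<close>

text \<open>Forms are functions on an arbitrary index set rather than matrices: induction can remove
  a single index without renumbering, and sets such as the indices of nonnegative eigenvalues serve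
  directly.\<close>

definition qform :: "'a set \<Rightarrow> ('a \<Rightarrow> 'a \<Rightarrow> complex) \<Rightarrow> ('a \<Rightarrow> complex) \<Rightarrow> complex" where
  "qform J Y x = (\<Sum>a\<in>J. \<Sum>b\<in>J. cnj (x a) * Y a b * x b)"

definition posdef :: "'a set \<Rightarrow> ('a \<Rightarrow> 'a \<Rightarrow> complex) \<Rightarrow> bool" where
  "posdef J Y \<longleftrightarrow> (\<forall>x. (\<exists>j\<in>J. x j \<noteq> 0) \<longrightarrow> 0 < Re (qform J Y x))"

lemma sum_sum_mult:
  fixes c :: "'a::comm_semiring_0"
  shows "(\<Sum>i\<in>A. \<Sum>j\<in>B. c * f i * g j) = c * sum f A * sum g B"
proof -
  have "c * sum f A * sum g B = c * (\<Sum>i\<in>A. \<Sum>j\<in>B. f i * g j)"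
    by (simp only: sum_product mult.assoc)
  then show ?thesis by (simp add: sum_distrib_left mult.assoc)
qed

lemma qform_cong:
  assumes "\<And>a b. a \<in> J \<Longrightarrow> b \<in> J \<Longrightarrow> Y a b = Y' a b" "\<And>a. a \<in> J \<Longrightarrow> x a = x' a"
  shows "qform J Y x = qform J Y' x'"
  unfolding qform_def by (intro sum.cong refl) (use assms in auto)

lemma posdefD: "posdef J Y \<Longrightarrow> j \<in> J \<Longrightarrow> x j \<noteq> 0 \<Longrightarrow> 0 < Re (qform J Y x)"
  by (auto simp: posdef_def)

text \<open>Completing the square in the variable \<open>x a\<close>; what remains on
  \<open>J\<close> is the Schur complement of the pivot \<open>Y a a\<close>.\<close>

lemma qform_insert:
  assumes "finite J" "a \<notin> J" "\<And>b. b \<in> J \<Longrightarrow> Y b a = cnj (Y a b)"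
    and "Y a a = of_real y" "y \<noteq> 0"
  shows "qform (insert a J) Y x =
    of_real (y * (cmod (x a + (\<Sum>b\<in>J. Y a b * x b) / of_real y))\<^sup>2)
      + qform J (\<lambda>b c. Y b c - Y b a * Y a c / Y a a) x"
proof -
  define L where "L = (\<Sum>b\<in>J. Y a b * x b)"
  have cL: "cnj L = (\<Sum>b\<in>J. cnj (x b) * Y b a)"
    unfolding L_def cnj_sum by (intro sum.cong refl) (use assms(3) in \<open>auto simp: mult.commute\<close>)
  have q1: "qform (insert a J) Y x = cnj (x a) * of_real y * x a + cnj (x a) * L + cnj L * x a + qform J Y x"
    unfolding cL unfolding L_def qform_def using assms(1,2)
    by (simp add: assms(4) sum.distrib sum_distrib_left sum_distrib_right mult.assoc)
  have q2: "qform J (\<lambda>b c. Y b c - Y b a * Y a c / Y a a) x = qform J Y x - cnj L * L / of_real y"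
    unfolding cL unfolding L_def qform_def sum_product sum_divide_distrib sum_subtractf[symmetric]
    by (intro sum.cong refl) (simp add: assms(4) algebra_simps)
  have "of_real (y * (cmod (x a + L / of_real y))\<^sup>2) =
     of_real y * ((x a + L / of_real y) * cnj (x a + L / of_real y))"
    by (simp only: of_real_mult complex_norm_square)
  also have "\<dots> = cnj (x a) * of_real y * x a + cnj (x a) * L + cnj L * x a + cnj L * L / of_real y"
    using assms(5) by (simp add: field_simps)
  finally show ?thesis unfolding L_def[symmetric] q1 q2 by (simp only:) simp
qed

text \<open>The two summands of \<open>qform_insert\<close> are tested separately: the unit vector
  at \<open>a\<close> isolates the pivot, and the choice of \<open>x a\<close> that makes the square
  vanish isolates the Schur complement.\<close>

lemma posdef_insert:
  assumes "finite J" "a \<notin> J" "\<And>b c. b \<in> insert a J \<Longrightarrow> c \<in> insert a J \<Longrightarrow> Y b c = cnj (Y c b)"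
  shows "posdef (insert a J) Y \<longleftrightarrow>
    0 < Re (Y a a) \<and> posdef J (\<lambda>b c. Y b c - Y b a * Y a c / Y a a)"
proof -
  have real: "Y a a = of_real (Re (Y a a))"
    using assms(3)[of a a] by (simp add: complex_eq_iff)
  have Ya: "Y b a = cnj (Y a b)" if "b \<in> J" for b using assms(3) that by blast
  show ?thesis
  proof (intro iffI conjI)
    assume pd: "posdef (insert a J) Y"
    define x where "x b = (if b = a then 1 else 0 :: complex)" for b
    have z: "(\<Sum>b\<in>J. f b * x b) = 0" for f
      by (rule sum.neutral) (use assms(2) in \<open>auto simp: x_def\<close>)
    have z': "(\<Sum>b\<in>J. cnj (x b) * f b) = 0" for f
      by (rule sum.neutral) (use assms(2) in \<open>auto simp: x_def\<close>)
    have z'': "(\<Sum>b\<in>J. \<Sum>c\<in>J. cnj (x b) * Y b c * x c) = 0"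
      by (intro sum.neutral ballI) (use assms(2) in \<open>auto simp: x_def\<close>)
    have "qform (insert a J) Y x = Y a a"
      using assms(1,2) z[of "Y a"] z'[of "\<lambda>b. Y b a"] z''
      by (simp add: qform_def sum.distrib x_def[of a])
    then show y: "0 < Re (Y a a)"
      using posdefD[OF pd, of a x] by (simp add: x_def)
    show "posdef J (\<lambda>b c. Y b c - Y b a * Y a c / Y a a)"
      unfolding posdef_def
    proof (intro allI impI)
      fix x :: "'a \<Rightarrow> complex" assume "\<exists>j\<in>J. x j \<noteq> 0"
      then obtain j where j: "j \<in> J" "x j \<noteq> 0" by blast
      define x' where "x' = x(a := - (\<Sum>b\<in>J. Y a b * x b) / of_real (Re (Y a a)))"
      have s: "(\<Sum>b\<in>J. Y a b * x' b) = (\<Sum>b\<in>J. Y a b * x b)"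
        by (intro sum.cong refl) (use assms(2) in \<open>auto simp: x'_def\<close>)
      have "qform (insert a J) Y x' = qform J (\<lambda>b c. Y b c - Y b a * Y a c / Y a a) x'"
        by (subst qform_insert[where J = J and a = a and Y = Y and y = "Re (Y a a)"]) (use assms(1,2) Ya real y s in \<open>auto simp: x'_def\<close>)
      also have "\<dots> = qform J (\<lambda>b c. Y b c - Y b a * Y a c / Y a a) x"
        by (rule qform_cong) (use assms(2) in \<open>auto simp: x'_def\<close>)
      finally show "0 < Re (qform J (\<lambda>b c. Y b c - Y b a * Y a c / Y a a) x)"
        using posdefD[OF pd, of j x'] j assms(2) by (cases "j = a") (auto simp: x'_def)
    qed
  next
    assume R: "0 < Re (Y a a) \<and> posdef J (\<lambda>b c. Y b c - Y b a * Y a c / Y a a)"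
    show "posdef (insert a J) Y"
      unfolding posdef_def
    proof (intro allI impI)
      fix x :: "'a \<Rightarrow> complex" assume nz: "\<exists>j\<in>insert a J. x j \<noteq> 0"
      let ?w = "cmod (x a + (\<Sum>b\<in>J. Y a b * x b) / of_real (Re (Y a a)))"
      let ?q = "Re (qform J (\<lambda>b c. Y b c - Y b a * Y a c / Y a a) x)"
      have eq: "Re (qform (insert a J) Y x) = Re (Y a a) * ?w\<^sup>2 + ?q"
        by (subst qform_insert[where J = J and a = a and Y = Y and y = "Re (Y a a)"]) (use assms(1,2) Ya real R in auto)
      show "0 < Re (qform (insert a J) Y x)"
      proof (cases "\<exists>j\<in>J. x j \<noteq> 0")
        case True
        then have "?q > 0" using R by (auto simp: posdef_def)
        moreover have "Re (Y a a) * ?w\<^sup>2 \<ge> 0" using R by simp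
        ultimately show ?thesis using eq by linarith
      next
        case False
        then have "?q = 0" by (auto simp: qform_def intro!: sum.neutral)
        moreover have "(\<Sum>b\<in>J. Y a b * x b) = 0" using False by (intro sum.neutral) auto
        moreover have "x a \<noteq> 0" using nz False by auto
        ultimately show ?thesis using eq R by simp
      qed
    qed
  qed
qed

text \<open>Openness of positive definiteness by induction over the pivots: a pivot is eventually
  positive because its limit is, and the Schur complements converge because the limiting pivot is
  nonzero.\<close>

lemma posdef_eventually:
  assumes "finite J" "posdef J Y"
    and "\<And>a b. a \<in> J \<Longrightarrow> b \<in> J \<Longrightarrow> Y a b = cnj (Y b a)"
    and "\<And>t a b. a \<in> J \<Longrightarrow> b \<in> J \<Longrightarrow> Yt t a b = cnj (Yt t b a)"
    and "\<And>a b. a \<in> J \<Longrightarrow> b \<in> J \<Longrightarrow> ((\<lambda>t. Yt t a b) \<longlongrightarrow> Y a b) F"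
  shows "\<forall>\<^sub>F t in F. posdef J (Yt t)"
  using assms
proof (induction J arbitrary: Y Yt rule: finite_induct)
  case empty
  then show ?case by (simp add: posdef_def)
next
  case (insert a J)
  note pi = posdef_insert[OF insert.hyps(1,2)]
  have R: "0 < Re (Y a a)" "posdef J (\<lambda>b c. Y b c - Y b a * Y a c / Y a a)"
    using insert.prems(1) pi[of Y] insert.prems(2) by blast+
  have nz: "Y a a \<noteq> 0" using R(1) by auto
  have "((\<lambda>t. Re (Yt t a a)) \<longlongrightarrow> Re (Y a a)) F"
    by (intro tendsto_Re insert.prems(4)) auto
  then have e1: "\<forall>\<^sub>F t in F. 0 < Re (Yt t a a)"
    by (rule order_tendstoD(1)) (use R in auto)
  have h: "Z b c - Z b a * Z a c / Z a a = cnj (Z c b - Z c a * Z a b / Z a a)"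
    if "\<And>b c. b \<in> insert a J \<Longrightarrow> c \<in> insert a J \<Longrightarrow> Z b c = cnj (Z c b)" "b \<in> J" "c \<in> J" for Z :: "'a \<Rightarrow> 'a \<Rightarrow> complex" and b c
  proof -
    have "Z b c = cnj (Z c b)" "Z b a = cnj (Z a b)" "Z a c = cnj (Z c a)" "cnj (Z a a) = Z a a"
      using that(1)[of b c] that(1)[of b a] that(1)[of a c] that(1)[of a a] that(2,3) by auto
    then show ?thesis by simp
  qed
  have e2: "\<forall>\<^sub>F t in F. posdef J (\<lambda>b c. Yt t b c - Yt t b a * Yt t a c / Yt t a a)"
  proof (rule insert.IH[OF R(2)])
    show "Y b c - Y b a * Y a c / Y a a = cnj (Y c b - Y c a * Y a b / Y a a)" if "b \<in> J" "c \<in> J" for b c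
      using h[of Y b c] insert.prems(2) that by blast
    show "Yt t b c - Yt t b a * Yt t a c / Yt t a a = cnj (Yt t c b - Yt t c a * Yt t a b / Yt t a a)"
      if "b \<in> J" "c \<in> J" for t b c
      using h[of "Yt t" b c] insert.prems(3) that by blast
    show "((\<lambda>t. Yt t b c - Yt t b a * Yt t a c / Yt t a a) \<longlongrightarrow> Y b c - Y b a * Y a c / Y a a) F"
      if "b \<in> J" "c \<in> J" for b c
      by (intro tendsto_diff tendsto_divide tendsto_mult insert.prems(4) nz) (use that in auto)
  qed
  show ?case
    using e1 e2
  proof eventually_elim
    case (elim t)
    then show ?case using pi[of "Yt t"] insert.prems(3) by blast
  qed
qed

text \<open>Gaussian elimination, one equation at a time: a vanishing equation is dropped, any other
  is solved for an unknown with nonzero coefficient, which costs one equation and one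
  unknown.\<close>

lemma linear_system_nontrivial:
  fixes m :: "'k \<Rightarrow> 'j \<Rightarrow> 'a::field"
  assumes "finite P" "finite J" "card P < card J"
  shows "\<exists>x. (\<exists>j\<in>J. x j \<noteq> 0) \<and> (\<forall>k\<in>P. (\<Sum>j\<in>J. m k j * x j) = 0)"
  using assms
proof (induction P arbitrary: J m rule: finite_induct)
  case empty
  then obtain j where "j \<in> J" by fastforce
  then show ?case by (intro exI[of _ "\<lambda>_. 1"]) auto
next
  case (insert p P)
  show ?case
  proof (cases "\<forall>j\<in>J. m p j = 0")
    case True
    have "card P < card J" using insert by auto
    then obtain x where "\<exists>j\<in>J. x j \<noteq> 0" "\<forall>k\<in>P. (\<Sum>j\<in>J. m k j * x j) = 0"
      using insert.IH[of J m] insert.prems by blast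
    then show ?thesis using True by (intro exI[of _ x]) auto
  next
    case False
    then obtain j0 where j0: "j0 \<in> J" "m p j0 \<noteq> 0" by blast
    define J' where "J' = J - {j0}"
    have J': "finite J'" "card P < card J'" "J = insert j0 J'" "j0 \<notin> J'"
      using insert j0 by (auto simp: J'_def)
    obtain x where x: "\<exists>j\<in>J'. x j \<noteq> 0"
      "\<forall>k\<in>P. (\<Sum>j\<in>J'. (m k j - m k j0 * m p j / m p j0) * x j) = 0"
      using insert.IH[OF J'(1,2), of "\<lambda>k j. m k j - m k j0 * m p j / m p j0"] by blast
    define s where "s = (\<Sum>j\<in>J'. m p j * x j)"
    define x' where "x' = x(j0 := - s / m p j0)"
    have sum: "(\<Sum>j\<in>J. m k j * x' j) = (\<Sum>j\<in>J'. m k j * x j) - m k j0 * s / m p j0" for k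
    proof -
      have "(\<Sum>j\<in>J'. m k j * x' j) = (\<Sum>j\<in>J'. m k j * x j)"
        by (intro sum.cong refl) (use J' in \<open>auto simp: x'_def\<close>)
      then show ?thesis unfolding J'(3) using J' by (simp add: x'_def)
    qed
    have "(\<Sum>j\<in>J. m k j * x' j) = 0" if "k \<in> insert p P" for k
    proof (cases "k = p")
      case True
      then show ?thesis using sum[of p] j0 by (simp add: s_def)
    next
      case False
      then have "(\<Sum>j\<in>J'. (m k j - m k j0 * m p j / m p j0) * x j) = 0" using x that by auto
      moreover have "(\<Sum>j\<in>J'. (m k j - m k j0 * m p j / m p j0) * x j) = (\<Sum>j\<in>J'. m k j * x j) - m k j0 * s / m p j0"
        unfolding s_def sum_distrib_left sum_divide_distrib sum_subtractf[symmetric]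
        by (intro sum.cong refl) (simp add: algebra_simps)
      ultimately show ?thesis using sum[of k] by simp
    qed
    moreover have "\<exists>j\<in>J. x' j \<noteq> 0" using x(1) J' by (auto simp: x'_def)
    ultimately show ?thesis by blast
  qed
qed

section \<open>The positive index of a Hermitian form through subspaces\<close>

definition gram :: "nat \<Rightarrow> (nat \<Rightarrow> nat \<Rightarrow> complex) \<Rightarrow> (nat \<Rightarrow> nat \<Rightarrow> complex) \<Rightarrow> nat \<Rightarrow> nat \<Rightarrow> complex" where
  "gram n H X a b = (\<Sum>i<n. \<Sum>j<n. cnj (X i a) * H i j * X j b)"

text \<open>A positive definite Gram matrix forces the columns of \<open>X\<close> indexed by
  \<open>J\<close> to be linearly independent. So independence is built in, and the condition means
  that \<open>H\<close> is positive on some subspace of dimension \<open>k\<close>.\<close>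

definition posdim :: "nat \<Rightarrow> (nat \<Rightarrow> nat \<Rightarrow> complex) \<Rightarrow> nat \<Rightarrow> bool" where
  "posdim n H k \<longleftrightarrow> (\<exists>J X. finite J \<and> card J = k \<and> posdef J (gram n H X))"

lemma gram_cong:
  assumes "\<And>i j. i < n \<Longrightarrow> j < n \<Longrightarrow> H i j = H' i j"
  shows "gram n H X a b = gram n H' X a b"
  unfolding gram_def using assms by (intro sum.cong refl) auto

lemma posdim_cong:
  assumes "\<And>i j. i < n \<Longrightarrow> j < n \<Longrightarrow> H i j = H' i j"
  shows "posdim n H k \<longleftrightarrow> posdim n H' k"
proof -
  have "gram n H = gram n H'"
    by (intro ext gram_cong) (use assms in auto)
  then show ?thesis by (simp add: posdim_def)
qed

text \<open>The linear substitution given by \<open>X\<close> in a sesquilinear form. It serves both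
  to evaluate a Gram form and to compose two changes of coordinates.\<close>

lemma sesquilinear_pullback:
  "(\<Sum>a\<in>I. \<Sum>b\<in>J. cnj (x a) * (\<Sum>i\<in>K. \<Sum>j\<in>L. cnj (X i a) * H i j * X j b) * y b)
    = (\<Sum>i\<in>K. \<Sum>j\<in>L. cnj (\<Sum>a\<in>I. X i a * x a) * H i j * (\<Sum>b\<in>J. X j b * y b))"
proof -
  let ?f = "\<lambda>a b i j. H i j * (cnj (X i a) * cnj (x a)) * (X j b * y b)"
  have "(\<Sum>a\<in>I. \<Sum>b\<in>J. cnj (x a) * (\<Sum>i\<in>K. \<Sum>j\<in>L. cnj (X i a) * H i j * X j b) * y b)
    = (\<Sum>a\<in>I. \<Sum>b\<in>J. \<Sum>i\<in>K. \<Sum>j\<in>L. ?f a b i j)"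
    unfolding sum_distrib_left sum_distrib_right by (intro sum.cong refl) (simp only: mult_ac)
  also have "\<dots> = (\<Sum>a\<in>I. \<Sum>i\<in>K. \<Sum>b\<in>J. \<Sum>j\<in>L. ?f a b i j)"
    by (intro sum.cong refl sum.swap)
  also have "\<dots> = (\<Sum>i\<in>K. \<Sum>a\<in>I. \<Sum>j\<in>L. \<Sum>b\<in>J. ?f a b i j)"
    by (subst sum.swap) (intro sum.cong refl sum.swap)
  also have "\<dots> = (\<Sum>i\<in>K. \<Sum>j\<in>L. \<Sum>a\<in>I. \<Sum>b\<in>J. ?f a b i j)"
    by (intro sum.cong refl sum.swap)
  also have "\<dots> = (\<Sum>i\<in>K. \<Sum>j\<in>L. cnj (\<Sum>a\<in>I. X i a * x a) * H i j * (\<Sum>b\<in>J. X j b * y b))"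
    unfolding sum_sum_mult by (intro sum.cong refl) (simp add: mult_ac)
  finally show ?thesis .
qed

lemma qform_gram: "qform J (gram n H X) x = qform {..<n} H (\<lambda>i. \<Sum>b\<in>J. X i b * x b)"
  unfolding qform_def gram_def by (rule sesquilinear_pullback)

lemma gram_gram: "gram n (gram m H W) X = gram m H (\<lambda>i c. \<Sum>a<n. W i a * X a c)"
  unfolding gram_def by (intro ext sesquilinear_pullback)

text \<open>\<open>W\<close> maps one positive subspace onto another. A vector with positive value
  cannot be sent to zero, so \<open>W\<close> may be rectangular or singular.\<close>

lemma posdim_congruence: "posdim n (gram m H W) k \<Longrightarrow> posdim m H k"
  unfolding posdim_def gram_gram by blast

text \<open>A subspace of dimension larger than the number of positive terms contains a nonzero
  vector orthogonal to all \<open>t _ k\<close> with \<open>e k > 0\<close>, and the form is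
  nonpositive there. The vectors \<open>t _ k\<close> are arbitrary, so the bound fits a spectral
  decomposition as well as a factorization with any number of terms.\<close>

lemma posdim_le_card:
  fixes e :: "'k \<Rightarrow> real" and t :: "nat \<Rightarrow> 'k \<Rightarrow> complex"
  assumes "finite K"
    and H: "\<And>i j. i < n \<Longrightarrow> j < n \<Longrightarrow> H i j = (\<Sum>k\<in>K. of_real (e k) * t i k * cnj (t j k))"
    and "posdim n H r"
  shows "r \<le> card {k\<in>K. e k > 0}"
proof (rule ccontr)
  assume "\<not> ?thesis"
  then have lt: "card {k\<in>K. e k > 0} < r" by simp
  obtain J X where J: "finite J" "card J = r" and pd: "posdef J (gram n H X)"
    using assms(3) by (auto simp: posdim_def)
  obtain x where x: "\<exists>j\<in>J. x j \<noteq> 0"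
    and ker: "\<forall>k\<in>{k\<in>K. e k > 0}. (\<Sum>b\<in>J. (\<Sum>j<n. cnj (t j k) * X j b) * x b) = 0"
    using linear_system_nontrivial[of "{k\<in>K. e k > 0}" J "\<lambda>k b. \<Sum>j<n. cnj (t j k) * X j b"] assms(1) J lt by auto
  define y where "y i = (\<Sum>b\<in>J. X i b * x b)" for i
  \<comment> \<open>In the coordinates \<open>s k\<close> the form is diagonal with weights
    \<open>e k\<close>, and the coordinates of positive weight vanish.\<close>
  define s where "s k = (\<Sum>j<n. cnj (t j k) * y j)" for k
  have s0: "s k = 0" if "k \<in> K" "e k > 0" for k
  proof -
    have "s k = (\<Sum>j<n. \<Sum>b\<in>J. cnj (t j k) * X j b * x b)"
      by (simp add: s_def y_def sum_distrib_left mult.assoc)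
    also have "\<dots> = (\<Sum>b\<in>J. (\<Sum>j<n. cnj (t j k) * X j b) * x b)"
      by (subst sum.swap) (simp add: sum_distrib_right)
    finally show ?thesis using ker that by simp
  qed
  have "qform J (gram n H X) x = (\<Sum>i<n. \<Sum>j<n. \<Sum>k\<in>K. of_real (e k) * (t i k * cnj (y i)) * (cnj (t j k) * y j))"
    unfolding qform_gram unfolding qform_def y_def[symmetric]
    by (intro sum.cong refl) (simp add: H sum_distrib_left sum_distrib_right, simp only: mult_ac)
  also have "\<dots> = (\<Sum>k\<in>K. \<Sum>i<n. \<Sum>j<n. of_real (e k) * (t i k * cnj (y i)) * (cnj (t j k) * y j))"
    by (subst sum.swap[of _ K]) (intro sum.cong refl sum.swap)
  also have "\<dots> = (\<Sum>k\<in>K. of_real (e k) * of_real ((cmod (s k))\<^sup>2))"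
    unfolding sum_sum_mult complex_norm_square by (intro sum.cong refl) (simp add: s_def mult_ac)
  finally have "Re (qform J (gram n H X) x) = (\<Sum>k\<in>K. e k * (cmod (s k))\<^sup>2)"
    by (simp only: Re_sum Re_complex_of_real flip: of_real_mult)
  also have "\<dots> \<le> 0"
  proof (rule sum_nonpos)
    fix k assume "k \<in> K"
    then show "e k * (cmod (s k))\<^sup>2 \<le> 0"
      using s0[of k] by (cases "e k > 0") (auto simp: mult_nonpos_nonneg)
  qed
  finally show False using pd x by (auto simp: posdef_def)
qed

section \<open>Signature of Hermitian matrices\<close>

lemma proots_linear_factors: "proots (\<Prod>a\<leftarrow>as. [:- a, 1:]) = mset (as :: complex list)"
proof (induction as)
  case (Cons a as)
  have "(\<Prod>a\<leftarrow>as. [:- a, 1:]) \<noteq> (0 :: complex poly)"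
    by (auto simp: prod_list_zero_iff)
  then show ?case using Cons by (simp add: proots_mult del: mult_pCons_left)
qed simp

lemma size_filter_mset_map_upt:
  "size (filter_mset P (mset (map d [0..<n]))) = card {k. k < n \<and> P (d k)}"
proof -
  have "size (filter_mset P (mset (map d [0..<n]))) = length (filter P (map d [0..<n]))"
    by (metis mset_filter size_mset)
  also have "\<dots> = card {i. i < n \<and> P (d i)}"
    unfolding length_filter_conv_card by (intro arg_cong[where f = card]) auto
  finally show ?thesis .
qed

text \<open>All clauses are stated for one pair \<open>W\<close>, \<open>e\<close>, because the
  kernel indices, the orthonormal eigenvectors and the eigenvalue counts later have to refer to the
  same diagonalization.\<close>

lemma hermitian_spectral:
  fixes H :: "complex mat"
  assumes H: "H \<in> carrier_mat n n" and herm: "hadj cnj H = H"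
  shows "\<exists>W e. (\<forall>i<n. \<forall>j<n. H $$ (i,j) = (\<Sum>k<n. of_real (e k) * W i k * cnj (W j k))) \<and>
    (\<forall>a<n. \<forall>b<n. gram n (\<lambda>i j. H $$ (i,j)) W a b = (if a = b then of_real (e a) else 0)) \<and>
    (\<forall>a<n. \<forall>b<n. (\<Sum>i<n. cnj (W i a) * W i b) = (if a = b then 1 else 0)) \<and>
    nu_pos H = card {k. k < n \<and> e k > 0} \<and> nu_neg H = card {k. k < n \<and> e k < (0::real)} \<and>
    (det H \<noteq> 0 \<longleftrightarrow> (\<forall>k<n. e k \<noteq> 0))"
proof -
  obtain V e where V: "V \<in> carrier_mat n n" and VV: "hadj cnj V * V = 1\<^sub>m n"
    and HV: "H = V * mat_diag n (\<lambda>i. complex_of_real (e i)) * hadj cnj V"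
    using hermitian_unitary_diag[OF H herm] by blast
  let ?D = "mat_diag n (\<lambda>i. complex_of_real (e i))"
  define W where "W i k = V $$ (i,k)" for i k
  have V': "hadj cnj V \<in> carrier_mat n n" using V by auto
  have D: "?D \<in> carrier_mat n n" by simp
  have VV': "V * hadj cnj V = 1\<^sub>m n" by (rule mat_mult_left_right_inverse[OF V' V VV])
  have VD: "V * ?D \<in> carrier_mat n n" using V D by auto
  have e1: "H $$ (i,j) = (\<Sum>k<n. of_real (e k) * W i k * cnj (W j k))" if "i < n" "j < n" for i j
  proof -
    have "H $$ (i,j) = (\<Sum>k<n. (V * ?D) $$ (i,k) * hadj cnj V $$ (k,j))"
      by (subst HV, rule index_mult_sum[OF VD V' that])
    then show ?thesis
      using that V by (simp add: mat_diag_mult_right[OF V] W_def mult_ac)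
  qed
  have HW: "H * V \<in> carrier_mat n n" using H V by auto
  have "hadj cnj V * (H * V) = (hadj cnj V * V) * ?D * (hadj cnj V * V)"
    unfolding HV using V V' D
    by (simp add: assoc_mult_mat[of _ n n _ n _ n] mult_carrier_mat[of _ n n _ n])
  then have DV: "hadj cnj V * (H * V) = ?D" using VV D by simp
  have e2: "gram n (\<lambda>i j. H $$ (i,j)) W a b = (if a = b then of_real (e a) else 0)" if "a < n" "b < n" for a b
  proof -
    have "?D $$ (a,b) = (\<Sum>i<n. hadj cnj V $$ (a,i) * (H * V) $$ (i,b))"
      unfolding DV[symmetric] by (rule index_mult_sum[OF V' HW that])
    also have "\<dots> = (\<Sum>i<n. cnj (W i a) * (\<Sum>j<n. H $$ (i,j) * W j b))"
      using that V by (intro sum.cong refl) (simp add: index_mult_sum[OF H V] W_def del: index_mult_mat)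
    also have "\<dots> = gram n (\<lambda>i j. H $$ (i,j)) W a b"
      by (simp add: gram_def sum_distrib_left mult.assoc)
    finally have eq: "?D $$ (a,b) = gram n (\<lambda>i j. H $$ (i,j)) W a b" .
    show ?thesis unfolding eq[symmetric] using that by (simp add: mat_diag_def)
  qed
  have e3: "(\<Sum>i<n. cnj (W i a) * W i b) = (if a = b then 1 else 0)" if "a < n" "b < n" for a b
  proof -
    have "(hadj cnj V * V) $$ (a,b) = (\<Sum>i<n. hadj cnj V $$ (a,i) * V $$ (i,b))"
      by (rule index_mult_sum[OF V' V that])
    then show ?thesis unfolding VV using that V by (simp add: W_def)
  qed
  \<comment> \<open>Since \<open>V\<close> is unitary, the congruence is also a similarity; it
    therefore preserves \<open>char_poly\<close> and turns the root counts behind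
    \<open>nu_pos\<close> and \<open>nu_neg\<close> into counts of the \<open>e k\<close>.\<close>
  have "similar_mat H ?D"
    by (rule similar_matI[of _ _ V "hadj cnj V" n]) (use H V V' D VV VV' HV in auto)
  then have "char_poly H = char_poly ?D" by (rule char_poly_similar)
  also have ut: "upper_triangular ?D" by (auto simp: mat_diag_def)
  have dm: "diag_mat ?D = map (\<lambda>i. complex_of_real (e i)) [0..<n]"
    by (auto simp: diag_mat_def mat_diag_def)
  have "char_poly ?D = (\<Prod>a\<leftarrow>map (\<lambda>i. complex_of_real (e i)) [0..<n]. [:- a, 1:])"
    using char_poly_upper_triangular[OF D ut] dm by simp
  finally have pr: "proots (char_poly H) = mset (map (\<lambda>i. complex_of_real (e i)) [0..<n])"
    by (simp only: proots_linear_factors)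
  have e4: "nu_pos H = card {k. k < n \<and> e k > 0}" "nu_neg H = card {k. k < n \<and> e k < 0}"
    unfolding nu_pos_def nu_neg_def pr size_filter_mset_map_upt by auto
  have e5: "det H \<noteq> 0 \<longleftrightarrow> (\<forall>k<n. e k \<noteq> 0)"
  proof -
    have "det (hadj cnj V) * det V = 1" using det_mult[OF V' V] VV by simp
    then have nz: "det V \<noteq> 0" "det (hadj cnj V) \<noteq> 0" by auto
    have "det H = det V * det ?D * det (hadj cnj V)"
      by (subst HV) (simp add: det_mult[OF VD V'] det_mult[OF V D])
    then have "det H \<noteq> 0 \<longleftrightarrow> 0 \<notin> set (diag_mat ?D)"
      using det_upper_triangular[OF ut D] nz by (auto simp: prod_list_zero_iff)
    then show ?thesis unfolding dm by auto
  qed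
  show ?thesis using e1 e2 e3 e4 e5 by (intro exI[of _ W] exI[of _ e]) simp
qed

lemma posdef_diag:
  assumes "finite J" "\<And>a b. a \<in> J \<Longrightarrow> b \<in> J \<Longrightarrow> Y a b = (if a = b then of_real (e a) else 0)"
    "\<And>a. a \<in> J \<Longrightarrow> e a > 0"
  shows "posdef J Y"
  unfolding posdef_def
proof (intro allI impI)
  fix x :: "'a \<Rightarrow> complex" assume "\<exists>j\<in>J. x j \<noteq> 0"
  then obtain j where j: "j \<in> J" "x j \<noteq> 0" by blast
  have "qform J Y x = (\<Sum>a\<in>J. \<Sum>b\<in>J. if a = b then cnj (x a) * of_real (e a) * x a else 0)"
    unfolding qform_def using assms(2) by (intro sum.cong refl) auto
  also have "\<dots> = (\<Sum>a\<in>J. of_real (e a * (cmod (x a))\<^sup>2))"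
    using assms(1) by (intro sum.cong refl) (simp add: of_real_mult complex_norm_square mult_ac del: of_real_power)
  finally have "Re (qform J Y x) = (\<Sum>a\<in>J. e a * (cmod (x a))\<^sup>2)"
    by (simp only: Re_sum Re_complex_of_real)
  also have "\<dots> > 0"
  proof (rule sum_pos2[OF assms(1) j(1)])
    show "0 < e j * (cmod (x j))\<^sup>2" using assms(3)[OF j(1)] j(2) by simp
    show "0 \<le> e i * (cmod (x i))\<^sup>2" if "i \<in> J" for i using assms(3)[OF that] by simp
  qed
  finally show "0 < Re (qform J Y x)" .
qed

text \<open>The index is the largest dimension of a definite subspace: the eigenvectors of the right
  sign attain it, and \<open>posdim_le_card\<close> excludes anything larger. The negative index is
  obtained as the positive one of \<open>- H\<close>.\<close>

lemma nu_pos_posdim: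
  assumes "H \<in> carrier_mat n n" "hadj cnj H = H"
  shows "posdim n (\<lambda>i j. H $$ (i,j)) r \<Longrightarrow> r \<le> nu_pos H"
    and "posdim n (\<lambda>i j. - H $$ (i,j)) r \<Longrightarrow> r \<le> nu_neg H"
    and "posdim n (\<lambda>i j. H $$ (i,j)) (nu_pos H)"
    and "posdim n (\<lambda>i j. - H $$ (i,j)) (nu_neg H)"
    and "det H \<noteq> 0 \<Longrightarrow> nu_pos H + nu_neg H = n"
    and "nu_pos H \<le> n" and "nu_neg H \<le> n"
proof -
  obtain W e where *: "\<forall>i<n. \<forall>j<n. H $$ (i,j) = (\<Sum>k<n. of_real (e k) * W i k * cnj (W j k))"
    "\<forall>a<n. \<forall>b<n. gram n (\<lambda>i j. H $$ (i,j)) W a b = (if a = b then of_real (e a) else 0)"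
    and nu: "nu_pos H = card {k. k < n \<and> e k > 0}" "nu_neg H = card {k. k < n \<and> e k < 0}"
    and d: "det H \<noteq> 0 \<longleftrightarrow> (\<forall>k<n. e k \<noteq> 0)"
    using hermitian_spectral[OF assms] by blast
  have s: "\<And>i j. i < n \<Longrightarrow> j < n \<Longrightarrow> H $$ (i,j) = (\<Sum>k<n. of_real (e k) * W i k * cnj (W j k))" using *(1) by blast
  have g: "\<And>a b. a < n \<Longrightarrow> b < n \<Longrightarrow> gram n (\<lambda>i j. H $$ (i,j)) W a b = (if a = b then of_real (e a) else 0)" using *(2) by blast
  have set: "{k \<in> {..<n}. P k} = {k. k < n \<and> P k}" for P by auto
  show "posdim n (\<lambda>i j. H $$ (i,j)) r \<Longrightarrow> r \<le> nu_pos H"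
    unfolding nu set[symmetric] by (rule posdim_le_card[OF _ s]) auto
  show "posdim n (\<lambda>i j. - H $$ (i,j)) r \<Longrightarrow> r \<le> nu_neg H"
    using posdim_le_card[of "{..<n}" n "\<lambda>i j. - H $$ (i,j)" "\<lambda>k. - e k" W r]
    by (simp add: s nu set sum_negf)
  show "posdim n (\<lambda>i j. H $$ (i,j)) (nu_pos H)"
    unfolding posdim_def nu
    by (intro exI[of _ "{k. k < n \<and> e k > 0}"] exI[of _ W] conjI posdef_diag[where e = e]) (auto simp: g)
  have "gram n (\<lambda>i j. - H $$ (i,j)) W a b = - gram n (\<lambda>i j. H $$ (i,j)) W a b" for a b
    by (simp add: gram_def sum_negf)
  then show "posdim n (\<lambda>i j. - H $$ (i,j)) (nu_neg H)"
    unfolding posdim_def nu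
    by (intro exI[of _ "{k. k < n \<and> e k < 0}"] exI[of _ W] conjI posdef_diag[where e = "\<lambda>k. - e k"]) (auto simp: g)
  show "nu_pos H + nu_neg H = n" if "det H \<noteq> 0"
  proof -
    have "card {k. k < n \<and> e k > 0} + card {k. k < n \<and> e k < 0} = card ({k. k < n \<and> e k > 0} \<union> {k. k < n \<and> e k < 0})"
      by (rule card_Un_disjoint[symmetric]) auto
    also have "{k. k < n \<and> e k > 0} \<union> {k. k < n \<and> e k < 0} = {..<n}"
      using d that by (auto simp: neq_iff)
    finally show ?thesis unfolding nu by simp
  qed
  show "nu_pos H \<le> n" "nu_neg H \<le> n"
    unfolding nu using card_mono[of "{..<n}"] by (metis (no_types, lifting) card_lessThan finite_lessThan lessThan_iff mem_Collect_eq subsetI)+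
qed

lemma gram_hermitian:
  assumes "\<And>i j. i < n \<Longrightarrow> j < n \<Longrightarrow> H i j = cnj (H j i)"
  shows "gram n H X a b = cnj (gram n H X b a)"
proof -
  have "cnj (gram n H X b a) = (\<Sum>i<n. \<Sum>j<n. X i b * cnj (H i j) * cnj (X j a))"
    by (simp add: gram_def)
  also have "\<dots> = (\<Sum>j<n. \<Sum>i<n. X i b * cnj (H i j) * cnj (X j a))"
    by (rule sum.swap)
  also have "\<dots> = gram n H X a b"
    unfolding gram_def
  proof (intro sum.cong refl)
    fix i j assume "i \<in> {..<n}" "j \<in> {..<n}"
    then have "cnj (H j i) = H i j" using assms[of i j] by simp
    then show "X j b * cnj (H j i) * cnj (X i a) = cnj (X i a) * H i j * X j b" by (simp add: mult_ac)
  qed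
  finally show ?thesis ..
qed

text \<open>Lower semicontinuity of the positive index: the witnessing subspace stays fixed while
  the form moves, so openness of definiteness suffices.\<close>

lemma posdim_eventually:
  assumes "posdim n H r"
    and H: "\<And>i j. i < n \<Longrightarrow> j < n \<Longrightarrow> H i j = cnj (H j i)"
    and Ht: "\<And>t i j. i < n \<Longrightarrow> j < n \<Longrightarrow> Ht t i j = cnj (Ht t j i)"
    and lim: "\<And>i j. i < n \<Longrightarrow> j < n \<Longrightarrow> ((\<lambda>t. Ht t i j) \<longlongrightarrow> H i j) F"
  shows "\<forall>\<^sub>F t in F. posdim n (Ht t) r"
proof -
  obtain J X where J: "finite J" "card J = r" and pd: "posdef J (gram n H X)"
    using assms(1) by (auto simp: posdim_def)
  have "\<forall>\<^sub>F t in F. posdef J (gram n (Ht t) X)"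
  proof (rule posdef_eventually[OF J(1) pd])
    show "((\<lambda>t. gram n (Ht t) X a b) \<longlongrightarrow> gram n H X a b) F" for a b
      unfolding gram_def by (intro tendsto_sum tendsto_mult tendsto_const lim) auto
    show "gram n H X a b = cnj (gram n H X b a)" for a b by (rule gram_hermitian) (rule H)
    show "gram n (Ht t) X a b = cnj (gram n (Ht t) X b a)" for t a b by (rule gram_hermitian) (rule Ht)
  qed
  then show ?thesis
    by eventually_elim (use J in \<open>auto simp: posdim_def\<close>)
qed

text \<open>Rescaling the kernel directions by \<open>1 / sqrt t\<close> makes the form converge to the positive part
  of \<open>T 0\<close> plus the derivative.\<close>

lemma posdim_after_crossing:
  fixes T :: "real \<Rightarrow> nat \<Rightarrow> nat \<Rightarrow> complex"
  assumes T: "\<And>t a b. a < n \<Longrightarrow> b < n \<Longrightarrow> T t a b = cnj (T t b a)"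
    and T0: "\<And>a b. a < n \<Longrightarrow> b < n \<Longrightarrow> T 0 a b = (if a = b then of_real (e a) else 0)"
    and T': "\<And>a b. a < n \<Longrightarrow> b < n \<Longrightarrow> ((\<lambda>t. (T t a b - T 0 a b) / of_real t) \<longlongrightarrow> D a b) (at_right 0)"
    and D: "\<And>a b. a < n \<Longrightarrow> b < n \<Longrightarrow> D a b = cnj (D b a)"
    and pd: "posdef {a. a < n \<and> e a = 0} D"
  shows "\<forall>\<^sub>F t in at_right 0. posdim n (T t) (card {a. a < n \<and> e a \<ge> 0})"
proof -
  define J where "J = {a. a < n \<and> e a \<ge> 0}"
  define Z where "Z = {a. a < n \<and> e a = 0}"
  define P where "P = {a. a < n \<and> e a > 0}"
  define w where "w t a = (if e a = 0 then 1 / complex_of_real (sqrt t) else 1)" for t a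
  define X where "X t i a = (if i = a then w t a else 0)" for t and i a :: nat
  define Y where "Y a b = (if e a = 0 \<and> e b = 0 then D a b else if a = b then of_real (e a) else 0)" for a b
  have J: "finite J" "J = P \<union> Z" "P \<inter> Z = {}" "finite P" "finite Z" by (auto simp: J_def P_def Z_def)
  have g: "gram n (T t) (X t) a b = cnj (w t a) * T t a b * w t b" if "a \<in> J" "b \<in> J" for t a b
  proof -
    have ab: "a < n" "b < n" using that by (auto simp: J_def)
    have "gram n (T t) (X t) a b = (\<Sum>i<n. \<Sum>j<n. if j = b then (if i = a then cnj (w t a) * T t i b * w t b else 0) else 0)"
      unfolding gram_def X_def by (intro sum.cong refl) auto
    then show ?thesis using ab by (simp add: sum.delta)
  qed
  have posY: "posdef J Y"
    unfolding posdef_def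
  proof (intro allI impI)
    fix x :: "nat \<Rightarrow> complex" assume nz: "\<exists>j\<in>J. x j \<noteq> 0"
    have PZ: "Y a b = 0" if "a \<in> P" "b \<in> Z" for a b using that by (auto simp: Y_def P_def Z_def)
    have ZP: "Y a b = 0" if "a \<in> Z" "b \<in> P" for a b using that by (auto simp: Y_def P_def Z_def)
    \<comment> \<open>The limit form is block diagonal: the positive eigenvalues on
      \<open>P\<close>, the derivative \<open>D\<close> on \<open>Z\<close>.\<close>
    have "qform J Y x = qform P Y x + qform Z Y x"
      unfolding qform_def J(2) sum.union_disjoint[OF J(4,5,3)]
      by (simp add: sum.distrib PZ ZP)
    also have "qform Z Y x = qform Z D x" by (rule qform_cong) (auto simp: Y_def Z_def)
    finally have eq: "Re (qform J Y x) = Re (qform P Y x) + Re (qform Z D x)" by simp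
    have pP: "posdef P Y" by (rule posdef_diag[OF J(4), of _ e]) (auto simp: Y_def P_def)
    have z: "Re (qform S M x) = 0" if "\<not> (\<exists>j\<in>S. x j \<noteq> 0)" for S M
      using that by (auto simp: qform_def intro!: sum.neutral)
    have nn: "Re (qform S M x) \<ge> 0" if "posdef S M" for S M
    proof (cases "\<exists>j\<in>S. x j \<noteq> 0")
      case True
      then show ?thesis using that by (auto simp: posdef_def intro: less_imp_le)
    next
      case False
      then show ?thesis using z[OF False] by simp
    qed
    from nz consider "\<exists>j\<in>P. x j \<noteq> 0" | "\<exists>j\<in>Z. x j \<noteq> 0" unfolding J(2) by blast
    then show "0 < Re (qform J Y x)"
    proof cases
      case 1
      then have "Re (qform P Y x) > 0" using pP by (auto simp: posdef_def)
      then show ?thesis using nn[OF pd[folded Z_def]] unfolding eq by (intro add_pos_nonneg)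
    next
      case 2
      then have "Re (qform Z D x) > 0" using pd unfolding Z_def[symmetric] by (auto simp: posdef_def)
      then show ?thesis using nn[OF pP] unfolding eq by (intro add_nonneg_pos)
    qed
  qed
  have "\<forall>\<^sub>F t in at_right 0. posdef J (gram n (T t) (X t))"
  proof (rule posdef_eventually[OF J(1) posY])
    show "Y a b = cnj (Y b a)" if "a \<in> J" "b \<in> J" for a b
      using that D[of a b] by (auto simp: Y_def J_def)
    show "gram n (T t) (X t) a b = cnj (gram n (T t) (X t) b a)" for t a b
      by (rule gram_hermitian) (rule T)
    show "((\<lambda>t. gram n (T t) (X t) a b) \<longlongrightarrow> Y a b) (at_right 0)" if ab: "a \<in> J" "b \<in> J" for a b
    proof -
      have abn: "a < n" "b < n" using ab by (auto simp: J_def)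
      have pos: "\<forall>\<^sub>F t::real in at_right 0. 0 < t" by (simp add: eventually_at_right_less)
      have sq: "((\<lambda>t. complex_of_real (sqrt t)) \<longlongrightarrow> 0) (at_right 0)"
      proof -
        have "((\<lambda>t. sqrt t) \<longlongrightarrow> sqrt 0) (at_right 0)"
          by (intro tendsto_real_sqrt tendsto_ident_at)
        then show ?thesis using tendsto_of_real by fastforce
      qed
      have id0: "((\<lambda>t. complex_of_real t) \<longlongrightarrow> 0) (at_right 0)"
        using tendsto_of_real[OF tendsto_ident_at[of "0::real" "{0<..}"]] by simp
      note lim = T'[OF abn]
      consider "e a = 0" "e b = 0" | "(e a = 0) \<noteq> (e b = 0)" | "e a \<noteq> 0" "e b \<noteq> 0" by blast
      then have "((\<lambda>t. cnj (w t a) * T t a b * w t b) \<longlongrightarrow> Y a b) (at_right 0)"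
      proof cases
        case 1
        have "((\<lambda>t. cnj (w t a) * T t a b * w t b) \<longlongrightarrow> D a b) (at_right 0)"
        proof (rule Lim_transform_eventually[OF lim])
          show "\<forall>\<^sub>F t in at_right 0. (T t a b - T 0 a b) / of_real t = cnj (w t a) * T t a b * w t b"
            using pos
          proof eventually_elim
            case (elim t)
            have "complex_of_real (sqrt t) * complex_of_real (sqrt t) = of_real t"
              using elim by (simp flip: of_real_mult)
            then show ?case using 1 T0[OF abn] by (simp add: w_def)
          qed
        qed
        then show ?thesis using 1 by (simp add: Y_def)
      next
        case 2
        \<comment> \<open>A mixed entry carries a single factor \<open>1 / sqrt t\<close>, while
          \<open>T t a b\<close> is of order \<open>t\<close> because \<open>T 0 a b = 0\<close>; so
          it tends to 0.\<close>
        have "((\<lambda>t. of_real (sqrt t) * ((T t a b - T 0 a b) / of_real t)) \<longlongrightarrow> 0 * D a b) (at_right 0)"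
          by (intro tendsto_mult sq lim)
        moreover have "\<forall>\<^sub>F t in at_right 0. of_real (sqrt t) * ((T t a b - T 0 a b) / of_real t) = cnj (w t a) * T t a b * w t b"
          using pos
        proof eventually_elim
          case (elim t)
          have "complex_of_real (sqrt t) * complex_of_real (sqrt t) = of_real t" "complex_of_real (sqrt t) \<noteq> 0"
            using elim by (simp_all flip: of_real_mult)
          then have "complex_of_real (sqrt t) / of_real t = 1 / of_real (sqrt t)"
            by (metis divide_divide_eq_left' divide_self_if times_divide_eq_left)
          then have q: "of_real (sqrt t) * y / of_real t = y / of_real (sqrt t)" for y :: complex
            by (metis mult.commute mult_1 times_divide_eq_left times_divide_eq_right)
          have "T 0 a b = 0" using 2 T0[OF abn] by auto
          then show ?case using 2 q[of "T t a b"] by (auto simp: w_def)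
        qed
        ultimately have "((\<lambda>t. cnj (w t a) * T t a b * w t b) \<longlongrightarrow> 0 * D a b) (at_right 0)"
          by (rule Lim_transform_eventually)
        then show ?thesis using 2 by (auto simp: Y_def)
      next
        case 3
        have "((\<lambda>t. of_real t * ((T t a b - T 0 a b) / of_real t) + T 0 a b) \<longlongrightarrow> 0 * D a b + T 0 a b) (at_right 0)"
          by (intro tendsto_intros id0 lim)
        moreover have "\<forall>\<^sub>F t in at_right 0. of_real t * ((T t a b - T 0 a b) / of_real t) + T 0 a b = cnj (w t a) * T t a b * w t b"
          using pos by eventually_elim (use 3 in \<open>auto simp: w_def\<close>)
        ultimately have "((\<lambda>t. cnj (w t a) * T t a b * w t b) \<longlongrightarrow> 0 * D a b + T 0 a b) (at_right 0)"
          by (rule Lim_transform_eventually)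
        then show ?thesis using 3 T0[OF abn] by (auto simp: Y_def)
      qed
      then show ?thesis using g[OF ab] by simp
    qed
  qed
  then show ?thesis
    by eventually_elim (use J in \<open>auto simp: posdim_def J_def\<close>)
qed

text \<open>A form that takes both signs vanishes somewhere on the segment between the two witnesses.\<close>

lemma qform_definite_or_isotropic:
  assumes "finite Z" and herm: "\<And>a b. a \<in> Z \<Longrightarrow> b \<in> Z \<Longrightarrow> D a b = cnj (D b a)"
    and iso: "\<And>x. \<exists>j\<in>Z. x j \<noteq> 0 \<Longrightarrow> qform Z D x \<noteq> 0"
  shows "posdef Z D \<or> posdef Z (\<lambda>a b. - D a b)"
proof (rule ccontr)
  assume neg: "\<not> ?thesis"
  have real: "qform Z D x = of_real (Re (qform Z D x))" for x
  proof -
    have "cnj (qform Z D x) = (\<Sum>a\<in>Z. \<Sum>b\<in>Z. x a * cnj (D a b) * cnj (x b))"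
      by (simp add: qform_def)
    also have "\<dots> = (\<Sum>b\<in>Z. \<Sum>a\<in>Z. x a * cnj (D a b) * cnj (x b))" by (rule sum.swap)
    also have "\<dots> = qform Z D x"
      unfolding qform_def
    proof (intro sum.cong refl)
      fix b a assume "b \<in> Z" "a \<in> Z"
      then have "cnj (D a b) = D b a" using herm[of b a] by simp
      then show "x a * cnj (D a b) * cnj (x b) = cnj (x b) * D b a * x a" by (simp add: mult_ac)
    qed
    finally show ?thesis by (simp add: complex_eq_iff)
  qed
  have m: "qform Z (\<lambda>a b. - D a b) x = - qform Z D x" for x by (simp add: qform_def sum_negf)
  obtain x y where x: "\<exists>j\<in>Z. x j \<noteq> 0" "Re (qform Z D x) \<le> 0" and y: "\<exists>j\<in>Z. y j \<noteq> 0" "Re (qform Z D y) \<ge> 0"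
    using neg unfolding posdef_def m by (auto simp: not_less)
  have x': "Re (qform Z D x) < 0" using x iso[OF x(1)] real[of x] by (metis of_real_0 order_le_less)
  have y': "Re (qform Z D y) > 0" using y iso[OF y(1)] real[of y] by (metis of_real_0 order_le_less)
  define p where "p s j = of_real (1 - s) * x j + of_real s * y j" for s :: real and j
  define q where "q s = Re (qform Z D (p s))" for s
  have "continuous_on {0..1} q"
    unfolding q_def qform_def p_def by (intro continuous_intros)
  moreover have p01: "p 0 = x" "p 1 = y" by (auto simp: p_def fun_eq_iff)
  moreover have q01: "q 0 < 0" "q 1 > 0" using x' y' by (simp_all add: q_def p01)
  ultimately obtain s where s: "0 \<le> s" "s \<le> 1" "q s = 0"
    using IVT'[of q 0 0 1] by force
  have "qform Z D (p s) = 0" using s(3) real[of "p s"] by (simp add: q_def)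
  then have z: "p s j = 0" if "j \<in> Z" for j using iso that by blast
  have s1: "s \<noteq> 1" using s q01 by auto
  \<comment> \<open>The zero found on the segment must be the zero vector on \<open>Z\<close>, so
    \<open>x\<close> and \<open>y\<close> are proportional there. Then the value at \<open>x\<close>
    is a nonnegative multiple of the value at \<open>y\<close>, against the opposite signs.\<close>
  define l where "l = complex_of_real (- s / (1 - s))"
  have xy: "x j = l * y j" if "j \<in> Z" for j
    using z[OF that] s1 unfolding p_def l_def by (simp add: field_simps)
  have "qform Z D x = qform Z D (\<lambda>j. l * y j)" by (rule qform_cong) (auto simp: xy)
  also have "\<dots> = (cnj l * l) * qform Z D y"
    unfolding qform_def sum_distrib_left by (intro sum.cong refl) (simp only: complex_cnj_mult mult_ac)
  also have "cnj l * l = of_real ((s / (1 - s))\<^sup>2)"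
    by (simp add: l_def power2_eq_square)
  finally have eq: "qform Z D x = of_real ((s / (1 - s))\<^sup>2) * qform Z D y" .
  have "Re (of_real c * w) = c * Re w" for c w by simp
  then have "Re (qform Z D x) = (s / (1 - s))\<^sup>2 * Re (qform Z D y)" unfolding eq .
  moreover have "0 \<le> (s / (1 - s))\<^sup>2 * Re (qform Z D y)" using y' by simp
  ultimately show False using x' by linarith
qed

section \<open>The ring of Laurent polynomials\<close>

lemma is_lpoly_zero: "is_lpoly 0"
  by (simp add: is_lpoly_def lp_support_def)

lemma is_lpoly_monom: "is_lpoly (fls_const c * fls_X_intpow k)"
proof -
  have "lp_support (fls_const c * fls_X_intpow k) \<subseteq> {k}"
    by (auto simp: lp_support_def fls_X_intpow_times_conv_shift mult.commute[of "fls_const c"])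
  then show ?thesis unfolding is_lpoly_def by (rule finite_subset) simp
qed

lemma is_lpoly_one: "is_lpoly 1"
  using is_lpoly_monom[of 1 0] by simp

lemma is_lpoly_add: "is_lpoly f \<Longrightarrow> is_lpoly g \<Longrightarrow> is_lpoly (f + g)"
  unfolding is_lpoly_def by (erule finite_subset[rotated, OF finite_UnI]) (auto simp: lp_support_def)

lemma is_lpoly_uminus: "is_lpoly f \<Longrightarrow> is_lpoly (- f)"
  by (simp add: is_lpoly_def lp_support_def)

lemma is_lpoly_diff: "is_lpoly f \<Longrightarrow> is_lpoly g \<Longrightarrow> is_lpoly (f - g)"
  using is_lpoly_add[of f "- g"] is_lpoly_uminus by simp

lemma fls_monom_nth:
  fixes c :: complex
  shows "fls_nth (fls_const c * fls_X_intpow k * g) n = c * fls_nth g (n - k)"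
  unfolding mult.assoc fls_X_intpow_times_conv_shift(1) by simp

lemma fls_monom_nth':
  fixes c :: complex
  shows "fls_nth (fls_const c * fls_X_intpow k) n = (if n = k then c else 0)"
  using fls_monom_nth[of c k 1 n] by simp

lemma lpoly_fls_expand:
  assumes "is_lpoly f"
  shows "f = (\<Sum>k\<in>lp_support f. fls_const (fls_nth f k) * fls_X_intpow k)"
proof -
  have fin: "finite (lp_support f)" using assms by (simp add: is_lpoly_def)
  have "fls_nth (\<Sum>k\<in>lp_support f. fls_const (fls_nth f k) * fls_X_intpow k) n = fls_nth f n" for n
  proof -
    have "fls_nth (\<Sum>k\<in>lp_support f. fls_const (fls_nth f k) * fls_X_intpow k) n = (\<Sum>k\<in>lp_support f. if n = k then fls_nth f k else 0)"
    by (simp only: fls_nth_sum fls_monom_nth')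
  also have "\<dots> = fls_nth f n"
    using fin by (simp add: sum.delta lp_support_def)
  finally show ?thesis .
  qed
  then show ?thesis by (intro fls_eqI) simp
qed

lemma lpoly_fls_times_nth:
  assumes "is_lpoly f"
  shows "fls_nth (f * g) n = (\<Sum>k\<in>lp_support f. fls_nth f k * fls_nth g (n - k))"
proof -
  have "f * g = (\<Sum>k\<in>lp_support f. fls_const (fls_nth f k) * fls_X_intpow k * g)"
    by (subst lpoly_fls_expand[OF assms]) (simp add: sum_distrib_right)
  then show ?thesis by (simp only: fls_nth_sum fls_monom_nth)
qed

lemma is_lpoly_mult:
  assumes "is_lpoly f" "is_lpoly g"
  shows "is_lpoly (f * g)"
proof -
  have "lp_support (f * g) \<subseteq> (\<lambda>(a,b). a + b) ` (lp_support f \<times> lp_support g)"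
  proof
    fix n assume "n \<in> lp_support (f * g)"
    then obtain k where "k \<in> lp_support f" "fls_nth f k * fls_nth g (n - k) \<noteq> 0"
      unfolding lp_support_def using lpoly_fls_times_nth[OF assms(1), of g n]
      by (auto simp: lp_support_def elim: sum.not_neutral_contains_not_neutral)
    then have "(k, n - k) \<in> lp_support f \<times> lp_support g" by (auto simp: lp_support_def)
    then show "n \<in> (\<lambda>(a,b). a + b) ` (lp_support f \<times> lp_support g)" by force
  qed
  then show ?thesis
    using assms finite_subset unfolding is_lpoly_def by blast
qed

lemma lp_star_nth:
  assumes "is_lpoly f"
  shows "fls_nth (lp_star f) n = cnj (fls_nth f (- n))"
proof -
  have fin: "finite (lp_support f)" using assms by (simp add: is_lpoly_def)
  have "fls_nth (lp_star f) n = (\<Sum>k\<in>lp_support f. if - n = k then cnj (fls_nth f k) else 0)"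
    unfolding lp_star_def fls_nth_sum fls_monom_nth' by (intro sum.cong refl) auto
  then show ?thesis using fin by (simp add: sum.delta lp_support_def)
qed

lemma is_lpoly_star:
  assumes "is_lpoly f"
  shows "is_lpoly (lp_star f)"
proof -
  have "lp_support (lp_star f) \<subseteq> uminus ` lp_support f"
    using lp_star_nth[OF assms] by (force simp: lp_support_def)
  then show ?thesis using assms finite_subset unfolding is_lpoly_def by blast
qed

text \<open>\<open>lp_star\<close> and \<open>lp_eval\<close> sum over the support and are additive
  and multiplicative only when it is finite. On a type of their own, Laurent polynomials form an
  integral domain on which the star, and evaluation at nonzero points, are ring homomorphisms that
  commute with determinants.\<close>

typedef lpoly = "{f. is_lpoly f}" morphisms fls_of lpoly_of
  using is_lpoly_zero by auto

setup_lifting type_definition_lpoly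

instantiation lpoly :: idom
begin
lift_definition zero_lpoly :: lpoly is 0 by (rule is_lpoly_zero)
lift_definition one_lpoly :: lpoly is 1 by (rule is_lpoly_one)
lift_definition plus_lpoly :: "lpoly \<Rightarrow> lpoly \<Rightarrow> lpoly" is plus by (rule is_lpoly_add)
lift_definition minus_lpoly :: "lpoly \<Rightarrow> lpoly \<Rightarrow> lpoly" is minus by (rule is_lpoly_diff)
lift_definition uminus_lpoly :: "lpoly \<Rightarrow> lpoly" is uminus by (rule is_lpoly_uminus)
lift_definition times_lpoly :: "lpoly \<Rightarrow> lpoly \<Rightarrow> lpoly" is times by (rule is_lpoly_mult)
instance by standard (transfer; simp add: algebra_simps)+
end

section \<open>Coefficients, star and evaluation on the type of Laurent polynomials\<close>

lift_definition lcoeff :: "lpoly \<Rightarrow> int \<Rightarrow> complex" is fls_nth .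
lift_definition lstar :: "lpoly \<Rightarrow> lpoly" is lp_star by (rule is_lpoly_star)
lift_definition leval :: "complex \<Rightarrow> lpoly \<Rightarrow> complex" is "\<lambda>z f. lp_eval f z" .
lift_definition lmonom :: "complex \<Rightarrow> int \<Rightarrow> lpoly" is "\<lambda>c k. fls_const c * fls_X_intpow k"
  by (rule is_lpoly_monom)

abbreviation lsupp :: "lpoly \<Rightarrow> int set" where "lsupp f \<equiv> {k. lcoeff f k \<noteq> 0}"

lemma finite_lsupp [simp]: "finite (lsupp f)"
  by transfer (simp add: is_lpoly_def lp_support_def)

lemma lpoly_eqI: "(\<And>k. lcoeff f k = lcoeff g k) \<Longrightarrow> f = g"
  by transfer (rule fls_eqI)

lemma lcoeff_simps [simp]:
  "lcoeff 0 k = 0" "lcoeff 1 k = (if k = 0 then 1 else 0)"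
  "lcoeff (f + g) k = lcoeff f k + lcoeff g k" "lcoeff (f - g) k = lcoeff f k - lcoeff g k"
  "lcoeff (- f) k = - lcoeff f k" "lcoeff (lstar f) k = cnj (lcoeff f (- k))"
  "lcoeff (lmonom c m) k = (if k = m then c else 0)"
  "lcoeff (lmonom c m * f) k = c * lcoeff f (k - m)"
  by (transfer; simp add: lp_star_nth fls_monom_nth fls_monom_nth')+

lemma lcoeff_sum [simp]: "lcoeff (\<Sum>x\<in>S. f x) k = (\<Sum>x\<in>S. lcoeff (f x) k)"
  by (induction S rule: infinite_finite_induct) auto

lemma lcoeff_mult: "lcoeff (f * g) n = (\<Sum>k\<in>lsupp f. lcoeff f k * lcoeff g (n - k))"
  by transfer (simp add: lpoly_fls_times_nth flip: lp_support_def)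

lemma lpoly_expand:
  assumes "finite S" "lsupp f \<subseteq> S"
  shows "f = (\<Sum>k\<in>S. lmonom (lcoeff f k) k)"
proof (rule lpoly_eqI)
  fix n
  have "lcoeff (\<Sum>k\<in>S. lmonom (lcoeff f k) k) n = (\<Sum>k\<in>S. if k = n then lcoeff f k else 0)"
    unfolding lcoeff_sum by (intro sum.cong refl) auto
  then show "lcoeff f n = lcoeff (\<Sum>k\<in>S. lmonom (lcoeff f k) k) n"
    using assms by (auto simp: sum.delta)
qed

lemma lmonom_simps [simp]:
  "lmonom a i * lmonom b j = lmonom (a * b) (i + j)" "lmonom 0 i = 0" "lmonom 1 0 = 1"
  "lstar (lmonom a i) = lmonom (cnj a) (- i)"
  by (rule lpoly_eqI; auto)+

lemma leval_sum_eq: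
  assumes "finite S" "lsupp f \<subseteq> S"
  shows "leval z f = (\<Sum>k\<in>S. lcoeff f k * z powi k)"
proof -
  have "leval z f = (\<Sum>k\<in>lsupp f. lcoeff f k * z powi k)"
    by transfer (simp add: lp_eval_def lp_support_def)
  also have "\<dots> = (\<Sum>k\<in>S. lcoeff f k * z powi k)"
    by (rule sum.mono_neutral_left) (use assms in auto)
  finally show ?thesis .
qed

lemma leval_add: "leval z (f + g) = leval z f + leval z g"
proof -
  define S where "S = lsupp f \<union> lsupp g"
  have "finite S" "lsupp f \<subseteq> S" "lsupp g \<subseteq> S" "lsupp (f + g) \<subseteq> S" by (auto simp: S_def)
  then show ?thesis
    by (simp add: leval_sum_eq[of S] algebra_simps sum.distrib)
qed

lemma leval_zero: "leval z 0 = 0"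
  using leval_sum_eq[of "{}" 0 z] by simp

lemma leval_monom [simp]: "leval z (lmonom c k) = c * z powi k"
  by (subst leval_sum_eq[of "{k}"]) auto

lemma leval_one: "leval z 1 = 1"
  using leval_monom[of z 1 0] by simp

lemma leval_sum: "leval z (\<Sum>x\<in>S. f x) = (\<Sum>x\<in>S. leval z (f x))"
  by (induction S rule: infinite_finite_induct) (auto simp: leval_add leval_zero)

lemma leval_monom_mult:
  assumes "z \<noteq> 0"
  shows "leval z (lmonom c k * f) = c * z powi k * leval z f"
proof -
  have "leval z (lmonom c k * f) = (\<Sum>j\<in>(\<lambda>i. i + k) ` lsupp f. lcoeff (lmonom c k * f) j * z powi j)"
    by (rule leval_sum_eq) (auto simp: image_iff intro!: exI[of _ "_ - k"])
  also have "\<dots> = (\<Sum>i\<in>lsupp f. c * lcoeff f i * z powi (i + k))"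
    by (subst sum.reindex) (auto simp: inj_on_def)
  also have "\<dots> = c * z powi k * leval z f"
    unfolding leval_sum_eq[OF finite_lsupp order_refl, of z f] sum_distrib_left
    by (intro sum.cong refl) (use assms in \<open>simp add: power_int_add mult_ac\<close>)
  finally show ?thesis .
qed

lemma leval_mult:
  assumes "z \<noteq> 0"
  shows "leval z (f * g) = leval z f * leval z g"
proof -
  have "f * g = (\<Sum>k\<in>lsupp f. lmonom (lcoeff f k) k * g)"
    by (subst lpoly_expand[OF finite_lsupp order_refl, of f]) (simp add: sum_distrib_right)
  then have "leval z (f * g) = (\<Sum>k\<in>lsupp f. lcoeff f k * z powi k * leval z g)"
    using assms by (simp add: leval_sum leval_monom_mult)
  then show ?thesis
    unfolding leval_sum_eq[OF finite_lsupp order_refl, of z f] by (simp add: sum_distrib_right)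
qed

lemma leval_hom: "z \<noteq> 0 \<Longrightarrow> comm_ring_hom (leval z)"
  by unfold_locales (auto simp: leval_add leval_mult leval_zero leval_one)

lemma lstar_lstar [simp]: "lstar (lstar f) = f"
  by (rule lpoly_eqI) simp

lemma lstar_mult: "lstar (f * g) = lstar f * lstar g"
proof (rule lpoly_eqI)
  fix n
  have "lcoeff (lstar (f * g)) n = (\<Sum>k\<in>lsupp f. cnj (lcoeff f k) * cnj (lcoeff g (- n - k)))"
    by (simp add: lcoeff_mult)
  also have "\<dots> = (\<Sum>k\<in>lsupp (lstar f). lcoeff (lstar f) k * lcoeff (lstar g) (n - k))"
    by (rule sum.reindex_bij_witness[of _ uminus uminus]) auto
  finally show "lcoeff (lstar (f * g)) n = lcoeff (lstar f * lstar g) n"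
    by (simp only: lcoeff_mult)
qed

interpretation lstar_hom: comm_ring_hom lstar
  by unfold_locales (auto simp: lstar_mult intro!: lpoly_eqI)

interpretation fls_of_hom: comm_ring_hom fls_of
  by unfold_locales (transfer; simp)+

text \<open>Consequently the zeros of a Hermitian Laurent polynomial are symmetric under reflection
  in the circle.\<close>

lemma leval_lstar_gen: "z \<noteq> 0 \<Longrightarrow> leval z (lstar f) = cnj (leval (inverse (cnj z)) f)"
proof -
  assume z: "z \<noteq> 0"
  have "leval z (lstar f) = (\<Sum>k\<in>uminus ` lsupp f. lcoeff (lstar f) k * z powi k)"
    by (rule leval_sum_eq) (auto simp: image_iff intro!: exI[of _ "- _"])
  also have "\<dots> = (\<Sum>k\<in>lsupp f. cnj (lcoeff f k) * z powi (- k))"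
    by (subst sum.reindex) (auto simp: inj_on_def)
  also have "\<dots> = cnj (leval (inverse (cnj z)) f)"
    unfolding leval_sum_eq[OF finite_lsupp order_refl, of _ f] cnj_sum
    by (intro sum.cong refl) (simp add: power_int_minus power_int_inverse)
  finally show ?thesis .
qed

lemma leval_lstar: "cmod z = 1 \<Longrightarrow> leval z (lstar f) = cnj (leval z f)"
proof -
  assume z: "cmod z = 1"
  then have nz: "z \<noteq> 0" by auto
  have "z * cnj z = 1" using z complex_norm_square[of z] by simp
  then have "inverse (cnj z) = z" using nz by (simp add: field_simps)
  then show ?thesis using leval_lstar_gen[OF nz, of f] by simp
qed

lemma tendsto_leval:
  assumes "(g \<longlongrightarrow> z) F" "z \<noteq> 0"
  shows "((\<lambda>t. leval (g t) f) \<longlongrightarrow> leval z f) F"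
  unfolding leval_sum_eq[OF finite_lsupp order_refl, of _ f]
  by (intro tendsto_sum tendsto_mult tendsto_const tendsto_power_int assms)

lemma leval_hermitian_real:
  "lstar f = f \<Longrightarrow> cmod z = 1 \<Longrightarrow> leval z f = of_real (Re (leval z f))"
  using leval_lstar[of z f] by (simp add: complex_eq_iff)

definition lconst :: "complex \<Rightarrow> lpoly" where "lconst c = lmonom c 0"

interpretation lconst_hom: comm_ring_hom lconst
  by unfold_locales (auto simp: lconst_def intro!: lpoly_eqI)

lemma lstar_lconst [simp]: "lstar (lconst c) = lconst (cnj c)"
  by (simp add: lconst_def)

lemma leval_lconst [simp]: "leval z (lconst c) = c"
  by (simp add: lconst_def)

lemma lcoeff_lconst [simp]: "lcoeff (lconst c) k = (if k = 0 then c else 0)"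
  by (simp add: lconst_def)

lemma lconst_eq_0_iff [simp]: "lconst c = 0 \<longleftrightarrow> c = 0"
proof
  assume "lconst c = 0"
  then have "lcoeff (lconst c) 0 = 0" by simp
  then show "c = 0" by simp
qed simp

section \<open>Linear factors and roots\<close>

definition lroot :: "complex \<Rightarrow> lpoly" where "lroot a = lmonom 1 1 - lconst a"

lemma leval_lroot [simp]: "leval z (lroot a) = z - a"
proof -
  have "lroot a = lmonom 1 1 + lmonom (- a) 0" by (rule lpoly_eqI) (auto simp: lroot_def)
  then show ?thesis by (simp add: leval_add)
qed

text \<open>For nonnegative \<open>k\<close> this is the factorization of a difference of powers; a
  negative exponent is reduced to it by a unit monomial factor.\<close>

lemma lroot_dvd_monom:
  assumes "a \<noteq> 0"
  shows "lroot a dvd lmonom 1 k - lconst (a powi k)"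
proof -
  have pow: "lmonom 1 (int n) = lmonom 1 1 ^ n" for n
  proof (induction n)
    case (Suc n)
    have "lmonom 1 (int (Suc n)) = lmonom 1 1 * lmonom 1 (int n)" by simp
    then show ?case using Suc by simp
  qed simp
  have cpow: "lconst (a ^ n) = lconst a ^ n" for n
    by (simp add: lconst_hom.hom_power)
  have nat: "lroot a dvd lmonom 1 (int n) - lconst (a ^ n)" for n
    unfolding pow cpow lroot_def by (metis dvd_triv_left power_diff_sumr2)
  show ?thesis
  proof (cases "k \<ge> 0")
    case True
    then show ?thesis using nat[of "nat k"] by (simp add: power_int_def)
  next
    case False
    define n where "n = nat (- k)"
    have k: "k = - int n" using False by (simp add: n_def)
    have "lmonom 1 k - lconst (a powi k) =
       (lmonom 1 (int n) - lconst (a ^ n)) * lmonom (- inverse (a ^ n)) (- int n)"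
      using assms by (intro lpoly_eqI) (auto simp: k algebra_simps lconst_def power_int_minus)
    then show ?thesis using nat[of n] by simp
  qed
qed

lemma lroot_dvd:
  assumes "a \<noteq> 0" "leval a f = 0"
  shows "lroot a dvd f"
proof -
  have e: "f = (\<Sum>k\<in>lsupp f. lmonom (lcoeff f k) k)"
    by (rule lpoly_expand) auto
  have "(\<Sum>k\<in>lsupp f. lconst (lcoeff f k) * lconst (a powi k)) = lconst (leval a f)"
    unfolding leval_sum_eq[OF finite_lsupp order_refl, of a f]
    by (simp add: lconst_hom.hom_sum lconst_hom.hom_mult)
  then have "f = (\<Sum>k\<in>lsupp f. lconst (lcoeff f k) * (lmonom 1 k - lconst (a powi k)))"
    using assms e by (simp add: right_diff_distrib sum_subtractf) (simp add: lconst_def)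
  also have "lroot a dvd \<dots>"
    by (intro dvd_sum dvd_mult lroot_dvd_monom assms)
  finally show ?thesis .
qed

text \<open>Clearing denominators. When \<open>m\<close> is the least exponent, \<open>p\<close> has
  a nonzero constant term.\<close>

lemma lpoly_as_poly:
  assumes m: "\<And>k. lcoeff f k \<noteq> 0 \<Longrightarrow> m \<le> k"
  obtains p where "\<And>j. j \<ge> m \<Longrightarrow> Polynomial.coeff p (nat (j - m)) = lcoeff f j"
    and "\<And>z. z \<noteq> 0 \<Longrightarrow> leval z f = z powi m * poly p z"
proof -
  define p where "p = (\<Sum>k\<in>lsupp f. Polynomial.monom (lcoeff f k) (nat (k - m)))"
  have cp: "Polynomial.coeff p (nat (j - m)) = lcoeff f j" if "j \<ge> m" for j
  proof -
    have "Polynomial.coeff p (nat (j - m)) = (\<Sum>k\<in>lsupp f. if k = j then lcoeff f k else 0)"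
      unfolding p_def coeff_sum
    proof (intro sum.cong refl)
      fix k assume "k \<in> lsupp f"
      then have "nat (k - m) = nat (j - m) \<longleftrightarrow> k = j" using m[of k] that by auto
      then show "Polynomial.coeff (Polynomial.monom (lcoeff f k) (nat (k - m))) (nat (j - m)) = (if k = j then lcoeff f k else 0)"
        by auto
    qed
    then show ?thesis by (simp add: sum.delta)
  qed
  have "leval z f = z powi m * poly p z" if z: "z \<noteq> 0" for z
    unfolding leval_sum_eq[OF finite_lsupp order_refl, of z f] p_def poly_sum sum_distrib_left
  proof (intro sum.cong refl)
    fix k assume "k \<in> lsupp f"
    then have "z powi k = z powi m * z ^ nat (k - m)"
      using m[of k] z by (simp flip: power_int_of_nat power_int_add)
    then show "lcoeff f k * z powi k = z powi m * poly (Polynomial.monom (lcoeff f k) (nat (k - m))) z"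
      by (simp add: poly_monom)
  qed
  then show ?thesis using that cp by blast
qed

lemma lsupp_Min:
  assumes "f \<noteq> 0"
  obtains m where "lcoeff f m \<noteq> 0" "\<And>k. lcoeff f k \<noteq> 0 \<Longrightarrow> m \<le> k"
proof -
  have ne: "lsupp f \<noteq> {}" using assms lpoly_eqI[of f 0] by auto
  show ?thesis
    by (rule that[of "Min (lsupp f)"]) (use Min_in[OF finite_lsupp ne] Min_le[OF finite_lsupp] in auto)
qed

text \<open>After dividing by the lowest power, a Laurent polynomial with two terms becomes an
  ordinary polynomial of positive degree with nonzero constant term; the root from the fundamental
  theorem of algebra is then nonzero.\<close>

lemma lpoly_root_exists:
  assumes "lcoeff f k \<noteq> 0" "lcoeff f l \<noteq> 0" "k < l"
  shows "\<exists>a. a \<noteq> 0 \<and> leval a f = 0"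
proof -
  have "f \<noteq> 0" using assms by auto
  then obtain m where m: "lcoeff f m \<noteq> 0" "\<And>k. lcoeff f k \<noteq> 0 \<Longrightarrow> m \<le> k"
    using lsupp_Min by blast
  obtain p where cp: "\<And>j. j \<ge> m \<Longrightarrow> Polynomial.coeff p (nat (j - m)) = lcoeff f j"
    and ev: "\<And>z. z \<noteq> 0 \<Longrightarrow> leval z f = z powi m * poly p z"
    using lpoly_as_poly[OF m(2)] by blast
  have "m \<le> k" "m \<le> l" using assms m by auto
  then have "Polynomial.coeff p (nat (l - m)) \<noteq> 0" "nat (l - m) > 0" using cp[of l] assms by auto
  then have "degree p > 0" using le_degree[of p "nat (l - m)"] by linarith
  then have "\<not> constant (poly p)" by (simp add: constant_degree)
  then obtain a where a: "poly p a = 0" using fundamental_theorem_of_algebra by blast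
  have "poly p 0 \<noteq> 0" using cp[of m] m by (simp add: poly_0_coeff_0)
  then have "a \<noteq> 0" using a by auto
  then show ?thesis using ev a by auto
qed

lemma finite_lpoly_roots:
  assumes "f \<noteq> 0"
  shows "finite {z. z \<noteq> 0 \<and> leval z f = 0}"
proof -
  obtain m where m: "lcoeff f m \<noteq> 0" "\<And>k. lcoeff f k \<noteq> 0 \<Longrightarrow> m \<le> k"
    using lsupp_Min[OF assms] by blast
  obtain p where cp: "\<And>j. j \<ge> m \<Longrightarrow> Polynomial.coeff p (nat (j - m)) = lcoeff f j"
    and ev: "\<And>z. z \<noteq> 0 \<Longrightarrow> leval z f = z powi m * poly p z"
    using lpoly_as_poly[OF m(2)] by blast
  have "p \<noteq> 0" using cp[of m] m by auto
  then have "finite {z. poly p z = 0}" by (rule poly_roots_finite)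
  moreover have "{z. z \<noteq> 0 \<and> leval z f = 0} \<subseteq> {z. poly p z = 0}" using ev by auto
  ultimately show ?thesis by (rule finite_subset[rotated])
qed

text \<open>The support is symmetric about 0, so an exponent \<open>k \<noteq> 0\<close> would come
  with \<open>- k\<close>, and two exponents already force a nonzero root.\<close>

lemma hermitian_lpoly_const:
  assumes "lstar f = f" "f \<noteq> 0" "\<And>z. z \<noteq> 0 \<Longrightarrow> leval z f \<noteq> 0"
  shows "\<exists>c::real. c \<noteq> 0 \<and> f = lconst (of_real c)"
proof -
  have sym: "cnj (lcoeff f (- k)) = lcoeff f k" for k
    using arg_cong[OF assms(1), of "\<lambda>f. lcoeff f k"] by simp
  have z: "lcoeff f k = 0" if "k \<noteq> 0" for k
  proof (rule ccontr)
    assume "lcoeff f k \<noteq> 0"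
    then have "lcoeff f (- k) \<noteq> 0" using sym[of k] by auto
    then show False
      using lpoly_root_exists[of f k "- k"] lpoly_root_exists[of f "- k" k] \<open>lcoeff f k \<noteq> 0\<close> assms(3) that
      by (metis neg_less_iff_less equal_neg_zero linorder_less_linear)
  qed
  have "lcoeff f 0 = of_real (Re (lcoeff f 0))"
    using sym[of 0] by (simp add: complex_eq_iff)
  then have "f = lconst (of_real (Re (lcoeff f 0)))"
    by (intro lpoly_eqI) (auto simp: z)
  then show ?thesis using assms(2) by (intro exI[of _ "Re (lcoeff f 0)"]) auto
qed

section \<open>Laurent polynomials with prescribed signs on the circle\<close>

text \<open>The boolean function comparing \<open>g\<close> with the fixed value \<open>g x\<close>
  is continuous on a connected interval; passing to it avoids a topology on the value type.\<close>

lemma locally_constant_interval: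
  fixes g :: "real \<Rightarrow> 'a"
  assumes "\<And>t. a < t \<Longrightarrow> t < b \<Longrightarrow> \<forall>\<^sub>F s in at t. g s = g t"
    and "a < x" "x < b" "a < y" "y < b"
  shows "g x = g y"
proof -
  have "continuous_on {a<..<b} (\<lambda>s. g s = g x)"
    unfolding continuous_on_def
  proof
    fix t assume t: "t \<in> {a<..<b}"
    then have "\<forall>\<^sub>F s in at t within {a<..<b}. g s = g t"
      using assms(1)[of t] eventually_at_filter by (auto simp: eventually_at_filter elim: eventually_mono)
    then show "((\<lambda>s. g s = g x) \<longlongrightarrow> (g t = g x)) (at t within {a<..<b})"
      unfolding tendsto_discrete by eventually_elim simp
  qed
  then obtain c where "\<forall>s\<in>{a<..<b}. (g s = g x) = c"
    using connectedD_const[of "{a<..<b}" "\<lambda>s. g s = g x"] connected_Ioo by blast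
  then show ?thesis using assms(2-5) by (metis greaterThanLessThan_iff)
qed

text \<open>Nearby points of the circle are reached by rotation, which puts every \<open>z\<close>
  at angle 0 of its own coordinate. The filter is punctured, but the comparison is with the value at
  \<open>z\<close> itself.\<close>

definition circle_lc :: "(complex \<Rightarrow> 'a) \<Rightarrow> complex \<Rightarrow> bool" where
  "circle_lc \<sigma> z \<longleftrightarrow> (\<forall>\<^sub>F t in at (0::real). \<sigma> (z * cis t) = \<sigma> z)"

lemma circle_lc_arc:
  assumes "\<And>t. a < t \<Longrightarrow> t < b \<Longrightarrow> circle_lc \<sigma> (z * cis t)"
    and "a < x" "x < b" "a < y" "y < b"
  shows "\<sigma> (z * cis x) = \<sigma> (z * cis y)"
proof (rule locally_constant_interval[where g = "\<lambda>t. \<sigma> (z * cis t)", OF _ assms(2-5)])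
  fix t assume "a < t" "t < b"
  then obtain d where d: "d > 0" "\<And>s. s \<noteq> 0 \<Longrightarrow> \<bar>s\<bar> < d \<Longrightarrow> \<sigma> (z * cis t * cis s) = \<sigma> (z * cis t)"
    using assms(1)[of t] unfolding circle_lc_def eventually_at by (auto simp: dist_real_def)
  have "\<sigma> (z * cis s) = \<sigma> (z * cis t)" if "s \<noteq> t" "dist s t < d" for s
    using d(2)[of "s - t"] that by (simp add: dist_real_def mult.assoc cis_mult)
  then show "\<forall>\<^sub>F s in at t. \<sigma> (z * cis s) = \<sigma> (z * cis t)"
    unfolding eventually_at using d(1) by (intro exI[of _ d]) auto
qed

lemma cis_neq_1: "0 < \<bar>t\<bar> \<Longrightarrow> \<bar>t\<bar> < 2 * pi \<Longrightarrow> cis t \<noteq> 1"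
proof
  assume t: "0 < \<bar>t\<bar>" "\<bar>t\<bar> < 2 * pi" and "cis t = 1"
  then have "cos t = 1" by (metis cis.simps(1) one_complex.simps(1))
  then have "cos \<bar>t\<bar> = 1" by (simp add: abs_if)
  then have "1 - 2 * (sin (\<bar>t\<bar> / 2))\<^sup>2 = 1" using cos_double_sin[of "\<bar>t\<bar> / 2"] by simp
  moreover have "sin (\<bar>t\<bar> / 2) > 0" using t by (intro sin_gt_zero) auto
  ultimately show False by simp
qed

lemma tendsto_mult_cis: "((\<lambda>t. z * cis t) \<longlongrightarrow> z) (at (0::real))"
proof -
  have "cis = (\<lambda>t. exp (\<i> * of_real t))" by (rule ext) (simp add: cis_conv_exp)
  moreover have "isCont (\<lambda>t. exp (\<i> * complex_of_real t)) 0" by (intro continuous_intros)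
  ultimately have "isCont cis 0" by (simp only:)
  then have "(cis \<longlongrightarrow> cis 0) (at 0)" by (simp only: isCont_def)
  then show ?thesis using tendsto_mult[OF tendsto_const[of z] , of cis "cis 0"] by simp
qed

lemma eventually_circle_avoids:
  assumes "cmod z = 1" "finite F"
  shows "\<forall>\<^sub>F t in at (0::real). z * cis t \<notin> F"
proof -
  have "\<forall>\<^sub>F t in at (0::real). z * cis t \<noteq> f" for f
  proof (cases "f = z")
    case True
    have "\<forall>\<^sub>F t in at (0::real). t \<noteq> 0 \<and> \<bar>t\<bar> < 2 * pi"
      unfolding eventually_at by (intro exI[of _ "2 * pi"]) (auto simp: dist_real_def)
    then show ?thesis
    proof eventually_elim
      case (elim t)
      then have "cis t \<noteq> 1" by (intro cis_neq_1) auto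
      moreover have "z \<noteq> 0" using assms(1) by auto
      ultimately show ?case using True by (metis mult_cancel_left2)
    qed
  next
    case False
    then show ?thesis using tendsto_imp_eventually_ne[OF tendsto_mult_cis[of z], of f] by auto
  qed
  then have "\<forall>\<^sub>F t in at (0::real). \<forall>f\<in>F. z * cis t \<noteq> f"
    by (intro eventually_ball_finite assms) auto
  then show ?thesis by eventually_elim auto
qed

lemma circle_quotient_arg:
  assumes "cmod z = 1" "cmod w = 1"
  obtains t where "w = z * cis t" "- pi < t" "t \<le> pi" "w \<noteq> z \<Longrightarrow> t \<noteq> 0"
proof -
  have "w = z * cis (Arg (w / z))"
    using assms by (subst cis_Arg) (auto simp: norm_divide sgn_div_norm)
  then show ?thesis using that[of "Arg (w / z)"] Arg_bounded[of "w / z"] by (metis cis_zero mult.right_neutral)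
qed

lemma sin_half_neq_0: "t \<noteq> 0 \<Longrightarrow> \<bar>t\<bar> < 2 * pi \<Longrightarrow> sin (t / 2) \<noteq> 0"
proof -
  assume "t \<noteq> 0" "\<bar>t\<bar> < 2 * pi"
  then have "sin (\<bar>t\<bar> / 2) > 0" by (intro sin_gt_zero) auto
  then show ?thesis by (auto simp: abs_if split: if_splits)
qed

text \<open>Sign changes on the circle come in pairs, since a single factor
  \<open>sin (t / 2)\<close> is not single valued there. The product of two half-angle sines is
  \<open>cos (\<theta> / 2) - cos (t - \<theta> / 2)\<close>, and the second cosine is the real part
  of the point against the arc midpoint \<open>u\<close>; this gives the three coefficients of
  \<open>q\<close>.\<close>

lemma two_root_lpoly:
  assumes "cmod z = 1"
  obtains q where "lstar q = q"
    and "\<And>t. Re (leval (z * cis t) q) = 2 * sin (t / 2) * sin ((t - \<theta>) / 2)"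
proof -
  define u where "u = z * cis (\<theta> / 2)"
  define q where "q = lconst (of_real (cos (\<theta> / 2))) + (lmonom (- cnj u / 2) 1 + lmonom (- u / 2) (- 1))"
  have "lstar q = q" by (simp add: q_def lstar_hom.hom_add add.commute)
  moreover have "Re (leval (z * cis t) q) = 2 * sin (t / 2) * sin ((t - \<theta>) / 2)" for t
  proof -
    have zz: "z * cnj z = 1" using assms complex_norm_square[of z] by simp
    have nz: "z \<noteq> 0" using assms by auto
    have inv: "inverse (z * cis t) = cnj z * cis (- t)"
    proof (rule inverse_unique)
      show "z * cis t * (cnj z * cis (- t)) = 1"
        using zz cis_mult[of t "- t"] by (simp add: mult_ac)
    qed
    have 1: "z * cis t * cnj u = cis (t - \<theta> / 2)"
      using zz cis_mult[of t "- (\<theta> / 2)"] by (simp add: u_def cis_cnj mult_ac)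
    have 2: "inverse (z * cis t) * u = cis (\<theta> / 2 - t)"
    proof -
      have "inverse (z * cis t) * u = (z * cnj z) * (cis (\<theta> / 2) * cis (- t))"
        unfolding inv u_def by (simp only: mult_ac)
      then show ?thesis unfolding zz cis_mult by simp
    qed
    have "leval (z * cis t) q = of_real (cos (\<theta> / 2)) - (z * cis t * cnj u) / 2 - (inverse (z * cis t) * u) / 2"
      by (simp add: q_def leval_add power_int_minus field_simps del: inverse_mult_distrib)
    then have "Re (leval (z * cis t) q) = cos (\<theta> / 2) - cos (t - \<theta> / 2) / 2 - cos (\<theta> / 2 - t) / 2"
      unfolding 1 2 by simp
    also have "cos (\<theta> / 2 - t) = cos (t - \<theta> / 2)" by (metis cos_minus minus_diff_eq)
    finally have "Re (leval (z * cis t) q) = cos (\<theta> / 2) - cos (t - \<theta> / 2)" by simp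
    moreover have "cos (t / 2 - (t - \<theta>) / 2) = cos (\<theta> / 2)" "cos (t / 2 + (t - \<theta>) / 2) = cos (t - \<theta> / 2)"
      by (intro arg_cong[where f = cos]; simp add: field_simps)+
    ultimately show ?thesis
      using sin_times_sin[of "t / 2" "(t - \<theta>) / 2"] by (simp add: field_simps)
  qed
  ultimately show ?thesis using that by blast
qed

text \<open>Jump points are removed one at a time; a jump at \<open>z\<close> is cancelled by a factor
  changing sign exactly at \<open>z\<close> and at one other exceptional point. A single exceptional point
  carries no jump, since the circle minus a point is connected.\<close>

lemma lpoly_with_signs:
  fixes \<sigma> :: "complex \<Rightarrow> real"
  assumes "finite Z"
    and "\<And>z. cmod z = 1 \<Longrightarrow> z \<notin> Z \<Longrightarrow> \<sigma> z = 1 \<or> \<sigma> z = - 1"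
    and "\<And>z. cmod z = 1 \<Longrightarrow> z \<notin> Z \<Longrightarrow> circle_lc \<sigma> z"
  shows "\<exists>b. lstar b = b \<and> (\<forall>z. cmod z = 1 \<longrightarrow> z \<notin> Z \<longrightarrow> Re (leval z b) * \<sigma> z > 0)"
  using assms
proof (induction Z arbitrary: \<sigma> rule: finite_induct)
  case empty
  have "\<sigma> z = \<sigma> 1" if z: "cmod z = 1" for z
  proof -
    obtain t where t: "z = 1 * cis t" "- pi < t" "t \<le> pi"
      using circle_quotient_arg[of 1 z] z norm_one by metis
    \<comment> \<open>The interval ends at \<open>2 * pi\<close> because \<open>t = pi\<close> has
      to be an interior point.\<close>
    have "\<sigma> (1 * cis t) = \<sigma> (1 * cis 0)"
      by (rule circle_lc_arc[of "- pi" "2 * pi"]) (use empty.prems t pi_gt_zero in \<open>auto simp del: pi_gt_zero\<close>)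
    then show ?thesis using t by simp
  qed
  note const = this
  have pos: "\<sigma> 1 * \<sigma> 1 > 0" using empty.prems(1)[of 1] by auto
  show ?case
  proof (intro exI[of _ "lconst (of_real (\<sigma> 1))"] conjI allI impI)
    fix z assume "cmod z = 1"
    then have "\<sigma> z = \<sigma> 1" by (rule const)
    then show "0 < Re (leval z (lconst (of_real (\<sigma> 1)))) * \<sigma> z" using pos by simp
  qed simp
next
  case (insert z1 Z)
  show ?case
  proof (cases "cmod z1 = 1")
    case False
    then have ne: "z \<noteq> z1" if "cmod z = 1" for z using that by auto
    have "\<exists>b. lstar b = b \<and> (\<forall>z. cmod z = 1 \<longrightarrow> z \<notin> Z \<longrightarrow> Re (leval z b) * \<sigma> z > 0)"
      by (rule insert.IH) (use insert.prems ne in auto)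
    then show ?thesis by auto
  next
    case z1: True
    have fin: "finite (insert z1 Z)" using insert.hyps by simp
    obtain \<epsilon>0 where e0: "\<epsilon>0 > 0" "\<And>t. t \<noteq> 0 \<Longrightarrow> \<bar>t\<bar> < \<epsilon>0 \<Longrightarrow> z1 * cis t \<notin> insert z1 Z"
      using eventually_circle_avoids[OF z1 fin] unfolding eventually_at by (auto simp: dist_real_def)
    define \<epsilon> where "\<epsilon> = min \<epsilon>0 pi"
    have e: "\<epsilon> > 0" "\<epsilon> \<le> pi" "\<And>t. t \<noteq> 0 \<Longrightarrow> \<bar>t\<bar> < \<epsilon> \<Longrightarrow> z1 * cis t \<notin> insert z1 Z"
      using e0 pi_gt_zero by (auto simp: \<epsilon>_def)
    have n1: "cmod (z1 * cis t) = 1" for t using z1 by (simp add: norm_mult)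
    have off: "circle_lc \<sigma> (z1 * cis t)" if "t \<noteq> 0" "\<bar>t\<bar> < \<epsilon>" for t
      using insert.prems(2)[OF n1 e(3)[OF that]] .
    \<comment> \<open>\<open>R\<close> and \<open>L\<close> are the one-sided values of
      \<open>\<sigma>\<close> at \<open>z1\<close>; a jump means that they differ.\<close>
    define R where "R = \<sigma> (z1 * cis (\<epsilon> / 2))"
    define L where "L = \<sigma> (z1 * cis (- \<epsilon> / 2))"
    have R: "\<sigma> (z1 * cis t) = R" if "0 < t" "t < \<epsilon>" for t
      unfolding R_def
      by (rule circle_lc_arc[of 0 \<epsilon>]) (use that e(1) off in auto)
    have L: "\<sigma> (z1 * cis t) = L" if "- \<epsilon> < t" "t < 0" for t
      unfolding L_def
      by (rule circle_lc_arc[of "- \<epsilon>" 0]) (use that e(1) off in auto)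
    have R1: "R = 1 \<or> R = -1" and L1: "L = 1 \<or> L = -1"
      unfolding R_def L_def using insert.prems(1)[OF n1] e(3)[of "\<epsilon> / 2"] e(3)[of "- \<epsilon> / 2"] e(1) by auto
    have lc_off: "\<forall>\<^sub>F t in at 0. z * cis t \<noteq> z1" if "cmod z = 1" for z
      using eventually_circle_avoids[OF that, of "{z1}"] by simp
    show ?thesis
    proof (cases "L = R")
      case True
      \<comment> \<open>Without a jump the singularity at \<open>z1\<close> is removable.\<close>
      define \<sigma>' where "\<sigma>' = \<sigma>(z1 := R)"
      have "circle_lc \<sigma>' z" if z: "cmod z = 1" "z \<notin> Z" for z
      proof (cases "z = z1")
        case zz: True
        have "\<sigma>' (z1 * cis t) = R" if "t \<noteq> 0" "\<bar>t\<bar> < \<epsilon>" for t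
          using R[of t] L[of t] True that by (cases "t > 0") (auto simp: \<sigma>'_def)
        then show ?thesis
          unfolding circle_lc_def eventually_at zz using e(1)
          by (intro exI[of _ \<epsilon>]) (auto simp: \<sigma>'_def dist_real_def)
      next
        case False
        then have "circle_lc \<sigma> z" using insert.prems(2) z by auto
        then show ?thesis unfolding circle_lc_def using lc_off[OF z(1)]
          by eventually_elim (use False in \<open>auto simp: \<sigma>'_def\<close>)
      qed
      moreover have "\<sigma>' z = 1 \<or> \<sigma>' z = - 1" if "cmod z = 1" "z \<notin> Z" for z
        using insert.prems(1) R1 that by (auto simp: \<sigma>'_def)
      ultimately obtain b where "lstar b = b" "\<forall>z. cmod z = 1 \<longrightarrow> z \<notin> Z \<longrightarrow> Re (leval z b) * \<sigma>' z > 0"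
        using insert.IH[of \<sigma>'] by blast
      then show ?thesis by (intro exI[of _ b]) (auto simp: \<sigma>'_def)
    next
      case jump: False
      have "\<exists>z2\<in>Z. cmod z2 = 1"
      proof (rule ccontr)
        assume no: "\<not> ?thesis"
        have "circle_lc \<sigma> (z1 * cis t)" if "0 < t" "t < 2 * pi" for t
        proof -
          have "cis t \<noteq> 1" using that by (intro cis_neq_1) auto
          then have "z1 * cis t \<noteq> z1" using z1 by auto
          then show ?thesis using no insert.prems(2)[OF n1] n1[of t] by auto
        qed
        \<comment> \<open>Travelling once around the circle from just after \<open>z1\<close> to
          just before it meets no exceptional point, so \<open>R = L\<close>.\<close>
        then have "\<sigma> (z1 * cis (\<epsilon> / 2)) = \<sigma> (z1 * cis (2 * pi - \<epsilon> / 2))"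
          by (rule circle_lc_arc[of 0 "2 * pi"]) (use e in auto)
        also have "cis (2 * pi - \<epsilon> / 2) = cis (- \<epsilon> / 2)"
          using cis_mult[of "2 * pi" "- \<epsilon> / 2"] by simp
        finally show False using jump by (simp add: R_def L_def)
      qed
      \<comment> \<open>The auxiliary polynomial is allowed to vanish at \<open>z2\<close>, because
        \<open>z2\<close> stays in the exceptional set of the induction hypothesis.\<close>
      then obtain z2 where z2: "z2 \<in> Z" "cmod z2 = 1" by blast
      have z12: "z2 \<noteq> z1" using z2 insert.hyps by auto
      obtain \<theta> where th: "z2 = z1 * cis \<theta>" "- pi < \<theta>" "\<theta> \<le> pi" "\<theta> \<noteq> 0"
        using circle_quotient_arg[OF z1 z2(2)] z12 by metis
      obtain q where q: "lstar q = q" "\<And>t. Re (leval (z1 * cis t) q) = 2 * sin (t / 2) * sin ((t - \<theta>) / 2)"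
        using two_root_lpoly[OF z1, of \<theta>] by metis
      define v where "v z = Re (leval z q)" for z
      have vnz: "v z \<noteq> 0" if z: "cmod z = 1" "z \<noteq> z1" "z \<noteq> z2" for z
      proof -
        obtain t where t: "z = z1 * cis t" "- pi < t" "t \<le> pi" "t \<noteq> 0"
          using circle_quotient_arg[OF z1 z(1)] z(2) by metis
        have "t \<noteq> \<theta>" using t th z by auto
        then show ?thesis
          using sin_half_neq_0[of t] sin_half_neq_0[of "t - \<theta>"] t th by (simp add: v_def q(2))
      qed
      have vlim: "((\<lambda>t. v (z * cis t)) \<longlongrightarrow> v z) (at 0)" if "cmod z = 1" for z
        unfolding v_def by (intro tendsto_Re tendsto_leval tendsto_mult_cis) (use that in auto)
      have vlc: "\<forall>\<^sub>F t in at 0. sgn (v (z * cis t)) = sgn (v z)" if "cmod z = 1" "v z \<noteq> 0" for z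
      proof (cases "v z > 0")
        case True
        have "\<forall>\<^sub>F t in at 0. v (z * cis t) > 0" by (rule order_tendstoD(1)[OF vlim True]) (rule that)
        then show ?thesis by eventually_elim (use True in auto)
      next
        case False
        then have neg: "v z < 0" using that by auto
        have "\<forall>\<^sub>F t in at 0. v (z * cis t) < 0" by (rule order_tendstoD(2)[OF vlim neg]) (rule that)
        then show ?thesis by eventually_elim (use neg in auto)
      qed
      \<comment> \<open>\<open>s\<close> is the sign near \<open>z1\<close> of the factor vanishing
        at \<open>z2\<close>. The other factor changes sign at \<open>z1\<close>, so the product of
        \<open>\<sigma>\<close> with the sign of \<open>v\<close> is \<open>R * s\<close> on the
        right and \<open>- L * s = R * s\<close> on the left; this is the value given to
        \<open>\<sigma>'\<close> at \<open>z1\<close>.\<close>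
      define s where "s = sgn (sin (- \<theta> / 2))"
      have snz: "s = 1 \<or> s = - 1"
        using sin_half_neq_0[of "- \<theta>"] th by (auto simp: s_def sgn_if)
      define \<sigma>' where "\<sigma>' z = (if z = z1 then R * s else \<sigma> z * sgn (v z))" for z
      have lc1: "circle_lc \<sigma>' z1"
      proof -
        have "((\<lambda>t. sin ((t - \<theta>) / 2)) \<longlongrightarrow> sin ((0 - \<theta>) / 2)) (at 0)"
          by (intro tendsto_intros) auto
        then have lim: "((\<lambda>t. sin ((t - \<theta>) / 2)) \<longlongrightarrow> sin (- \<theta> / 2)) (at 0)" by simp
        have sg: "\<forall>\<^sub>F t in at 0. sgn (sin ((t - \<theta>) / 2)) = s"
        proof (cases "sin (- \<theta> / 2) > 0")
          case True
          show ?thesis using order_tendstoD(1)[OF lim True] by eventually_elim (use True in \<open>auto simp: s_def\<close>)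
        next
          case False
          then have neg: "sin (- \<theta> / 2) < 0" using snz by (auto simp: s_def sgn_if split: if_splits)
          show ?thesis using order_tendstoD(2)[OF lim neg] by eventually_elim (use neg in \<open>auto simp: s_def\<close>)
        qed
        have small: "\<forall>\<^sub>F t in at 0. t \<noteq> 0 \<and> \<bar>t\<bar> < \<epsilon>"
          unfolding eventually_at using e(1) by (intro exI[of _ \<epsilon>]) (auto simp: dist_real_def)
        show ?thesis
          unfolding circle_lc_def using sg small
        proof eventually_elim
          case (elim t)
          have "z1 * cis t \<noteq> z1" using e(3)[of t] elim by auto
          then have eq: "\<sigma>' (z1 * cis t) = \<sigma> (z1 * cis t) * (sgn (sin (t / 2)) * s)"
            using elim by (simp add: \<sigma>'_def v_def q(2) sgn_mult)
          show ?case
          proof (cases "t > 0")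
            case True
            then have "sin (t / 2) > 0" using elim e by (intro sin_gt_zero) auto
            then show ?thesis using eq R[of t] True elim by (simp add: \<sigma>'_def)
          next
            case False
            then have "sin (- t / 2) > 0" using elim e by (intro sin_gt_zero) auto
            then have "sin (t / 2) < 0" by simp
            moreover have "L = - R" using jump R1 L1 by auto
            ultimately show ?thesis using eq L[of t] False elim by (simp add: \<sigma>'_def)
          qed
        qed
      qed
      have "circle_lc \<sigma>' z" if z: "cmod z = 1" "z \<notin> Z" for z
      proof (cases "z = z1")
        case True
        then show ?thesis using lc1 by simp
      next
        case False
        then have "circle_lc \<sigma> z" using insert.prems(2) z by auto
        then have "\<forall>\<^sub>F t in at 0. \<sigma> (z * cis t) = \<sigma> z" by (simp add: circle_lc_def)
        moreover have "\<forall>\<^sub>F t in at 0. sgn (v (z * cis t)) = sgn (v z)"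
          by (rule vlc[OF z(1)]) (use vnz z False z2 in auto)
        ultimately show ?thesis unfolding circle_lc_def using lc_off[OF z(1)]
          by eventually_elim (use False in \<open>auto simp: \<sigma>'_def\<close>)
      qed
      moreover have "\<sigma>' z = 1 \<or> \<sigma>' z = - 1" if z: "cmod z = 1" "z \<notin> Z" for z
      proof (cases "z = z1")
        case True
        then show ?thesis using R1 snz by (auto simp: \<sigma>'_def)
      next
        case False
        then have "v z \<noteq> 0" "\<sigma> z = 1 \<or> \<sigma> z = -1" using vnz z z2 insert.prems(1)[of z] by auto
        then show ?thesis using False by (auto simp: \<sigma>'_def sgn_if)
      qed
      ultimately obtain b where b: "lstar b = b" "\<forall>z. cmod z = 1 \<longrightarrow> z \<notin> Z \<longrightarrow> Re (leval z b) * \<sigma>' z > 0"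
        using insert.IH[of \<sigma>'] by blast
      show ?thesis
      proof (intro exI[of _ "b * q"] conjI allI impI)
        show "lstar (b * q) = b * q" using b(1) q(1) by (simp add: lstar_mult)
        fix z assume z: "cmod z = 1" "z \<notin> insert z1 Z"
        have nz: "z \<noteq> 0" using z by auto
        have "leval z (b * q) = of_real (Re (leval z b)) * of_real (v z)"
          unfolding leval_mult[OF nz] v_def
          using leval_hermitian_real[OF b(1) z(1)] leval_hermitian_real[OF q(1) z(1)] by metis
        then have eq: "Re (leval z (b * q)) = Re (leval z b) * v z" by (simp flip: of_real_mult)
        have vz: "v z \<noteq> 0" using vnz[of z] z z2 by auto
        have "Re (leval z b) * (\<sigma> z * sgn (v z)) > 0"
          using b(2) z by (auto simp: \<sigma>'_def)
        then have "Re (leval z b) * (\<sigma> z * sgn (v z)) * \<bar>v z\<bar> > 0" using vz by simp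
        then show "0 < Re (leval z (b * q)) * \<sigma> z"
          unfolding eq using sgn_mult_abs[of "v z"] by (metis mult.assoc mult.commute)
      qed
    qed
  qed
qed

section \<open>Unimodular Hermitian matrices\<close>

lemma congr_index:
  assumes "A \<in> carrier_mat m m" "B \<in> carrier_mat n m" "i < n" "j < n"
  shows "(B * A * hadj \<sigma> B) $$ (i,j) = (\<Sum>k<m. \<Sum>l<m. B $$ (i,k) * A $$ (k,l) * \<sigma> (B $$ (j,l)))"
proof -
  have "(B * A * hadj \<sigma> B) $$ (i,j) = (\<Sum>l<m. (B * A) $$ (i,l) * hadj \<sigma> B $$ (l,j))"
    by (rule index_mult_sum[of _ n m _ n]) (use assms in auto)
  also have "\<dots> = (\<Sum>l<m. \<Sum>k<m. B $$ (i,k) * A $$ (k,l) * \<sigma> (B $$ (j,l)))"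
    using assms by (intro sum.cong refl) (simp add: index_mult_sum[of B n m A m] sum_distrib_right del: index_mult_mat)
  also have "\<dots> = (\<Sum>k<m. \<Sum>l<m. B $$ (i,k) * A $$ (k,l) * \<sigma> (B $$ (j,l)))"
    by (rule sum.swap)
  finally show ?thesis .
qed

text \<open>\<open>hadj\<close> serves two involutions: \<open>cnj\<close> for values at a point of
  the circle and \<open>lstar\<close> for Laurent polynomials.\<close>

abbreviation adj :: "lpoly mat \<Rightarrow> lpoly mat" where "adj \<equiv> hadj lstar"

lemmas adj_mult = hadj_mult[OF lstar_hom.comm_ring_hom_axioms]

lemma adj_adj [simp]: "adj (adj A) = A"
  by (rule hadj_hadj) simp

lemma adj_one [simp]: "adj (1\<^sub>m n) = 1\<^sub>m n"
  by (rule hadj_one) unfold_locales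

lemma det_hadj:
  assumes "comm_ring_hom \<sigma>" "A \<in> carrier_mat n n"
  shows "det (hadj \<sigma> A) = \<sigma> (det A)"
proof -
  interpret comm_ring_hom \<sigma> by fact
  have "hadj \<sigma> A = map_mat \<sigma> (transpose_mat A)"
    by (rule eq_matI) (use assms in auto)
  then show ?thesis using det_transpose[OF assms(2)] by simp
qed

lemmas det_adj = det_hadj[OF lstar_hom.comm_ring_hom_axioms]

lemma adj_eq_iff:
  assumes "A \<in> carrier_mat n n"
  shows "adj A = A \<longleftrightarrow> (\<forall>i<n. \<forall>j<n. lstar (A $$ (j,i)) = A $$ (i,j))"
proof
  assume "adj A = A"
  then show "\<forall>i<n. \<forall>j<n. lstar (A $$ (j,i)) = A $$ (i,j)"
    using assms by (metis carrier_matD hadj_index)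
qed (rule eq_matI, use assms in auto)

text \<open>The factorization written as a difference of sums of rank-one squares, with the columns
  of \<open>U\<close> as functions \<open>u k\<close> and \<open>w k\<close>. In this form appending
  a square, padding with a zero coordinate and restricting to a block are changes of functions
  only.\<close>

definition lrep :: "nat \<Rightarrow> nat \<Rightarrow> lpoly mat \<Rightarrow> bool" where
  "lrep p q A \<longleftrightarrow> (\<exists>u w. \<forall>i<dim_row A. \<forall>j<dim_row A.
     A $$ (i,j) = (\<Sum>k<p. u k i * lstar (u k j)) - (\<Sum>k<q. w k i * lstar (w k j)))"

text \<open>\<open>B\<close> is applied to every vector of the representation; the number of squares
  of each sign stays the same.\<close>

lemma lrep_congruence:
  assumes "A \<in> carrier_mat m m" "B \<in> carrier_mat n m" "lrep p q A"
  shows "lrep p q (B * A * adj B)"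
proof -
  obtain u w where uw: "\<And>i j. i < m \<Longrightarrow> j < m \<Longrightarrow>
     A $$ (i,j) = (\<Sum>k<p. u k i * lstar (u k j)) - (\<Sum>k<q. w k i * lstar (w k j))"
    using assms(1,3) unfolding lrep_def by auto
  define T where "T v k i = (\<Sum>c<m. B $$ (i,c) * v k c)" for v :: "nat \<Rightarrow> nat \<Rightarrow> lpoly" and k i
  have T: "(\<Sum>c<m. \<Sum>d<m. B $$ (i,c) * (\<Sum>k<p. v k c * lstar (v k d)) * lstar (B $$ (j,d)))
      = (\<Sum>k<p. T v k i * lstar (T v k j))" for v i j p
  proof -
    have "(\<Sum>c<m. \<Sum>d<m. B $$ (i,c) * (\<Sum>k<p. v k c * lstar (v k d)) * lstar (B $$ (j,d)))
      = (\<Sum>c<m. \<Sum>d<m. \<Sum>k<p. (B $$ (i,c) * v k c) * lstar (B $$ (j,d) * v k d))"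
      by (intro sum.cong refl) (simp add: sum_distrib_left sum_distrib_right lstar_mult mult_ac)
    also have "\<dots> = (\<Sum>k<p. \<Sum>c<m. \<Sum>d<m. (B $$ (i,c) * v k c) * lstar (B $$ (j,d) * v k d))"
      by (subst sum.swap[of _ "{..<p}"]) (intro sum.cong refl sum.swap)
    also have "\<dots> = (\<Sum>k<p. T v k i * lstar (T v k j))"
      by (simp only: T_def lstar_hom.hom_sum sum_product)
    finally show ?thesis .
  qed
  have "(B * A * adj B) $$ (i,j) = (\<Sum>k<p. T u k i * lstar (T u k j)) - (\<Sum>k<q. T w k i * lstar (T w k j))"
    if "i < n" "j < n" for i j
  proof -
    have "(B * A * adj B) $$ (i,j) = (\<Sum>c<m. \<Sum>d<m. B $$ (i,c) * A $$ (c,d) * lstar (B $$ (j,d)))"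
      by (rule congr_index[OF assms(1,2) that])
    also have "\<dots> = (\<Sum>c<m. \<Sum>d<m. B $$ (i,c) * (\<Sum>k<p. u k c * lstar (u k d)) * lstar (B $$ (j,d))
        - B $$ (i,c) * (\<Sum>k<q. w k c * lstar (w k d)) * lstar (B $$ (j,d)))"
      by (intro sum.cong refl) (simp add: uw right_diff_distrib left_diff_distrib)
    finally show ?thesis by (simp add: sum_subtractf T)
  qed
  then show ?thesis
    unfolding lrep_def using assms(2) by (intro exI[of _ "T u"] exI[of _ "T w"]) auto
qed

section \<open>Row operations and congruence over Laurent polynomials\<close>

definition row_elem :: "nat \<Rightarrow> nat \<Rightarrow> (nat \<Rightarrow> 'a) \<Rightarrow> 'a::comm_ring_1 mat" where
  "row_elem n i c = mat n n (\<lambda>(r,s). if r = i then c s else if r = s then 1 else 0)"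

lemma row_elem_carrier [simp]: "row_elem n i c \<in> carrier_mat n n"
  by (simp add: row_elem_def)

lemma row_elem_mult_index:
  assumes "A \<in> carrier_mat n m" "i < n" "r < n" "s < m"
  shows "(row_elem n i c * A) $$ (r,s) = (if r = i then \<Sum>k<n. c k * A $$ (k,s) else A $$ (r,s))"
proof -
  have "(row_elem n i c * A) $$ (r,s) = (\<Sum>k<n. row_elem n i c $$ (r,k) * A $$ (k,s))"
    by (rule index_mult_sum) (use assms in auto)
  also have "\<dots> = (if r = i then \<Sum>k<n. c k * A $$ (k,s) else (\<Sum>k<n. if k = r then A $$ (k,s) else 0))"
  proof (cases "r = i")
    case True
    then show ?thesis using assms by (simp add: row_elem_def)
  next
    case False
    have "(\<Sum>k<n. row_elem n i c $$ (r,k) * A $$ (k,s)) = (\<Sum>k<n. if k = r then A $$ (k,s) else 0)"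
      by (intro sum.cong refl) (use False assms in \<open>auto simp: row_elem_def\<close>)
    then show ?thesis using False by simp
  qed
  also have "\<dots> = (if r = i then \<Sum>k<n. c k * A $$ (k,s) else A $$ (r,s))"
    using assms by (simp add: sum.delta)
  finally show ?thesis .
qed

text \<open>The inverse has the same shape: the equation in row \<open>i\<close> is solved for its
  unknown number \<open>i\<close>, whose coefficient is a unit.\<close>

lemma row_elem_inverse:
  assumes "i < n" "c i * d = 1"
  shows "row_elem n i c * row_elem n i (\<lambda>s. if s = i then d else - d * c s) = 1\<^sub>m n"
proof (rule eq_matI)
  fix r s assume "r < dim_row (1\<^sub>m n :: 'a mat)" "s < dim_col (1\<^sub>m n :: 'a mat)"
  then have rs: "r < n" "s < n" by auto
  let ?R = "row_elem n i (\<lambda>s. if s = i then d else - d * c s)"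
  have *: "(row_elem n i c * ?R) $$ (r,s) = (if r = i then \<Sum>k<n. c k * ?R $$ (k,s) else ?R $$ (r,s))"
    by (rule row_elem_mult_index) (use assms rs in auto)
  have "(\<Sum>k<n. c k * ?R $$ (k,s)) = c i * ?R $$ (i,s) + (\<Sum>k\<in>{..<n}-{i}. c k * ?R $$ (k,s))"
    by (rule sum.remove) (use assms in auto)
  also have "(\<Sum>k\<in>{..<n}-{i}. c k * ?R $$ (k,s)) = (\<Sum>k\<in>{..<n}-{i}. if k = s then c s else 0)"
    by (intro sum.cong refl) (use rs in \<open>auto simp: row_elem_def\<close>)
  also have "\<dots> = (if s = i then 0 else c s)" using rs by (simp add: sum.delta')
  also have "c i * ?R $$ (i,s) = (if s = i then 1 else - c s)"
    using assms rs by (auto simp: row_elem_def) (metis mult.assoc mult_1)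
  finally have sum: "(\<Sum>k<n. c k * ?R $$ (k,s)) = (if s = i then 1 else - c s) + (if s = i then 0 else c s)" .
  show "(row_elem n i c * ?R) $$ (r,s) = 1\<^sub>m n $$ (r,s)"
    unfolding * sum using rs by (auto simp: row_elem_def)
qed (auto simp: row_elem_def)

lemma row_elem_inverse':
  assumes "i < n" "c i * d = 1"
  shows "row_elem n i (\<lambda>s. if s = i then d else - d * c s) * row_elem n i c = 1\<^sub>m n"
proof -
  have dc: "d * c i = 1" using assms by (simp add: mult.commute)
  define c' where "c' s = (if s = i then d else - d * c s)" for s
  have "(\<lambda>s. if s = i then c i else - c i * c' s) = c"
    using assms dc by (auto simp: c'_def fun_eq_iff) (metis mult.assoc mult_1)
  then show ?thesis
    using row_elem_inverse[of i n c' "c i"] assms dc unfolding c'_def[abs_def] by simp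
qed

lemma det_row_elem_unit:
  assumes "i < n" "c i * d = 1"
  shows "det (row_elem n i c) dvd 1"
proof -
  let ?R = "row_elem n i (\<lambda>s. if s = i then d else - d * c s)"
  have "det (row_elem n i c) * det ?R = 1"
    using det_mult[of "row_elem n i c" n ?R] row_elem_inverse[where i = i and c = c, OF assms] by simp
  then show ?thesis by (intro dvdI[of _ _ "det ?R"]) simp
qed

text \<open>The left inverse \<open>W\<close> is part of the definition so that a congruence can be
  undone: taking adjoints in \<open>W * V = 1\<^sub>m n\<close> gives the identity for the factor on
  the right.\<close>

definition lcongr :: "nat \<Rightarrow> lpoly mat \<Rightarrow> lpoly mat \<Rightarrow> bool" where
  "lcongr n A B \<longleftrightarrow> (\<exists>V W. V \<in> carrier_mat n n \<and> W \<in> carrier_mat n n \<and> W * V = 1\<^sub>m n \<and> B = V * A * adj V)"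

lemma lcongr_refl: "A \<in> carrier_mat n n \<Longrightarrow> lcongr n A A"
  unfolding lcongr_def by (intro exI[of _ "1\<^sub>m n"]) auto

lemma lcongr_carrier: "lcongr n A B \<Longrightarrow> A \<in> carrier_mat n n \<Longrightarrow> B \<in> carrier_mat n n"
  by (auto simp: lcongr_def)

lemma lcongr_trans:
  assumes "A \<in> carrier_mat n n" "lcongr n A B" "lcongr n B C"
  shows "lcongr n A C"
proof -
  obtain V W V' W' where V: "V \<in> carrier_mat n n" "W \<in> carrier_mat n n" "W * V = 1\<^sub>m n" "B = V * A * adj V"
    and V': "V' \<in> carrier_mat n n" "W' \<in> carrier_mat n n" "W' * V' = 1\<^sub>m n" "C = V' * B * adj V'"
    using assms unfolding lcongr_def by blast
  have aV: "adj V \<in> carrier_mat n n" "adj V' \<in> carrier_mat n n" using V V' by auto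
  have "W' * (V' * V) = V"
    using assoc_mult_mat[of W' n n V' n V n] V V' by simp
  then have "W * W' * (V' * V) = 1\<^sub>m n"
    using assoc_mult_mat[of W n n W' n "V' * V" n] V V' by simp
  moreover have "C = (V' * V) * A * adj (V' * V)"
    unfolding adj_mult[OF V'(1) V(1)] V'(4) V(4) using V(1) V'(1) aV assms(1)
    by (simp add: assoc_mult_mat[of _ n n _ n _ n] mult_carrier_mat[of _ n n _ n])
  ultimately show ?thesis unfolding lcongr_def using V V' by (metis mult_carrier_mat)
qed

lemma lcongr_det:
  assumes "A \<in> carrier_mat n n" "lcongr n A B" "det A dvd 1"
  shows "det B dvd 1"
proof -
  obtain V W where V: "V \<in> carrier_mat n n" "W \<in> carrier_mat n n" "W * V = 1\<^sub>m n" "B = V * A * adj V"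
    using assms unfolding lcongr_def by blast
  have "det W * det V = 1" using det_mult[OF V(2,1)] V(3) by simp
  then have dV: "det V dvd 1" by (intro dvdI[of _ _ "det W"]) (simp add: mult.commute)
  then have "lstar (det V) dvd 1" by (metis lstar_hom.hom_dvd lstar_hom.hom_one)
  moreover have "det B = det V * det A * lstar (det V)"
    unfolding V(4) using V(1) assms(1) by (simp add: det_mult[of _ n] det_adj[OF V(1)] mult_carrier_mat[of _ n n _ n])
  ultimately show ?thesis using dV assms(3) by (metis mult_dvd_mono mult_1)
qed

lemma adj_congruence:
  assumes "A \<in> carrier_mat m m" "V \<in> carrier_mat n m" "adj A = A"
  shows "adj (V * A * adj V) = V * A * adj V"
proof -
  have "adj (V * A * adj V) = V * (adj A * adj V)"
    using adj_mult[of "V * A" n m "adj V" n] adj_mult[of V n m A m] assms by simp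
  then show ?thesis using assms by (simp add: assoc_mult_mat[of V n m A m "adj V" n])
qed

lemma lcongr_adj:
  assumes "A \<in> carrier_mat n n" "lcongr n A B" "adj A = A"
  shows "adj B = B"
  using assms adj_congruence unfolding lcongr_def by blast

lemma lcongr_lrep:
  assumes "A \<in> carrier_mat n n" "lcongr n A B" "lrep p q B"
  shows "lrep p q A"
proof -
  obtain V W where V: "V \<in> carrier_mat n n" "W \<in> carrier_mat n n" "W * V = 1\<^sub>m n" "B = V * A * adj V"
    using assms unfolding lcongr_def by blast
  have aV: "adj V \<in> carrier_mat n n" "adj W \<in> carrier_mat n n" using V by auto
  have "adj V * adj W = 1\<^sub>m n" using adj_mult[OF V(2,1)] V(3) by simp
  moreover have "W * B * adj W = (W * V) * A * (adj V * adj W)"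
    unfolding V(4) using V(1,2) aV assms(1)
    by (simp add: assoc_mult_mat[of _ n n _ n _ n] mult_carrier_mat[of _ n n _ n])
  ultimately have "A = W * B * adj W" using V(3) assms(1) by simp
  moreover have "lrep p q (W * B * adj W)"
    by (rule lrep_congruence[OF _ V(2) assms(3)]) (rule lcongr_carrier[OF assms(2,1)])
  ultimately show ?thesis by simp
qed

lemma lcongr_row_elem:
  assumes "i < n" "c i * d = 1"
  shows "lcongr n A (row_elem n i c * A * adj (row_elem n i c))"
  unfolding lcongr_def using row_elem_inverse'[where i = i and c = c, OF assms] row_elem_carrier by blast

section \<open>Row degrees and leading coefficients\<close>

definition deg_le :: "lpoly \<Rightarrow> int \<Rightarrow> bool" where
  "deg_le f d \<longleftrightarrow> (\<forall>k>d. lcoeff f k = 0)"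

lemma deg_le_sum: "(\<And>x. x \<in> S \<Longrightarrow> deg_le (f x) d) \<Longrightarrow> deg_le (sum f S) d"
  by (simp add: deg_le_def)

lemma deg_le_mono: "deg_le f d \<Longrightarrow> d \<le> e \<Longrightarrow> deg_le f e"
  by (simp add: deg_le_def)

lemma
  assumes "deg_le f a" "deg_le g b"
  shows deg_le_mult: "deg_le (f * g) (a + b)"
    and lcoeff_mult_top: "lcoeff (f * g) (a + b) = lcoeff f a * lcoeff g b"
proof -
  show "deg_le (f * g) (a + b)"
    unfolding deg_le_def lcoeff_mult
  proof (intro allI impI sum.neutral ballI)
    fix n k assume "a + b < n" "k \<in> lsupp f"
    then show "lcoeff f k * lcoeff g (n - k) = 0"
      using assms by (cases "k \<le> a") (auto simp: deg_le_def)
  qed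
  have "lcoeff (f * g) (a + b) = (\<Sum>k\<in>lsupp f. if k = a then lcoeff f a * lcoeff g b else 0)"
    unfolding lcoeff_mult
  proof (intro sum.cong refl)
    fix k assume "k \<in> lsupp f"
    then show "lcoeff f k * lcoeff g (a + b - k) = (if k = a then lcoeff f a * lcoeff g b else 0)"
      using assms by (cases k a rule: linorder_cases) (auto simp: deg_le_def)
  qed
  then show "lcoeff (f * g) (a + b) = lcoeff f a * lcoeff g b" by (auto simp: sum.delta)
qed

lemma
  assumes "finite S" "\<And>x. x \<in> S \<Longrightarrow> deg_le (f x) (r x)"
  shows deg_le_prod: "deg_le (prod f S) (sum r S)"
    and lcoeff_prod_top: "lcoeff (prod f S) (sum r S) = (\<Prod>x\<in>S. lcoeff (f x) (r x))"
proof -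
  have "deg_le (prod f S) (sum r S) \<and> lcoeff (prod f S) (sum r S) = (\<Prod>x\<in>S. lcoeff (f x) (r x))"
    using assms
  proof (induction S rule: finite_induct)
    case empty
    then show ?case by (simp add: deg_le_def)
  next
    case (insert x S)
    then show ?case using deg_le_mult[of "f x" "r x" "prod f S" "sum r S"]
        lcoeff_mult_top[of "f x" "r x" "prod f S" "sum r S"] by simp
  qed
  then show "deg_le (prod f S) (sum r S)" "lcoeff (prod f S) (sum r S) = (\<Prod>x\<in>S. lcoeff (f x) (r x))" by auto
qed

text \<open>The leading coefficient matrix by rows, as for row reduced matrices. The
  \<open>r i\<close> are mere bounds on the row degrees, so a row of it may be zero.\<close>

definition lead_mat :: "nat \<Rightarrow> (nat \<Rightarrow> int) \<Rightarrow> lpoly mat \<Rightarrow> complex mat" where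
  "lead_mat n r A = mat n n (\<lambda>(i,j). lcoeff (A $$ (i,j)) (r i))"

lemma lead_mat_carrier: "lead_mat n r A \<in> carrier_mat n n"
  by (simp add: lead_mat_def)

text \<open>Each Leibniz product takes one entry from every row, so its degree is at most the sum of
  the row bounds and its coefficient there is the product of the leading coefficients.\<close>

lemma
  assumes A: "A \<in> carrier_mat n n" and deg: "\<And>i j. i < n \<Longrightarrow> j < n \<Longrightarrow> deg_le (A $$ (i,j)) (r i)"
  shows deg_le_det: "deg_le (det A) (\<Sum>i<n. r i)"
    and lcoeff_det_top: "lcoeff (det A) (\<Sum>i<n. r i) = det (lead_mat n r A)"
proof -
  have sg: "lcoeff (signof p * f) k = signof p * lcoeff f k" for p :: "nat \<Rightarrow> nat" and f k
    by (simp add: sign_def)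
  have D: "det A = (\<Sum>p | p permutes {0..<n}. signof p * (\<Prod>i<n. A $$ (i, p i)))"
    using det_def'[OF A] by (simp add: atLeast0LessThan)
  have perm: "p i < n" if "p permutes {0..<n}" "i < n" for p i
    using that permutes_in_image[of p "{0..<n}" i] by auto
  have pd: "deg_le (\<Prod>i<n. A $$ (i, p i)) (\<Sum>i<n. r i)" if "p permutes {0..<n}" for p
    by (rule deg_le_prod) (use perm[OF that] deg in auto)
  have pc: "lcoeff (\<Prod>i<n. A $$ (i, p i)) (\<Sum>i<n. r i) = (\<Prod>i<n. lcoeff (A $$ (i, p i)) (r i))" if "p permutes {0..<n}" for p
    by (rule lcoeff_prod_top) (use perm[OF that] deg in auto)
  show "deg_le (det A) (\<Sum>i<n. r i)"
    unfolding D by (rule deg_le_sum) (use pd in \<open>auto simp: deg_le_def sg\<close>)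
  have L: "lead_mat n r A \<in> carrier_mat n n" by (simp add: lead_mat_def)
  have "lcoeff (det A) (\<Sum>i<n. r i) = (\<Sum>p | p permutes {0..<n}. signof p * (\<Prod>i<n. lcoeff (A $$ (i, p i)) (r i)))"
    unfolding D lcoeff_sum sg by (intro sum.cong refl) (simp add: pc)
  also have "\<dots> = (\<Sum>p | p permutes {0..<n}. signof p * (\<Prod>i<n. lead_mat n r A $$ (i, p i)))"
    by (intro sum.cong refl arg_cong2[where f = "(*)"] prod.cong) (use perm in \<open>auto simp: lead_mat_def\<close>)
  also have "\<dots> = det (lead_mat n r A)"
    using det_def'[OF L] by (simp add: atLeast0LessThan)
  finally show "lcoeff (det A) (\<Sum>i<n. r i) = det (lead_mat n r A)" .
qed

lemma unit_hermitian_lpoly: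
  assumes "f dvd 1" "lstar f = f"
  obtains c where "c \<noteq> 0" "f = lconst (complex_of_real c)"
proof -
  obtain g where "1 = f * g" using assms by auto
  then have "leval z f \<noteq> 0" if "z \<noteq> 0" for z
    using leval_mult[OF that, of f g] leval_one[of z] by auto
  moreover have "f \<noteq> 0" using assms by auto
  ultimately show ?thesis using hermitian_lpoly_const[OF assms(2)] that by blast
qed

lemma left_kernel_vector:
  fixes M :: "'a::field mat"
  assumes M: "M \<in> carrier_mat n n" and "det M = 0"
  obtains c i where "i < n" "c i \<noteq> 0" "\<And>j. j < n \<Longrightarrow> (\<Sum>k<n. c k * M $$ (k,j)) = 0"
proof -
  have "det (transpose_mat M) = 0" using det_transpose[OF M] assms by simp
  then obtain v where v: "v \<in> carrier_vec n" "v \<noteq> 0\<^sub>v n" "transpose_mat M *\<^sub>v v = 0\<^sub>v n"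
    using det_0_iff_vec_prod_zero_field[of "transpose_mat M" n] M by auto
  obtain i where i: "i < n" "v $ i \<noteq> 0" using v(1,2) by (metis eq_vecI carrier_vecD index_zero_vec)
  show ?thesis
  proof (rule that[of i "\<lambda>k. v $ k"])
    fix j assume j: "j < n"
    have "(transpose_mat M *\<^sub>v v) $ j = (\<Sum>k<n. v $ k * M $$ (k,j))"
      using M v(1) j by (auto simp: scalar_prod_def atLeast0LessThan mult.commute intro!: sum.cong)
    then show "(\<Sum>k<n. v $ k * M $$ (k,j)) = 0" using v(3) j by simp
  qed (use i in auto)
qed

text \<open>Row degrees are lowered as in the construction of a Wiener--Hopf factorization; the
  accompanying column operation does not raise them, because its exponents are nonpositive.\<close>

lemma row_reduced_form:
  assumes "A \<in> carrier_mat n n" "adj A = A" "det A dvd 1"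
    and "\<And>i j. i < n \<Longrightarrow> j < n \<Longrightarrow> deg_le (A $$ (i,j)) (r i)"
  shows "\<exists>B r'. lcongr n A B \<and> (\<forall>i<n. \<forall>j<n. deg_le (B $$ (i,j)) (r' i)) \<and>
    (\<Sum>i<n. r' i) = 0 \<and> det (lead_mat n r' B) \<noteq> 0"
  using assms
proof (induction "nat (\<Sum>i<n. r i)" arbitrary: A r rule: less_induct)
  case less
  note A = less.prems(1) and herm = less.prems(2) and unit = less.prems(3) and deg = less.prems(4)
  have "lstar (det A) = det A" using det_adj[OF A] herm by simp
  then obtain c where c: "c \<noteq> 0" "det A = lconst (complex_of_real c)"
    using unit_hermitian_lpoly[OF unit] by blast
  let ?s = "\<Sum>i<n. r i"
  \<comment> \<open>\<open>det A\<close> is a nonzero constant, so it has a term of degree 0; the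
    sum of the row bounds can thus serve as a measure.\<close>
  have s0: "?s \<ge> 0" using deg_le_det[OF A deg] c by (force simp: deg_le_def not_less[symmetric])
  have top: "det (lead_mat n r A) = (if ?s = 0 then of_real c else 0)"
    using lcoeff_det_top[OF A deg] c by simp
  show ?case
  proof (cases "?s = 0")
    case True
    then show ?thesis using top c lcongr_refl[OF A] deg by (intro exI[of _ A] exI[of _ r]) auto
  next
    case False
    then have "det (lead_mat n r A) = 0" using top by simp
    then obtain v i1 where v: "i1 < n" "v i1 \<noteq> 0" "\<And>j. j < n \<Longrightarrow> (\<Sum>k<n. v k * lead_mat n r A $$ (k,j)) = 0"
      using left_kernel_vector[OF lead_mat_carrier] by blast
    define S where "S = {k. k < n \<and> v k \<noteq> 0}"
    have "finite S" "S \<noteq> {}" using v by (auto simp: S_def)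
    \<comment> \<open>A row of maximal bound among those in the linear relation: then the exponents
      \<open>r i - r k\<close> are nonnegative for the rows involved.\<close>
    then obtain i where i: "i \<in> S" "\<And>k. k \<in> S \<Longrightarrow> r k \<le> r i"
      using Max_in[of "r ` S"] Max_ge[of "r ` S"] by fastforce
    have i': "i < n" "v i \<noteq> 0" using i by (auto simp: S_def)
    \<comment> \<open>The monomials shift all leading terms to degree \<open>r i\<close>, where the
      relation \<open>v\<close> cancels them; the bound of row \<open>i\<close> drops by
      one.\<close>
    define e where "e k = lmonom (v k) (r i - r k)" for k
    have unit_e: "e i * lconst (1 / v i) = 1" using i' by (simp add: e_def lconst_def)
    define E where "E = row_elem n i e"
    have E: "E \<in> carrier_mat n n" by (simp add: E_def)
    define B where "B = E * A * adj E"
    have cong: "lcongr n A B" unfolding B_def E_def by (rule lcongr_row_elem[where i = i and c = e, OF i'(1) unit_e])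
    have EA: "E * A \<in> carrier_mat n n" using E A by auto
    define r' where "r' = r(i := r i - 1)"
    have EAdeg: "deg_le ((E * A) $$ (k,j)) (r' k)" if kj: "k < n" "j < n" for k j
    proof (cases "k = i")
      case False
      then show ?thesis
        using row_elem_mult_index[OF A i'(1) kj, of e] deg kj by (simp add: E_def r'_def)
    next
      case True
      have eq: "(E * A) $$ (k,j) = (\<Sum>l<n. e l * A $$ (l,j))"
        using row_elem_mult_index[OF A i'(1) kj, of e] True by (simp add: E_def)
      have co: "lcoeff (e l * A $$ (l,j)) m = v l * lcoeff (A $$ (l,j)) (m - r i + r l)" for l m
        unfolding e_def lcoeff_simps by (simp add: algebra_simps)
      show ?thesis
        unfolding deg_le_def
      proof (intro allI impI)
        fix m assume m: "r' k < m"
        show "lcoeff ((E * A) $$ (k,j)) m = 0"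
        proof (cases "m = r i")
          case mi: True
          have "lcoeff ((E * A) $$ (k,j)) m = (\<Sum>l<n. v l * lead_mat n r A $$ (l,j))"
            unfolding eq lcoeff_sum co by (intro sum.cong refl) (use mi kj in \<open>auto simp: lead_mat_def\<close>)
          then show ?thesis using v(3)[OF kj(2)] by simp
        next
          case False
          then have "m > r i" using m True by (auto simp: r'_def)
          then show ?thesis unfolding eq lcoeff_sum co
            using deg[OF _ kj(2)] by (intro sum.neutral ballI) (auto simp: deg_le_def)
        qed
      qed
    qed
    have Bdeg: "deg_le (B $$ (k,j)) (r' k)" if kj: "k < n" "j < n" for k j
    proof -
      have "B $$ (k,j) = (\<Sum>l<n. (E * A) $$ (k,l) * adj E $$ (l,j))"
        unfolding B_def by (rule index_mult_sum[OF EA _ kj]) (use E in auto)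
      moreover have "deg_le ((E * A) $$ (k,l) * adj E $$ (l,j)) (r' k)" if l: "l < n" for l
      proof -
        have "deg_le (adj E $$ (l,j)) 0"
        proof (cases "j = i \<and> l \<in> S")
          case True
          then show ?thesis using E l kj i(2)[of l] by (auto simp: E_def row_elem_def e_def deg_le_def)
        next
          case False
          then show ?thesis using E l kj by (auto simp: E_def row_elem_def e_def deg_le_def S_def)
        qed
        then show ?thesis using deg_le_mult[OF EAdeg[OF kj(1) l]] by fastforce
      qed
      ultimately show ?thesis by (auto intro: deg_le_sum)
    qed
    have sum': "(\<Sum>i<n. r' i) = ?s - 1"
    proof -
      have "(\<Sum>k<n. r' k) = (r i - 1) + (\<Sum>k\<in>{..<n}-{i}. r k)"
        using i'(1) by (subst sum.remove[of _ i]) (auto simp: r'_def intro!: sum.cong)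
      moreover have "?s = r i + (\<Sum>k\<in>{..<n}-{i}. r k)"
        using i'(1) by (subst sum.remove[of _ i]) auto
      ultimately show ?thesis by simp
    qed
    obtain C r'' where C: "lcongr n B C" "\<forall>i<n. \<forall>j<n. deg_le (C $$ (i,j)) (r'' i)"
        "(\<Sum>i<n. r'' i) = 0" "det (lead_mat n r'' C) \<noteq> 0"
      using less.hyps[of r' B] sum' s0 False Bdeg lcongr_carrier[OF cong A] lcongr_adj[OF A cong herm] lcongr_det[OF A cong unit]
      by auto
    then show ?thesis using lcongr_trans[OF A cong C(1)] by blast
  qed
qed

text \<open>By Hermitian symmetry the exponents of the entry \<open>(i,j)\<close> of a row reduced
  \<open>B\<close> lie between \<open>- r j\<close> and \<open>r i\<close>. A nonzero Leibniz term
  of the leading matrix gives a permutation with \<open>r i + r (\<pi> i) \<ge> 0\<close>, and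
  equality holds because the \<open>r i\<close> sum to 0. For an \<open>i\<close> with
  \<open>r i \<le> 0\<close>, a nonzero diagonal entry must be constant; if it is zero, the entry
  \<open>(i, \<pi> i)\<close> has only the exponent \<open>r i\<close> left.\<close>

lemma unit_diagonal_entry:
  assumes A: "A \<in> carrier_mat n n" and herm: "adj A = A" and unit: "det A dvd 1" and n: "n > 0"
  obtains B i c where "lcongr n A B" "i < n" "c \<noteq> 0" "B $$ (i,i) = lconst (complex_of_real c)"
proof -
  define N where "N = Max (insert 0 (\<Union>i\<in>{..<n}. \<Union>j\<in>{..<n}. lsupp (A $$ (i,j))))"
  have fin: "finite (insert 0 (\<Union>i\<in>{..<n}. \<Union>j\<in>{..<n}. lsupp (A $$ (i,j))))" by auto
  have "k \<le> N" if "i < n" "j < n" "lcoeff (A $$ (i,j)) k \<noteq> 0" for i j k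
    unfolding N_def by (rule Max_ge[OF fin]) (use that in auto)
  then have "deg_le (A $$ (i,j)) ((\<lambda>_. N) i)" if "i < n" "j < n" for i j
    using that by (force simp: deg_le_def)
  then obtain B r where B: "lcongr n A B" and deg: "\<And>i j. i < n \<Longrightarrow> j < n \<Longrightarrow> deg_le (B $$ (i,j)) (r i)"
    and sum0: "(\<Sum>i<n. r i) = 0" and L: "det (lead_mat n r B) \<noteq> 0"
    using row_reduced_form[OF A herm unit, of "\<lambda>_. N"] by blast
  have Bc: "B \<in> carrier_mat n n" by (rule lcongr_carrier[OF B A])
  have Bh: "adj B = B" by (rule lcongr_adj[OF A B herm])
  have star: "B $$ (i,j) = lstar (B $$ (j,i))" if "i < n" "j < n" for i j
    using adj_eq_iff[OF Bc] Bh that by simp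
  have range: "- r j \<le> k \<and> k \<le> r i" if "i < n" "j < n" "lcoeff (B $$ (i,j)) k \<noteq> 0" for i j k
  proof -
    have "k \<le> r i" using deg[OF that(1,2)] that(3) by (force simp: deg_le_def)
    moreover have "lcoeff (B $$ (j,i)) (- k) \<noteq> 0" using that star[OF that(1,2)] by simp
    then have "- k \<le> r j" using deg[OF that(2,1)] by (force simp: deg_le_def)
    ultimately show ?thesis by simp
  qed
  have Lc: "lead_mat n r B \<in> carrier_mat n n" by (simp add: lead_mat_def)
  obtain \<pi> where pi: "\<pi> permutes {0..<n}" and "(\<Prod>i = 0..<n. lead_mat n r B $$ (i, \<pi> i)) \<noteq> 0"
    using L unfolding det_def'[OF Lc] by (auto elim!: sum.not_neutral_contains_not_neutral)
  then have nz: "lcoeff (B $$ (i, \<pi> i)) (r i) \<noteq> 0" if "i < n" for i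
    using that permutes_in_image[OF pi, of i] by (auto simp: lead_mat_def)
  have pin: "\<pi> i < n" if "i < n" for i using that permutes_in_image[OF pi, of i] by auto
  have nonneg: "0 \<le> r i + r (\<pi> i)" if "i < n" for i
    using range[OF that pin[OF that] nz[OF that]] by simp
  have "(\<Sum>i<n. r (\<pi> i)) = (\<Sum>i<n. r i)"
    using sum.permute[OF pi, of r] by (simp add: atLeast0LessThan o_def)
  then have "(\<Sum>i<n. r i + r (\<pi> i)) = 0" using sum0 by (simp add: sum.distrib)
  then have opp: "r (\<pi> i) = - r i" if "i < n" for i
    using sum_nonneg_eq_0_iff[of "{..<n}" "\<lambda>i. r i + r (\<pi> i)"] nonneg that by force
  have "\<exists>i<n. r i \<le> 0"
  proof (rule ccontr)
    assume "\<not> ?thesis"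
    then have "(\<Sum>i<n. r i) > 0" using n by (intro sum_pos) auto
    then show False using sum0 by simp
  qed
  then obtain i where i: "i < n" "r i \<le> 0" by blast
  show ?thesis
  proof (cases "B $$ (i,i) = 0")
    case False
    then obtain k where k: "lcoeff (B $$ (i,i)) k \<noteq> 0" using lpoly_eqI[of "B $$ (i,i)" 0] by auto
    have r0: "r i = 0" using range[OF i(1) i(1) k] i(2) by simp
    define c where "c = Re (lcoeff (B $$ (i,i)) 0)"
    have z: "lcoeff (B $$ (i,i)) k = 0" if "k \<noteq> 0" for k by (rule ccontr) (use range[OF i(1) i(1), of k] r0 that in force)
    have "lcoeff (B $$ (i,i)) 0 = cnj (lcoeff (B $$ (i,i)) 0)"
      using arg_cong[OF star[OF i(1) i(1)], of "\<lambda>f. lcoeff f 0"] by simp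
    then have "lcoeff (B $$ (i,i)) 0 = of_real c" by (simp add: c_def complex_eq_iff)
    then have eq: "B $$ (i,i) = lconst (of_real c)" by (intro lpoly_eqI) (auto simp: z)
    then have "c \<noteq> 0" using False by auto
    then show ?thesis using that B i eq by blast
  next
    case True
    define j where "j = \<pi> i"
    define a where "a = lcoeff (B $$ (i,j)) (r i)"
    have j: "j < n" using pin i by (simp add: j_def)
    have a: "a \<noteq> 0" using nz i by (simp add: a_def j_def)
    have rj: "r j = - r i" using opp i by (simp add: j_def)
    have mono: "B $$ (i,j) = lmonom a (r i)"
      by (intro lpoly_eqI) (use range[OF i(1) j] rj in \<open>force simp: a_def\<close>)
    have ij: "i \<noteq> j" using a True by (auto simp: a_def)
    \<comment> \<open>Adding \<open>f\<close> times row \<open>i\<close> to row \<open>j\<close>,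
      together with the adjoint column operation, changes the entry \<open>(j,j)\<close> by
      \<open>g + lstar g\<close> because \<open>B $$ (i,i) = 0\<close>. The factor \<open>f\<close>
      cancels the monomial, and \<open>g\<close> is half of what is missing to 1.\<close>
    define g where "g = lconst (1 / 2) * (1 - B $$ (j,j))"
    define f where "f = g * lmonom (1 / a) (- r i)"
    have "f * B $$ (i,j) = g * (lmonom (1 / a) (- r i) * lmonom a (r i))"
      unfolding f_def mono by (simp only: mult.assoc)
    then have fB: "f * B $$ (i,j) = g" using a by simp
    have gs: "lstar g = g"
      using star[OF j j] by (simp add: g_def lstar_mult lstar_hom.hom_minus)
    have "lconst (1 / 2) + lconst (1 / 2) = lconst (1 / 2 + 1 / 2)" by (simp only: lconst_hom.hom_add)
    also have "(1 / 2 + 1 / 2 :: complex) = 1" by simp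
    finally have half: "lconst (1 / 2) + lconst (1 / 2) = 1" by (simp only: lconst_hom.hom_one)
    have gg: "g + g = 1 - B $$ (j,j)"
      unfolding g_def distrib_right[symmetric] half by simp
    define e where "e k = (if k = j then 1 else if k = i then f else 0)" for k
    define C where "C = row_elem n j e * B * adj (row_elem n j e)"
    have BC: "lcongr n B C" unfolding C_def by (rule lcongr_row_elem[of j n e 1]) (use j in \<open>auto simp: e_def\<close>)
    have es: "(\<Sum>k<n. e k * h k) = h j + f * h i" for h :: "nat \<Rightarrow> lpoly"
    proof -
      have "(\<Sum>k<n. e k * h k) = (\<Sum>k\<in>{i,j}. e k * h k)"
        by (rule sum.mono_neutral_right) (use i j in \<open>auto simp: e_def\<close>)
      then show ?thesis using ij by (simp add: e_def add.commute)
    qed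
    have es': "(\<Sum>k<n. h k * lstar (e k)) = h j + h i * lstar f" for h :: "nat \<Rightarrow> lpoly"
    proof -
      have "(\<Sum>k<n. h k * lstar (e k)) = (\<Sum>k\<in>{i,j}. h k * lstar (e k))"
        by (rule sum.mono_neutral_right) (use i j in \<open>auto simp: e_def\<close>)
      then show ?thesis using ij by (simp add: e_def add.commute)
    qed
    have "C $$ (j,j) = (\<Sum>k<n. \<Sum>l<n. e k * B $$ (k,l) * lstar (e l))"
      unfolding C_def congr_index[OF Bc row_elem_carrier j j]
      by (intro sum.cong refl) (use j in \<open>auto simp: row_elem_def\<close>)
    also have "\<dots> = (\<Sum>k<n. e k * (B $$ (k,j) + B $$ (k,i) * lstar f))"
      unfolding es' by (simp add: distrib_left mult.assoc)
    also have "\<dots> = B $$ (j,j) + lstar (f * B $$ (i,j)) + f * B $$ (i,j)"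
      unfolding es using True star[OF j i(1)] by (simp add: lstar_mult mult.commute)
    also have "\<dots> = B $$ (j,j) + (g + g)" unfolding fB gs by (simp add: add.assoc)
    finally have "C $$ (j,j) = lconst (complex_of_real 1)" unfolding gg by simp
    then show ?thesis using that[of C j 1] lcongr_trans[OF A B BC] j by auto
  qed
qed

text \<open>The sign of \<open>c\<close> decides to which family the vector \<open>v\<close>, scaled
  by \<open>sqrt \<bar>c\<bar>\<close>, is appended.\<close>

lemma lrep_add_square:
  assumes S: "S \<in> carrier_mat n n" and rep: "lrep p q S" and A: "A \<in> carrier_mat n n" and c: "c \<noteq> 0"
    and AS: "\<And>i j. i < n \<Longrightarrow> j < n \<Longrightarrow> A $$ (i,j) = S $$ (i,j) + v i * lconst (complex_of_real c) * lstar (v j)"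
  shows "\<exists>p' q'. p' + q' = Suc (p + q) \<and> lrep p' q' A"
proof -
  obtain u w where uw: "\<And>i j. i < n \<Longrightarrow> j < n \<Longrightarrow>
     S $$ (i,j) = (\<Sum>k<p. u k i * lstar (u k j)) - (\<Sum>k<q. w k i * lstar (w k j))"
    using S rep unfolding lrep_def by auto
  define x where "x i = lconst (of_real (sqrt \<bar>c\<bar>)) * v i" for i
  have "lconst (of_real (sqrt \<bar>c\<bar>)) * lconst (of_real (sqrt \<bar>c\<bar>)) = lconst (of_real \<bar>c\<bar>)"
    by (simp flip: lconst_hom.hom_mult of_real_mult)
  then have xx: "x i * lstar (x j) = v i * lconst (of_real \<bar>c\<bar>) * lstar (v j)" for i j
    unfolding x_def lstar_mult lstar_lconst complex_cnj_complex_of_real by (metis (no_types, lifting) mult.assoc mult.commute)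
  have Ad: "dim_row A = n" using A by auto
  show ?thesis
  proof (cases "c > 0")
    case True
    have "lrep (Suc p) q A"
      unfolding lrep_def Ad
    proof (rule exI[of _ "u(p := x)"], rule exI[of _ w], intro allI impI)
      fix i j assume "i < n" "j < n"
      then show "A $$ (i,j) = (\<Sum>k<Suc p. (u(p := x)) k i * lstar ((u(p := x)) k j)) - (\<Sum>k<q. w k i * lstar (w k j))"
        using AS uw xx True by simp
    qed
    then show ?thesis by (intro exI[of _ "Suc p"] exI[of _ q]) simp
  next
    case False
    then have cc: "lconst (complex_of_real \<bar>c\<bar>) = - lconst (of_real c)"
      by (simp add: lconst_hom.hom_uminus)
    have "lrep p (Suc q) A"
      unfolding lrep_def Ad
    proof (rule exI[of _ u], rule exI[of _ "w(q := x)"], intro allI impI)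
      fix i j assume "i < n" "j < n"
      then show "A $$ (i,j) = (\<Sum>k<p. u k i * lstar (u k j)) - (\<Sum>k<Suc q. (w(q := x)) k i * lstar ((w(q := x)) k j))"
        using AS uw xx cc by simp
    qed
    then show ?thesis by (intro exI[of _ p] exI[of _ "Suc q"]) simp
  qed
qed

theorem unimodular_lrep:
  assumes "A \<in> carrier_mat n n" "adj A = A" "det A dvd 1"
  shows "\<exists>p q. p + q = n \<and> lrep p q A"
  using assms
proof (induction n arbitrary: A)
  case 0
  then show ?case by (auto simp: lrep_def)
next
  case (Suc m)
  let ?n = "Suc m"
  obtain B i c where B: "lcongr ?n A B" and i: "i < ?n" and c: "c \<noteq> 0" and Bii: "B $$ (i,i) = lconst (complex_of_real c)"
    using unit_diagonal_entry[OF Suc.prems] by blast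
  have Bc: "B \<in> carrier_mat ?n ?n" by (rule lcongr_carrier[OF B Suc.prems(1)])
  have Bh: "adj B = B" by (rule lcongr_adj[OF Suc.prems(1) B Suc.prems(2)])
  have Bu: "det B dvd 1" by (rule lcongr_det[OF Suc.prems(1) B Suc.prems(3)])
  have star: "lstar (B $$ (j,i)) = B $$ (i,j)" if "i < ?n" "j < ?n" for i j
    using adj_eq_iff[OF Bc] Bh that by simp
  let ?c = "lconst (complex_of_real c)" and ?d = "lconst (complex_of_real (1 / c))"
  have cd: "?c * ?d = 1" using c by (simp flip: lconst_hom.hom_mult of_real_mult)
  \<comment> \<open>The Schur complement kept at full size: its row and column \<open>i\<close>
    vanish, so indices need not be shifted until \<open>A1\<close> is extracted.\<close>
  define S where "S = mat ?n ?n (\<lambda>(j,k). B $$ (j,k) - B $$ (j,i) * ?d * B $$ (i,k))"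
  have Sc: "S \<in> carrier_mat ?n ?n" by (simp add: S_def)
  have dc: "?d * ?c = 1" using cd by (simp only: mult.commute)
  have Si: "S $$ (j,i) = 0" "S $$ (i,j) = 0" if j: "j < ?n" for j
  proof -
    have "B $$ (j,i) * ?d * ?c = B $$ (j,i)" by (simp only: mult.assoc dc mult_1_right)
    then show "S $$ (j,i) = 0" using j i by (simp add: S_def Bii)
    have "?c * ?d * B $$ (i,j) = B $$ (i,j)" by (simp only: cd mult_1)
    then show "S $$ (i,j) = 0" using j i by (simp add: S_def Bii)
  qed
  define A1 where "A1 = mat_delete S i i"
  have A1: "A1 \<in> carrier_mat m m" using mat_delete_carrier[OF Sc, of i i] by (simp add: A1_def)
  have A1i: "A1 $$ (j,k) = S $$ (insert_index i j, insert_index i k)" if "j < m" "k < m" for j k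
    unfolding A1_def by (rule mat_delete_index[OF Sc i i that, symmetric])
  have ins: "insert_index i j < ?n" if "j < m" for j using that by (auto simp: insert_index_def)
  have Sh: "lstar (S $$ (j,k)) = S $$ (k,j)" if "j < ?n" "k < ?n" for j k
    using that i star by (simp add: S_def lstar_hom.hom_minus lstar_mult mult_ac)
  have A1h: "adj A1 = A1" unfolding adj_eq_iff[OF A1] using A1i ins Sh by simp
  have A1u: "det A1 dvd 1"
  proof -
    \<comment> \<open>The transposed row matrix subtracts multiples of row \<open>i\<close> from the
      other rows. This one-sided elimination clears column \<open>i\<close> apart from the pivot,
      and Laplace expansion then relates \<open>det A1\<close> to \<open>det B\<close>.\<close>
    define e where "e k = (if k = i then 1 else - B $$ (k,i) * ?d)" for k
    define F where "F = transpose_mat (row_elem ?n i e)"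
    have F: "F \<in> carrier_mat ?n ?n" by (simp add: F_def)
    have Fu: "det F dvd 1"
      unfolding F_def det_transpose[OF row_elem_carrier]
      by (rule det_row_elem_unit[of _ _ _ 1]) (use i in \<open>auto simp: e_def\<close>)
    have FB: "(F * B) $$ (j,k) = (if j = i then B $$ (i,k) else S $$ (j,k))" if jk: "j < ?n" "k < ?n" for j k
    proof -
      have "(F * B) $$ (j,k) = (\<Sum>l<?n. F $$ (j,l) * B $$ (l,k))"
        by (rule index_mult_sum[OF F Bc jk])
      also have "\<dots> = (\<Sum>l<?n. (if l = i then e j * B $$ (i,k) else 0) + (if l = j \<and> j \<noteq> i then B $$ (j,k) else 0))"
        by (intro sum.cong refl) (use jk i in \<open>auto simp: F_def row_elem_def\<close>)
      also have "\<dots> = e j * B $$ (i,k) + (if j \<noteq> i then B $$ (j,k) else 0)"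
        unfolding sum.distrib using jk i by (cases "j = i") (simp_all add: sum.delta del: sum.lessThan_Suc)
      finally show ?thesis using jk i by (auto simp: e_def S_def)
    qed
    have FBc: "F * B \<in> carrier_mat ?n ?n" using F Bc by auto
    have "det (F * B) = (\<Sum>j<?n. (F * B) $$ (j,i) * cofactor (F * B) j i)"
      by (rule laplace_expansion_column[OF FBc i])
    also have "\<dots> = (\<Sum>j<?n. if j = i then ?c * cofactor (F * B) i i else 0)"
      by (intro sum.cong refl) (use i Si FB Bii in auto)
    also have "\<dots> = ?c * cofactor (F * B) i i" using i by (simp add: sum.delta del: sum.lessThan_Suc)
    also have "cofactor (F * B) i i = det A1"
    proof -
      have "mat_delete (F * B) i i = A1"
      proof (rule eq_matI)
        fix j k assume "j < dim_row A1" "k < dim_col A1"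
        then have jk: "j < m" "k < m" using A1 by auto
        have "mat_delete (F * B) i i $$ (j,k) = (F * B) $$ (insert_index i j, insert_index i k)"
          by (rule mat_delete_index[OF FBc i i jk, symmetric])
        then show "mat_delete (F * B) i i $$ (j,k) = A1 $$ (j,k)"
          using FB[OF ins[OF jk(1)] ins[OF jk(2)]] A1i[OF jk] by simp
      qed (use A1 mat_delete_carrier[OF FBc, of i i] in auto)
      then show ?thesis by (simp add: cofactor_def)
    qed
    finally have "?c * det A1 = det F * det B" using det_mult[OF F Bc] by simp
    then have "?c * det A1 dvd 1" using Fu Bu by (metis mult_dvd_mono mult_1)
    then show ?thesis by (rule dvd_mult_right)
  qed
  obtain p q where pq: "p + q = m" "lrep p q A1"
    using Suc.IH[OF A1 A1h A1u] by blast
  have "lrep p q S"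
  proof -
    obtain u w where uw: "\<And>j k. j < m \<Longrightarrow> k < m \<Longrightarrow>
       A1 $$ (j,k) = (\<Sum>l<p. u l j * lstar (u l k)) - (\<Sum>l<q. w l j * lstar (w l k))"
      using A1 pq(2) unfolding lrep_def by auto
    define X where "X v l j = (if j = i then 0 else v l (delete_index i j))" for v :: "nat \<Rightarrow> nat \<Rightarrow> lpoly" and l j
    have "S $$ (j,k) = (\<Sum>l<p. X u l j * lstar (X u l k)) - (\<Sum>l<q. X w l j * lstar (X w l k))"
      if jk: "j < ?n" "k < ?n" for j k
    proof (cases "j = i \<or> k = i")
      case True
      then show ?thesis using Si jk by (auto simp: X_def)
    next
      case False
      have "delete_index i j < m" "delete_index i k < m"
        using False jk i by (auto simp: delete_index_def)
      moreover have "insert_index i (delete_index i j) = j" "insert_index i (delete_index i k) = k"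
        using False by (auto intro: insert_delete_index)
      ultimately show ?thesis
        using A1i[of "delete_index i j" "delete_index i k"] uw False by (simp add: X_def)
    qed
    then show ?thesis unfolding lrep_def using Sc by (intro exI[of _ "X u"] exI[of _ "X w"]) auto
  qed
  moreover have "B $$ (j,k) = S $$ (j,k) + B $$ (j,i) * lconst (complex_of_real (1 / c)) * lstar (B $$ (k,i))"
    if "j < ?n" "k < ?n" for j k
    using that star[OF i that(2)] by (simp add: S_def)
  ultimately obtain p' q' where "p' + q' = Suc (p + q)" "lrep p' q' B"
    using lrep_add_square[OF Sc _ Bc, of p q "1 / c"] c by fastforce
  then show ?case using lcongr_lrep[OF Suc.prems(1) B] pq by auto
qed

section \<open>Splitting off roots of the determinant\<close>

definition leval_mat :: "complex \<Rightarrow> lpoly mat \<Rightarrow> complex mat" where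
  "leval_mat z A = map_mat (leval z) A"

lemma leval_mat_carrier [simp]: "leval_mat z A \<in> carrier_mat n m \<longleftrightarrow> A \<in> carrier_mat n m"
  unfolding leval_mat_def by (rule map_carrier_mat)

lemma leval_mat_index [simp]: "i < dim_row A \<Longrightarrow> j < dim_col A \<Longrightarrow> leval_mat z A $$ (i,j) = leval z (A $$ (i,j))"
  by (simp add: leval_mat_def)

lemma leval_mat_mult:
  assumes "z \<noteq> 0" "A \<in> carrier_mat n m" "B \<in> carrier_mat m l"
  shows "leval_mat z (A * B) = leval_mat z A * leval_mat z B"
proof -
  interpret comm_ring_hom "leval z" by (rule leval_hom) fact
  show ?thesis unfolding leval_mat_def by (rule mat_hom_mult[OF assms(2,3)])
qed

lemma det_leval_mat: "z \<noteq> 0 \<Longrightarrow> det (leval_mat z A) = leval z (det A)"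
proof -
  assume "z \<noteq> 0"
  then interpret comm_ring_hom "leval z" by (rule leval_hom)
  show ?thesis unfolding leval_mat_def by (rule hom_det)
qed

lemma leval_mat_adj: "cmod z = 1 \<Longrightarrow> leval_mat z (adj A) = hadj cnj (leval_mat z A)"
  by (rule eq_matI) (auto simp: leval_mat_def leval_lstar)

lemma hermitian_leval_mat:
  "cmod z = 1 \<Longrightarrow> adj A = A \<Longrightarrow> hadj cnj (leval_mat z A) = leval_mat z A"
  using leval_mat_adj[of z A] by simp

text \<open>Only an inequality, valid for every \<open>V\<close>; the split-off factors may be
  singular at points of the circle.\<close>

lemma nu_congruence_le:
  assumes H: "H \<in> carrier_mat m m" "hadj cnj H = H" and V: "V \<in> carrier_mat n m"
    and G: "G = V * H * hadj cnj V" "hadj cnj G = G"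
  shows "nu_pos G \<le> nu_pos H" and "nu_neg G \<le> nu_neg H"
proof -
  have Gc: "G \<in> carrier_mat n n" unfolding G(1) using V by auto
  \<comment> \<open>\<open>gram\<close> conjugates its left factor, hence the conjugate
    transpose.\<close>
  define W where "W i a = cnj (V $$ (a,i))" for i a
  have G': "G $$ (i,j) = gram m (\<lambda>i j. H $$ (i,j)) W i j" if "i < n" "j < n" for i j
    unfolding G(1) congr_index[OF H(1) V that] by (simp add: gram_def W_def)
  have neg: "gram m (\<lambda>i j. - H $$ (i,j)) W a b = - gram m (\<lambda>i j. H $$ (i,j)) W a b" for a b
    by (simp add: gram_def sum_negf)
  have "posdim n (gram m (\<lambda>i j. H $$ (i,j)) W) (nu_pos G)"
    using nu_pos_posdim(3)[OF Gc G(2)] posdim_cong[of n "\<lambda>i j. G $$ (i,j)" "gram m (\<lambda>i j. H $$ (i,j)) W"] G' by simp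
  then show "nu_pos G \<le> nu_pos H" by (rule nu_pos_posdim(1)[OF H posdim_congruence])
  have "posdim n (gram m (\<lambda>i j. - H $$ (i,j)) W) (nu_neg G)"
    using nu_pos_posdim(4)[OF Gc G(2)] posdim_cong[of n "\<lambda>i j. - G $$ (i,j)" "gram m (\<lambda>i j. - H $$ (i,j)) W"] G' neg by simp
  then show "nu_neg G \<le> nu_neg H" by (rule nu_pos_posdim(2)[OF H posdim_congruence])
qed

text \<open>At a point of the circle the star becomes complex conjugation, so the representation
  evaluates to signed squares, and \<open>posdim_le_card\<close> over their disjoint index set
  bounds each index by the number of squares of that sign.\<close>

lemma lrep_nu_le:
  assumes A: "A \<in> carrier_mat n n" and herm: "adj A = A" and rep: "lrep p q A" and z: "cmod z = 1"
  shows "nu_pos (leval_mat z A) \<le> p" and "nu_neg (leval_mat z A) \<le> q"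
proof -
  have nz: "z \<noteq> 0" using z by auto
  interpret ev: comm_ring_hom "leval z" by (rule leval_hom[OF nz])
  obtain u w where uw: "\<And>i j. i < n \<Longrightarrow> j < n \<Longrightarrow>
     A $$ (i,j) = (\<Sum>k<p. u k i * lstar (u k j)) - (\<Sum>k<q. w k i * lstar (w k j))"
    using A rep unfolding lrep_def by auto
  define t where "t i k = (case k of Inl k \<Rightarrow> leval z (u k i) | Inr k \<Rightarrow> leval z (w k i))" for i and k :: "nat + nat"
  define e :: "nat + nat \<Rightarrow> real" where "e k = (case k of Inl k \<Rightarrow> 1 | Inr k \<Rightarrow> - 1)" for k
  define K where "K = {..<p} <+> {..<q}"
  have fin: "finite K" by (simp add: K_def)
  have H: "leval_mat z A $$ (i,j) = (\<Sum>k\<in>K. of_real (e k) * t i k * cnj (t j k))" if "i < n" "j < n" for i j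
    using that A uw[OF that] unfolding K_def
    by (simp add: sum.Plus t_def e_def ev.hom_minus ev.hom_sum ev.hom_mult leval_lstar[OF z] sum_negf)
  have c1: "{k \<in> K. e k > 0} = Inl ` {..<p}" and c2: "{k \<in> K. - e k > 0} = Inr ` {..<q}"
    by (auto simp: K_def Plus_def e_def)
  have Hc: "leval_mat z A \<in> carrier_mat n n" using A by simp
  note Hh = hermitian_leval_mat[OF z herm]
  have "nu_pos (leval_mat z A) \<le> card {k \<in> K. e k > 0}"
    by (rule posdim_le_card[OF fin H nu_pos_posdim(3)[OF Hc Hh]])
  then show "nu_pos (leval_mat z A) \<le> p" unfolding c1 by (simp add: card_image)
  have "nu_neg (leval_mat z A) \<le> card {k \<in> K. - e k > 0}"
  proof (rule posdim_le_card[OF fin _ nu_pos_posdim(4)[OF Hc Hh]])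
    show "- leval_mat z A $$ (i,j) = (\<Sum>k\<in>K. of_real (- e k) * t i k * cnj (t j k))" if "i < n" "j < n" for i j
      unfolding H[OF that] sum_negf[symmetric] by (intro sum.cong refl) simp
  qed
  then show "nu_neg (leval_mat z A) \<le> q" unfolding c2 by (simp add: card_image)
qed

lemma det_mat_diag: "det (mat_diag n f) = (\<Prod>i<n. f i)"
proof -
  have ut: "upper_triangular (mat_diag n f)" by (auto simp: mat_diag_def)
  have "diag_mat (mat_diag n f) = map f [0..<n]" by (auto simp: diag_mat_def mat_diag_def)
  then show ?thesis
    using det_upper_triangular[OF ut, of n] by (simp add: prod.list_conv_set_nth atLeast0LessThan)
qed

lemma lroot_star:
  assumes "a \<noteq> 0"
  shows "lstar (lroot a) = lmonom (- cnj a) (- 1) * lroot (inverse (cnj a))"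
  using assms by (intro lpoly_eqI) (auto simp: lroot_def)

text \<open>Since \<open>lstar (lroot a)\<close> is a unit times \<open>lroot (inverse (cnj a))\<close>, the last hypothesis says that
  the diagonal entry in the direction \<open>v\<close> is divisible by \<open>lroot a * lstar (lroot a)\<close>.\<close>

lemma split_off_root:
  assumes A: "A \<in> carrier_mat n n" and herm: "adj A = A" and a: "a \<noteq> 0" and i: "i < n" "v i \<noteq> 0"
    and row: "\<And>j. j < n \<Longrightarrow> leval a (\<Sum>k<n. lconst (v k) * A $$ (k,j)) = 0"
    and diag: "(\<Sum>k<n. \<Sum>l<n. lconst (v k) * A $$ (k,l) * lstar (lconst (v l))) = lroot a * g"
    and g: "leval (inverse (cnj a)) g = 0"
  obtains B A1 c where "B \<in> carrier_mat n n" "A1 \<in> carrier_mat n n" "adj A1 = A1" "A = B * A1 * adj B"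
    "c \<noteq> 0" "lconst c * det A = lroot a * lstar (lroot a) * det A1"
proof -
  define e where "e k = lconst (v k)" for k
  define d where "d = lconst (1 / v i)"
  have ed: "e i * d = 1" using i by (simp add: e_def d_def flip: lconst_hom.hom_mult)
  \<comment> \<open>\<open>E\<close> replaces row \<open>i\<close> by the combination given by
    \<open>v\<close>: the row of \<open>C\<close> then vanishes at \<open>a\<close> and its diagonal
    entry is the one described by the hypothesis.\<close>
  define E where "E = row_elem n i e"
  have E: "E \<in> carrier_mat n n" by (simp add: E_def)
  define E' where "E' = row_elem n i (\<lambda>s. if s = i then d else - d * e s)"
  have E': "E' \<in> carrier_mat n n" by (simp add: E'_def)
  have EE: "E' * E = 1\<^sub>m n" unfolding E_def E'_def by (rule row_elem_inverse'[where i = i and c = e, OF i(1) ed])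
  define C where "C = E * A * adj E"
  have C: "C \<in> carrier_mat n n" using E A by (auto simp: C_def)
  have Ch: "adj C = C" unfolding C_def by (rule adj_congruence[OF A E herm])
  have star: "lstar (C $$ (j,k)) = C $$ (k,j)" if "j < n" "k < n" for j k
    using adj_eq_iff[OF C] Ch that by simp
  have Crow: "C $$ (i,j) = (\<Sum>k<n. e k * A $$ (k,j))" if j: "j < n" "j \<noteq> i" for j
  proof -
    have "C $$ (i,j) = (\<Sum>k<n. \<Sum>l<n. E $$ (i,k) * A $$ (k,l) * lstar (E $$ (j,l)))"
      unfolding C_def by (rule congr_index[OF A E i(1) j(1)])
    also have "\<dots> = (\<Sum>k<n. \<Sum>l<n. if l = j then e k * A $$ (k,j) else 0)"
      by (intro sum.cong refl) (use i j in \<open>auto simp: E_def row_elem_def\<close>)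
    finally show ?thesis using j by simp
  qed
  have Cdiag: "C $$ (i,i) = lroot a * g"
  proof -
    have "C $$ (i,i) = (\<Sum>k<n. \<Sum>l<n. E $$ (i,k) * A $$ (k,l) * lstar (E $$ (i,l)))"
      unfolding C_def by (rule congr_index[OF A E i(1) i(1)])
    also have "\<dots> = (\<Sum>k<n. \<Sum>l<n. lconst (v k) * A $$ (k,l) * lstar (lconst (v l)))"
      by (intro sum.cong refl) (use i in \<open>auto simp: E_def row_elem_def e_def\<close>)
    finally show ?thesis unfolding diag .
  qed
  have "\<forall>j\<in>{..<n}-{i}. \<exists>h. C $$ (i,j) = lroot a * h"
    using lroot_dvd[OF a row] Crow unfolding e_def dvd_def by auto
  then obtain h where h: "\<And>j. j < n \<Longrightarrow> j \<noteq> i \<Longrightarrow> C $$ (i,j) = lroot a * h j" by (metis DiffI lessThan_iff singletonD)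
  obtain g' where "g = lroot (inverse (cnj a)) * g'"
    using lroot_dvd[OF _ g] a by (auto simp: dvd_def)
  then have "g = lstar (lroot a) * (lmonom (- inverse (cnj a)) 1 * g')"
    unfolding lroot_star[OF a] using a by (simp add: mult_ac)
  then obtain g2 where g2: "g = lstar (lroot a) * g2" by blast
  have "lcoeff (lroot a) 1 = 1" by (simp add: lroot_def)
  then have lr0: "lroot a \<noteq> 0" by auto
  have lrs0: "lstar (lroot a) \<noteq> 0" using lr0 lstar_lstar[of "lroot a"] lstar_hom.hom_zero by metis
  have "lstar (lroot a * (lstar (lroot a) * g2)) = lroot a * (lstar (lroot a) * g2)"
    using star[OF i(1) i(1)] unfolding Cdiag g2 .
  then have "lroot a * lstar (lroot a) * lstar g2 = lroot a * lstar (lroot a) * g2"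
    by (simp add: lstar_mult mult_ac)
  then have g2h: "lstar g2 = g2" using lr0 lrs0 by simp
  \<comment> \<open>\<open>C\<close> with \<open>lroot a\<close> divided out of row \<open>i\<close>
    and its star out of column \<open>i\<close>; both are divided out of the corner entry, leaving
    \<open>g2\<close>.\<close>
  define A1 where "A1 = mat n n (\<lambda>(j,k). if j = i then (if k = i then g2 else h k)
      else (if k = i then lstar (h j) else C $$ (j,k)))"
  have A1: "A1 \<in> carrier_mat n n" by (simp add: A1_def)
  have A1h: "adj A1 = A1"
    unfolding adj_eq_iff[OF A1] using g2h star by (auto simp: A1_def)
  define \<delta> where "\<delta> j = (if j = i then lroot a else 1)" for j
  define \<Delta> where "\<Delta> = mat_diag n \<delta>"
  have D: "\<Delta> \<in> carrier_mat n n" by (simp add: \<Delta>_def)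
  have CD: "C = \<Delta> * A1 * adj \<Delta>"
  proof (rule eq_matI)
    fix j k assume "j < dim_row (\<Delta> * A1 * adj \<Delta>)" "k < dim_col (\<Delta> * A1 * adj \<Delta>)"
    then have jk: "j < n" "k < n" using D by auto
    have "(\<Delta> * A1 * adj \<Delta>) $$ (j,k) = (\<Sum>x<n. \<Sum>y<n. \<Delta> $$ (j,x) * A1 $$ (x,y) * lstar (\<Delta> $$ (k,y)))"
      by (rule congr_index[OF A1 D jk])
    also have "\<dots> = (\<Sum>x<n. \<Sum>y<n. if y = k then (if x = j then \<delta> j * A1 $$ (j,k) * lstar (\<delta> k) else 0) else 0)"
      by (intro sum.cong refl) (use jk in \<open>auto simp: \<Delta>_def mat_diag_def\<close>)
    also have "\<dots> = \<delta> j * A1 $$ (j,k) * lstar (\<delta> k)" using jk by simp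
    also have "\<dots> = C $$ (j,k)"
      using jk h[of k] h[of j] star[of i j] Cdiag g2 by (auto simp: \<delta>_def A1_def lstar_mult mult_ac)
    finally show "C $$ (j,k) = (\<Delta> * A1 * adj \<Delta>) $$ (j,k)" ..
  qed (use C D in auto)
  have aE: "adj E \<in> carrier_mat n n" "adj E' \<in> carrier_mat n n" "adj \<Delta> \<in> carrier_mat n n" using E E' D by auto
  have EE': "adj E * adj E' = 1\<^sub>m n" using adj_mult[OF E' E] EE by simp
  have "E' * C * adj E' = (E' * E) * A * (adj E * adj E')"
    unfolding C_def using E E' aE A by (simp add: assoc_mult_mat[of _ n n _ n _ n] mult_carrier_mat[of _ n n _ n])
  then have "A = E' * C * adj E'" using EE EE' A by simp
  also have "\<dots> = (E' * \<Delta>) * A1 * adj (E' * \<Delta>)"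
    unfolding CD adj_mult[OF E' D] using E' D aE A1
    by (simp add: assoc_mult_mat[of _ n n _ n _ n] mult_carrier_mat[of _ n n _ n])
  finally have AB: "A = (E' * \<Delta>) * A1 * adj (E' * \<Delta>)" .
  have detC: "det C = det E * det A * lstar (det E)"
    unfolding C_def using E A aE by (simp add: det_mult[of _ n] det_adj[OF E] mult_carrier_mat[of _ n n _ n])
  have detC': "det C = lroot a * lstar (lroot a) * det A1"
  proof -
    have "det \<Delta> = lroot a" unfolding \<Delta>_def det_mat_diag \<delta>_def using i by simp
    then show ?thesis unfolding CD using D A1 aE
      by (simp add: det_mult[of _ n] det_adj[OF D] mult_carrier_mat[of _ n n _ n] mult_ac)
  qed
  \<comment> \<open>\<open>E\<close> has constant entries, so it affects the determinant only by a
    nonzero constant and not its degree.\<close>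
  have "E = map_mat lconst (row_elem n i v)"
    by (rule eq_matI) (auto simp: E_def row_elem_def e_def)
  then have detE: "det E = lconst (det (row_elem n i v))" by (simp only: lconst_hom.hom_det)
  have "det (row_elem n i v) dvd 1"
    by (rule det_row_elem_unit[of i n v "1 / v i"]) (use i in auto)
  then have nz: "det (row_elem n i v) \<noteq> 0" by auto
  define c where "c = det (row_elem n i v) * cnj (det (row_elem n i v))"
  have "lconst c * det A = lroot a * lstar (lroot a) * det A1"
    unfolding detC'[symmetric] detC detE c_def by (simp add: lconst_hom.hom_mult mult_ac)
  moreover have "c \<noteq> 0" using nz by (simp add: c_def)
  ultimately show ?thesis using that[of "E' * \<Delta>" A1 c] AB A1 A1h E' D by (auto intro: mult_carrier_mat)
qed

text \<open>The difference quotient of \<open>f\<close> at \<open>a\<close>. For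
  \<open>a \<noteq> 0\<close> it is a Laurent polynomial, and its value at \<open>a\<close> is the
  derivative of \<open>f\<close> there.\<close>

definition lquot :: "complex \<Rightarrow> lpoly \<Rightarrow> lpoly" where
  "lquot a f = (SOME g. f - lconst (leval a f) = lroot a * g)"

lemma lquot: "a \<noteq> 0 \<Longrightarrow> f - lconst (leval a f) = lroot a * lquot a f"
proof -
  assume a: "a \<noteq> 0"
  interpret ev: comm_ring_hom "leval a" by (rule leval_hom[OF a])
  have "lroot a dvd f - lconst (leval a f)" by (rule lroot_dvd[OF a]) (simp add: ev.hom_minus)
  then show ?thesis unfolding lquot_def dvd_def by (rule someI_ex)
qed

text \<open>The chain rule along \<open>a * cis t\<close>, whose velocity at 0 is
  \<open>\<i> * a\<close>. Factoring out \<open>lroot a\<close> first leaves only the limit of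
  \<open>(cis t - 1) / t\<close>.\<close>

lemma leval_circle_derivative:
  assumes "a \<noteq> 0"
  shows "((\<lambda>t. (leval (a * cis t) f - leval a f) / of_real t) \<longlongrightarrow> \<i> * a * leval a (lquot a f)) (at 0)"
proof -
  have "((\<lambda>h. (exp (0 + h) - exp 0) / h) \<longlongrightarrow> exp (0::complex)) (at 0)"
    using DERIV_exp[of "0::complex"] unfolding DERIV_def .
  moreover have "filterlim (\<lambda>t. \<i> * complex_of_real t) (at 0) (at 0)"
    unfolding filterlim_at
  proof
    have "((\<lambda>t. \<i> * complex_of_real t) \<longlongrightarrow> \<i> * complex_of_real 0) (at 0)" by (intro tendsto_intros)
    then show "((\<lambda>t. \<i> * complex_of_real t) \<longlongrightarrow> 0) (at 0)" by simp
    show "\<forall>\<^sub>F t in at 0. \<i> * complex_of_real t \<in> UNIV \<and> \<i> * complex_of_real t \<noteq> 0"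
      unfolding eventually_at_filter by auto
  qed
  ultimately have "((\<lambda>t. (exp (0 + \<i> * complex_of_real t) - exp 0) / (\<i> * complex_of_real t)) \<longlongrightarrow> exp 0) (at 0)"
    by (rule filterlim_compose)
  then have "((\<lambda>t. \<i> * ((exp (0 + \<i> * complex_of_real t) - exp 0) / (\<i> * complex_of_real t))) \<longlongrightarrow> \<i> * exp 0) (at 0)"
    by (rule tendsto_mult[OF tendsto_const])
  then have 1: "((\<lambda>t. (cis t - 1) / of_real t) \<longlongrightarrow> \<i>) (at 0)"
    by (simp add: cis_conv_exp)
  have 2: "((\<lambda>t. leval (a * cis t) (lquot a f)) \<longlongrightarrow> leval a (lquot a f)) (at 0)"
    by (rule tendsto_leval[OF tendsto_mult_cis assms])
  have lim: "((\<lambda>t. a * ((cis t - 1) / of_real t) * leval (a * cis t) (lquot a f)) \<longlongrightarrow> a * \<i> * leval a (lquot a f)) (at 0)"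
    by (intro tendsto_intros 1 2)
  have eq: "a * ((cis t - 1) / of_real t) * leval (a * cis t) (lquot a f) = (leval (a * cis t) f - leval a f) / of_real t" for t
  proof -
    have nz: "a * cis t \<noteq> 0" using assms by simp
    interpret ev: comm_ring_hom "leval (a * cis t)" by (rule leval_hom[OF nz])
    have "leval (a * cis t) f - leval a f = (a * cis t - a) * leval (a * cis t) (lquot a f)"
      using arg_cong[OF lquot[OF assms, of f], of "leval (a * cis t)"] by (simp add: ev.hom_minus ev.hom_mult)
    then show ?thesis by (simp add: field_simps)
  qed
  show ?thesis using lim unfolding eq by (simp only: mult_ac)
qed

section \<open>Constant signature\<close>

text \<open>Provides the data for \<open>split_off_root\<close> on the circle: the combined row
  vanishes at \<open>a\<close> and its diagonal entry vanishes there to second order. In an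
  eigenbasis of \<open>A(a)\<close> the relevant form is the block of the derivative on the kernel
  indices \<open>Z\<close>.\<close>

lemma isotropic_kernel_vector:
  assumes A: "A \<in> carrier_mat n n" and herm: "adj A = A" and a: "cmod a = 1" and root: "leval a (det A) = 0"
    and F: "finite F" and pq: "p + q \<le> n"
    and nu: "\<And>z. cmod z = 1 \<Longrightarrow> z \<notin> F \<Longrightarrow> nu_pos (leval_mat z A) = p \<and> nu_neg (leval_mat z A) = q"
  shows "\<exists>v i. i < n \<and> v i \<noteq> 0 \<and> (\<forall>j<n. leval a (\<Sum>k<n. lconst (v k) * A $$ (k,j)) = 0) \<and>
    leval a (lquot a (\<Sum>k<n. \<Sum>l<n. lconst (v k) * A $$ (k,l) * lstar (lconst (v l)))) = 0"
proof -
  have a0: "a \<noteq> 0" using a by auto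
  interpret ev: comm_ring_hom "leval a" by (rule leval_hom[OF a0])
  define H where "H z i j = leval z (A $$ (i,j))" for z i j
  have Hmat: "leval_mat z A $$ (i,j) = H z i j" if "i < n" "j < n" for z i j
    using A that by (simp add: H_def)
  have star: "lstar (A $$ (j,i)) = A $$ (i,j)" if "i < n" "j < n" for i j
    using adj_eq_iff[OF A] herm that by simp
  have Hh: "H z i j = cnj (H z j i)" if "cmod z = 1" "i < n" "j < n" for z i j
    unfolding H_def leval_lstar[OF that(1), symmetric] star[OF that(2,3)] by simp
  have Hc: "leval_mat z A \<in> carrier_mat n n" for z using A by simp
  obtain W e where *: "\<forall>i<n. \<forall>j<n. leval_mat a A $$ (i,j) = (\<Sum>k<n. of_real (e k) * W i k * cnj (W j k))"
    "\<forall>b<n. \<forall>b'<n. gram n (\<lambda>i j. leval_mat a A $$ (i,j)) W b b' = (if b = b' then of_real (e b) else 0)"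
    "\<forall>b<n. \<forall>b'<n. (\<Sum>i<n. cnj (W i b) * W i b') = (if b = b' then 1 else 0)"
    and det: "det (leval_mat a A) \<noteq> 0 \<longleftrightarrow> (\<forall>k<n. e k \<noteq> (0::real))"
    using hermitian_spectral[OF Hc hermitian_leval_mat[OF a herm]] by blast
  have s: "H a i j = (\<Sum>k<n. of_real (e k) * W i k * cnj (W j k))" if "i < n" "j < n" for i j
    using *(1) Hmat that by simp
  have g: "gram n (H a) W b b' = (if b = b' then of_real (e b) else 0)" if "b < n" "b' < n" for b b'
    using *(2) that gram_cong[of n "\<lambda>i j. leval_mat a A $$ (i,j)" "H a" W b b'] Hmat by simp
  have orth: "(\<Sum>i<n. cnj (W i b) * W i b') = (if b = b' then 1 else 0)" if "b < n" "b' < n" for b b'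
    using *(3) that by simp
  define Z where "Z = {k. k < n \<and> e k = 0}"
  have finZ: "finite Z" by (simp add: Z_def)
  have Zne: "Z \<noteq> {}" using det root det_leval_mat[OF a0, of A] by (auto simp: Z_def)
  define T where "T t = gram n (H (a * cis t)) W" for t
  define d where "d i j = \<i> * a * leval a (lquot a (A $$ (i,j)))" for i j
  define D where "D = gram n d W"
  have n1: "cmod (a * cis t) = 1" for t using a by (simp add: norm_mult)
  have Th: "T t b b' = cnj (T t b' b)" for t b b'
    unfolding T_def by (rule gram_hermitian) (rule Hh[OF n1])
  have dlim: "((\<lambda>t. (H (a * cis t) i j - H a i j) / of_real t) \<longlongrightarrow> d i j) (at 0)" for i j
    unfolding H_def d_def by (rule leval_circle_derivative[OF a0])
  have Tlim: "((\<lambda>t. (T t b b' - T 0 b b') / of_real t) \<longlongrightarrow> D b b') (at 0)" for b b'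
  proof -
    have "((\<lambda>t. gram n (\<lambda>i j. (H (a * cis t) i j - H a i j) / of_real t) W b b') \<longlongrightarrow> D b b') (at 0)"
      unfolding gram_def D_def by (intro tendsto_sum tendsto_mult tendsto_const dlim)
    moreover have "gram n (\<lambda>i j. (H (a * cis t) i j - H a i j) / of_real t) W b b' = (T t b b' - T 0 b b') / of_real t" for t
      unfolding T_def gram_def sum_subtractf[symmetric] sum_divide_distrib
      by (intro sum.cong refl) (simp add: algebra_simps diff_divide_distrib)
    ultimately show ?thesis by simp
  qed
  \<comment> \<open>All \<open>T t\<close> are Hermitian because the path stays on the circle, and
    this passes to the limit of the difference quotients. The derivative with respect to the complex
    variable would in general not be Hermitian.\<close>
  have Dh: "D b b' = cnj (D b' b)" for b b'
  proof (rule tendsto_unique[OF _ Tlim])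
    have "((\<lambda>t. cnj ((T t b' b - T 0 b' b) / of_real t)) \<longlongrightarrow> cnj (D b' b)) (at 0)"
      by (rule tendsto_cnj[OF Tlim])
    moreover have "cnj ((T t b' b - T 0 b' b) / of_real t) = (T t b b' - T 0 b b') / of_real t" for t
      using Th[of t b b'] Th[of 0 b b'] by simp
    ultimately show "((\<lambda>t. (T t b b' - T 0 b b') / of_real t) \<longlongrightarrow> cnj (D b' b)) (at 0)"
      by (simp only:)
  qed simp
  \<comment> \<open>\<open>s\<close> is the direction of travel in which the kernel form is
    positive: on that side the kernel joins the positive part, on the other side the negative
    part.\<close>
  have crossing: False if s1: "s = 1 \<or> s = -1" and pd: "posdef Z (\<lambda>b b'. of_real s * D b b')" for s :: real
  proof -
    have ss: "s * s = 1" "s \<noteq> 0" "cnj (of_real s) = of_real s" using s1 by auto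
    have fl: "filterlim (\<lambda>t. c * t) (at 0) (at_right 0)" if "c \<noteq> 0" for c :: real
      unfolding filterlim_at
    proof
      have "((\<lambda>t. c * t) \<longlongrightarrow> c * 0) (at_right 0)" by (intro tendsto_intros)
      then show "((\<lambda>t. c * t) \<longlongrightarrow> 0) (at_right 0)" by simp
      show "\<forall>\<^sub>F t in at_right 0. c * t \<in> UNIV \<and> c * t \<noteq> 0"
        unfolding eventually_at_filter using that by auto
    qed
    have lim: "((\<lambda>t. of_real c * ((T (c * t) b b' - T 0 b b') / of_real (c * t))) \<longlongrightarrow> of_real c * D b b') (at_right 0)"
      if "c \<noteq> 0" for c b b'
      by (intro tendsto_mult tendsto_const filterlim_compose[OF Tlim fl[OF that]])
    have T0: "T 0 b b' = (if b = b' then of_real (e b) else 0)" if "b < n" "b' < n" for b b'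
      using g[OF that] by (simp add: T_def)
    have e1: "\<forall>\<^sub>F t in at_right 0. posdim n (T (s * t)) (card {k. k < n \<and> e k \<ge> 0})"
    proof (rule posdim_after_crossing[where D = "\<lambda>b b'. of_real s * D b b'"])
      show "((\<lambda>t. (T (s * t) b b' - T (s * 0) b b') / of_real t) \<longlongrightarrow> of_real s * D b b') (at_right 0)" for b b'
        using lim[OF ss(2), of b b'] ss by simp
      show "T (s * t) b b' = cnj (T (s * t) b' b)" for t b b' by (rule Th)
      show "of_real s * D b b' = cnj (of_real s * D b' b)" for b b'
        using Dh[of b b'] by simp
    qed (use T0 pd in \<open>auto simp: Z_def\<close>)
    \<comment> \<open>The same crossing for \<open>- T\<close> run backwards; reversing both the
      sign and the direction leaves the derivative \<open>of_real s * D\<close>.\<close>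
    have e2: "\<forall>\<^sub>F t in at_right 0. posdim n (\<lambda>b b'. - T (- s * t) b b') (card {k. k < n \<and> - e k \<ge> 0})"
    proof (rule posdim_after_crossing[where D = "\<lambda>b b'. of_real s * D b b'"])
      have "of_real (- s) * ((T (- s * t) b b' - T 0 b b') / of_real (- s * t)) = (T (- s * t) b b' - T 0 b b') / of_real t" for t b b'
        using ss by simp
      then have "((\<lambda>t. (T (- s * t) b b' - T 0 b b') / of_real t) \<longlongrightarrow> of_real (- s) * D b b') (at_right 0)" for b b'
        using lim[of "- s" b b'] ss by simp
      then have "((\<lambda>t. - ((T (- s * t) b b' - T 0 b b') / of_real t)) \<longlongrightarrow> - (of_real (- s) * D b b')) (at_right 0)" for b b'
        by (rule tendsto_minus)
      moreover have "- ((T (- s * t) b b' - T 0 b b') / of_real t) = (- T (- s * t) b b' - - T (- s * 0) b b') / of_real t" for t b b'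
        by (simp add: minus_divide_left)
      ultimately show "((\<lambda>t. (- T (- s * t) b b' - - T (- s * 0) b b') / of_real t) \<longlongrightarrow> of_real s * D b b') (at_right 0)" for b b'
        by simp
      show "- T (- s * t) b b' = cnj (- T (- s * t) b' b)" for t b b' using Th[of "- s * t" b b'] by simp
      show "of_real s * D b b' = cnj (of_real s * D b' b)" for b b'
        using Dh[of b b'] by simp
    qed (use T0 pd in \<open>auto simp: Z_def\<close>)
    have av: "\<forall>\<^sub>F t in at_right 0. a * cis (c * t) \<notin> F" if "c \<noteq> 0" for c
      using eventually_circle_avoids[OF a F] fl[OF that] by (auto simp: filterlim_iff)
    have av2: "\<forall>\<^sub>F t in at_right 0. a * cis (- s * t) \<notin> F" by (rule av) (use ss in simp)
    have "\<forall>\<^sub>F t in at_right (0::real). card {k. k < n \<and> e k \<ge> 0} \<le> p \<and> card {k. k < n \<and> - e k \<ge> 0} \<le> q"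
      using e1 e2 av[OF ss(2)] av2
    proof eventually_elim
      case (elim t)
      have "posdim n (H (a * cis (s * t))) (card {k. k < n \<and> e k \<ge> 0})"
        using elim(1) unfolding T_def by (rule posdim_congruence)
      then have "posdim n (\<lambda>i j. leval_mat (a * cis (s * t)) A $$ (i,j)) (card {k. k < n \<and> e k \<ge> 0})"
        using posdim_cong[of n "\<lambda>i j. leval_mat (a * cis (s * t)) A $$ (i,j)" "H (a * cis (s * t))"] Hmat by simp
      then have 1: "card {k. k < n \<and> e k \<ge> 0} \<le> nu_pos (leval_mat (a * cis (s * t)) A)"
        by (rule nu_pos_posdim(1)[OF Hc hermitian_leval_mat[OF n1 herm]])
      have "(\<lambda>b b'. - T (- s * t) b b') = gram n (\<lambda>i j. - H (a * cis (- s * t)) i j) W"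
        by (auto simp: T_def gram_def sum_negf fun_eq_iff)
      then have "posdim n (gram n (\<lambda>i j. - H (a * cis (- s * t)) i j) W) (card {k. k < n \<and> - e k \<ge> 0})"
        using elim(2) by (simp only:)
      then have "posdim n (\<lambda>i j. - H (a * cis (- s * t)) i j) (card {k. k < n \<and> - e k \<ge> 0})"
        by (rule posdim_congruence)
      then have "posdim n (\<lambda>i j. - leval_mat (a * cis (- s * t)) A $$ (i,j)) (card {k. k < n \<and> - e k \<ge> 0})"
        using posdim_cong[of n "\<lambda>i j. - leval_mat (a * cis (- s * t)) A $$ (i,j)" "\<lambda>i j. - H (a * cis (- s * t)) i j"] Hmat by simp
      then have 2: "card {k. k < n \<and> - e k \<ge> 0} \<le> nu_neg (leval_mat (a * cis (- s * t)) A)"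
        by (rule nu_pos_posdim(2)[OF Hc hermitian_leval_mat[OF n1 herm]])
      show ?case using 1 2 nu[OF n1, of "s * t"] nu[OF n1, of "- s * t"] elim(3,4) by simp
    qed
    then have le: "card {k. k < n \<and> e k \<ge> 0} \<le> p" "card {k. k < n \<and> - e k \<ge> 0} \<le> q"
      by (auto dest: eventually_happens)
    \<comment> \<open>Nonnegative and nonpositive eigenvalues overlap exactly in the kernel, so the
      two counts add up to \<open>n + card Z\<close>, which exceeds \<open>p + q\<close>.\<close>
    have "card {k. k < n \<and> e k \<ge> 0} + card {k. k < n \<and> - e k \<ge> 0}
       = card ({k. k < n \<and> e k \<ge> 0} \<union> {k. k < n \<and> - e k \<ge> 0}) + card ({k. k < n \<and> e k \<ge> 0} \<inter> {k. k < n \<and> - e k \<ge> 0})"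
      by (rule card_Un_Int) auto
    also have "{k. k < n \<and> e k \<ge> 0} \<union> {k. k < n \<and> - e k \<ge> 0} = {..<n}" by auto
    also have "{k. k < n \<and> e k \<ge> 0} \<inter> {k. k < n \<and> - e k \<ge> 0} = Z" by (auto simp: Z_def)
    finally have "n + card Z \<le> n" using le pq by simp
    then show False using Zne finZ by simp
  qed
  obtain x m where x: "m \<in> Z" "x m \<noteq> 0" "qform Z D x = 0"
  proof -
    have "\<not> posdef Z D" using crossing[of 1] by auto
    moreover have "\<not> posdef Z (\<lambda>b b'. - D b b')" using crossing[of "-1"] by auto
    ultimately show ?thesis
      using qform_definite_or_isotropic[OF finZ, of D] Dh that by blast
  qed
  \<comment> \<open>\<open>y\<close> is the kernel vector with coordinates \<open>x\<close> in the
    eigenbasis. Its conjugate \<open>v\<close> is used because \<open>A\<close> is multiplied by a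
    row vector from the left.\<close>
  define y where "y i = (\<Sum>b\<in>Z. W i b * x b)" for i
  define v where "v k = cnj (y k)" for k
  have Wy: "(\<Sum>k<n. cnj (W k m) * y k) = (if m \<in> Z then x m else 0)" if m: "m < n" for m
  proof -
    have "(\<Sum>k<n. cnj (W k m) * y k) = (\<Sum>k<n. \<Sum>b\<in>Z. cnj (W k m) * W k b * x b)"
      by (simp add: y_def sum_distrib_left mult.assoc)
    also have "\<dots> = (\<Sum>b\<in>Z. (\<Sum>k<n. cnj (W k m) * W k b) * x b)"
      by (subst sum.swap) (simp add: sum_distrib_right)
    also have "\<dots> = (\<Sum>b\<in>Z. if b = m then x m else 0)"
      by (intro sum.cong refl) (use orth[OF m] in \<open>auto simp: Z_def\<close>)
    finally show ?thesis using finZ by (simp add: sum.delta)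
  qed
  have mn: "m < n" using x by (simp add: Z_def)
  have "\<exists>i<n. v i \<noteq> 0"
  proof (rule ccontr)
    assume "\<not> ?thesis"
    then have "y k = 0" if "k < n" for k using that by (auto simp: v_def)
    then have "(\<Sum>k<n. cnj (W k m) * y k) = 0" by simp
    then show False using Wy[OF mn] x by simp
  qed
  then obtain i where i: "i < n" "v i \<noteq> 0" by blast
  have ker: "leval a (\<Sum>k<n. lconst (v k) * A $$ (k,j)) = 0" if j: "j < n" for j
  proof -
    have "leval a (\<Sum>k<n. lconst (v k) * A $$ (k,j)) = (\<Sum>k<n. cnj (y k) * H a k j)"
      by (simp add: ev.hom_sum ev.hom_mult v_def H_def)
    also have "\<dots> = (\<Sum>k<n. \<Sum>m<n. of_real (e m) * cnj (W j m) * (cnj (y k) * W k m))"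
      unfolding sum_distrib_left by (intro sum.cong refl) (use s j in \<open>simp add: sum_distrib_left mult_ac\<close>)
    also have "\<dots> = (\<Sum>m<n. of_real (e m) * cnj (W j m) * (\<Sum>k<n. cnj (y k) * W k m))"
      by (subst sum.swap) (simp add: sum_distrib_left)
    also have "\<dots> = 0"
    proof (rule sum.neutral, rule ballI)
      fix m assume "m \<in> {..<n}"
      then have m: "m < n" by simp
      have "(\<Sum>k<n. cnj (y k) * W k m) = cnj (\<Sum>k<n. cnj (W k m) * y k)"
        by (simp add: mult.commute)
      then show "of_real (e m) * cnj (W j m) * (\<Sum>k<n. cnj (y k) * W k m) = 0"
        using Wy[OF m] by (auto simp: Z_def)
    qed
    finally show ?thesis .
  qed
  define N where "N = (\<Sum>k<n. \<Sum>l<n. lconst (v k) * A $$ (k,l) * lstar (lconst (v l)))"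
  have evN: "leval z N = (\<Sum>k<n. \<Sum>l<n. cnj (y k) * H z k l * y l)" if "cmod z = 1" for z
  proof -
    have "z \<noteq> 0" using that by auto
    then interpret ez: comm_ring_hom "leval z" by (rule leval_hom)
    show ?thesis by (simp add: N_def ez.hom_sum ez.hom_mult v_def H_def)
  qed
  have "((\<lambda>t. \<Sum>k<n. \<Sum>l<n. cnj (y k) * ((H (a * cis t) k l - H a k l) / of_real t) * y l)
     \<longlongrightarrow> (\<Sum>k<n. \<Sum>l<n. cnj (y k) * d k l * y l)) (at 0)"
    by (intro tendsto_sum tendsto_mult tendsto_const dlim)
  moreover have "(\<Sum>k<n. \<Sum>l<n. cnj (y k) * ((H (a * cis t) k l - H a k l) / of_real t) * y l)
     = (leval (a * cis t) N - leval a N) / of_real t" for t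
    unfolding evN[OF n1] evN[OF a] sum_subtractf[symmetric] sum_divide_distrib
    by (intro sum.cong refl) (simp add: algebra_simps diff_divide_distrib)
  ultimately have Nlim: "((\<lambda>t. (leval (a * cis t) N - leval a N) / of_real t) \<longlongrightarrow> (\<Sum>k<n. \<Sum>l<n. cnj (y k) * d k l * y l)) (at 0)"
    by simp
  \<comment> \<open>The derivative of \<open>N\<close> along the circle in two ways: as the kernel
    form at \<open>x\<close>, which is 0, and as \<open>\<i> * a\<close> times the difference
    quotient at \<open>a\<close>.\<close>
  have "(\<Sum>k<n. \<Sum>l<n. cnj (y k) * d k l * y l) = \<i> * a * leval a (lquot a N)"
    by (rule tendsto_unique[OF _ Nlim leval_circle_derivative[OF a0]]) simp
  moreover have "(\<Sum>k<n. \<Sum>l<n. cnj (y k) * d k l * y l) = qform Z D x"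
    unfolding D_def qform_gram unfolding qform_def y_def ..
  ultimately have "leval a (lquot a N) = 0" using x a0 by simp
  then show ?thesis using i ker unfolding N_def by blast
qed

lemma finite_lpoly_top:
  assumes "f \<noteq> 0"
  obtains k where "lcoeff f k \<noteq> 0" "deg_le f k"
proof -
  have ne: "lsupp f \<noteq> {}" using assms lpoly_eqI[of f 0] by auto
  have "lcoeff f (Max (lsupp f)) \<noteq> 0" using Max_in[OF finite_lsupp ne] by simp
  moreover have "deg_le f (Max (lsupp f))"
    unfolding deg_le_def
  proof (intro allI impI)
    fix k assume "Max (lsupp f) < k"
    then have "k \<notin> lsupp f" using Max_ge[OF finite_lsupp, of k f] by linarith
    then show "lcoeff f k = 0" by simp
  qed
  ultimately show ?thesis using that by blast
qed

lemma infinite_circle: "infinite {z. cmod z = 1}"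
proof
  assume fin: "finite {z. cmod z = 1}"
  have "\<forall>\<^sub>F t in at (0::real). 1 * cis t \<notin> {z. cmod z = 1}"
    by (rule eventually_circle_avoids[OF _ fin]) simp
  then have "\<forall>\<^sub>F t in at (0::real). False" by simp
  then show False by simp
qed

lemma circle_point_avoiding:
  assumes "finite F"
  obtains z where "cmod z = 1" "z \<notin> F"
  using infinite_circle assms by (metis (mono_tags, lifting) finite_subset mem_Collect_eq subsetI)

text \<open>Each split lowers the top degree of the determinant by one, so a bound on this degree is
  the induction measure. \<open>F\<close> is enlarged by the zeros of \<open>det A\<close>, because
  away from them \<open>A1\<close> is nondegenerate and its signature can be compared with that of
  \<open>A\<close>.\<close>

theorem constant_signature_lrep:
  assumes "A \<in> carrier_mat n n" "adj A = A" "det A \<noteq> 0" "deg_le (det A) (int d)" "finite F" "p + q = n"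
    and "\<And>z. cmod z = 1 \<Longrightarrow> z \<notin> F \<Longrightarrow> nu_pos (leval_mat z A) = p \<and> nu_neg (leval_mat z A) = q"
  shows "lrep p q A"
  using assms
proof (induction d arbitrary: A F rule: less_induct)
  case (less d)
  note A = less.prems(1) and herm = less.prems(2) and dnz = less.prems(3) and deg = less.prems(4)
    and F = less.prems(5) and pq = less.prems(6) and nu = less.prems(7)
  have deth: "lstar (det A) = det A" using det_adj[OF A] herm by simp
  show ?case
  proof (cases "\<exists>a. a \<noteq> 0 \<and> leval a (det A) = 0")
    case False
    then obtain c where c: "c \<noteq> 0" "det A = lconst (complex_of_real c)"
      using hermitian_lpoly_const[OF deth dnz] by blast
    have "det A * lconst (complex_of_real (1 / c)) = 1"
      unfolding c(2) lconst_hom.hom_mult[symmetric] using c(1) by simp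
    then have "det A dvd 1" by (metis dvd_triv_left)
    then obtain p' q' where pq': "p' + q' = n" "lrep p' q' A"
      using unimodular_lrep[OF A herm] by blast
    obtain z where z: "cmod z = 1" "z \<notin> F" using circle_point_avoiding[OF F] by blast
    \<comment> \<open>The bounds at one point suffice, since both pairs add up to
      \<open>n\<close>.\<close>
    have "p \<le> p'" "q \<le> q'" using lrep_nu_le[OF A herm pq'(2) z(1)] nu[OF z] by auto
    then have "p = p'" "q = q'" using pq pq'(1) by auto
    then show ?thesis using pq'(2) by simp
  next
    case True
    then obtain a where a: "a \<noteq> 0" "leval a (det A) = 0" by blast
    interpret ev: comm_ring_hom "leval a" by (rule leval_hom[OF a(1)])
    define N where "N v = (\<Sum>k<n. \<Sum>l<n. lconst (v k) * A $$ (k,l) * lstar (lconst (v l)))" for v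
    have N0: "leval a (N v) = 0" if "\<And>j. j < n \<Longrightarrow> leval a (\<Sum>k<n. lconst (v k) * A $$ (k,j)) = 0" for v
    proof -
      have "N v = (\<Sum>l<n. (\<Sum>k<n. lconst (v k) * A $$ (k,l)) * lstar (lconst (v l)))"
        unfolding N_def by (subst sum.swap) (simp add: sum_distrib_right)
      also have "leval a \<dots> = (\<Sum>l<n. leval a (\<Sum>k<n. lconst (v k) * A $$ (k,l)) * leval a (lstar (lconst (v l))))"
        by (simp only: ev.hom_sum ev.hom_mult)
      also have "\<dots> = 0" using that by (intro sum.neutral) auto
      finally show ?thesis .
    qed
    obtain v i g where v: "i < n" "v i \<noteq> 0" "\<And>j. j < n \<Longrightarrow> leval a (\<Sum>k<n. lconst (v k) * A $$ (k,j)) = 0"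
      and g: "N v = lroot a * g" "leval (inverse (cnj a)) g = 0"
    proof (cases "cmod a = 1")
      case True
      obtain v i where v: "i < n" "v i \<noteq> 0" "\<forall>j<n. leval a (\<Sum>k<n. lconst (v k) * A $$ (k,j)) = 0"
        "leval a (lquot a (N v)) = 0"
        using isotropic_kernel_vector[OF A herm True a(2) F _ nu] pq unfolding N_def by auto
      have "N v = lroot a * lquot a (N v)" using lquot[OF a(1), of "N v"] N0[of v] v(3) by simp
      \<comment> \<open>On the circle \<open>a\<close> is its own reflection, so the zero required
        of \<open>g\<close> is the one obtained from isotropy.\<close>
      moreover have "a * cnj a = 1" using complex_norm_square[of a] True by simp
      then have "inverse (cnj a) = a" using a(1) by (simp add: field_simps)
      ultimately show ?thesis using that v by auto
    next
      case False
      have "det (leval_mat a A) = 0" using det_leval_mat[OF a(1)] a(2) by simp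
      then obtain v i where v: "i < n" "v i \<noteq> 0" "\<And>j. j < n \<Longrightarrow> (\<Sum>k<n. v k * leval_mat a A $$ (k,j)) = 0"
        using left_kernel_vector[of "leval_mat a A" n] A by (metis leval_mat_carrier)
      have ker: "leval a (\<Sum>k<n. lconst (v k) * A $$ (k,j)) = 0" if "j < n" for j
        using v(3)[OF that] A that by (simp add: ev.hom_sum ev.hom_mult)
      obtain g where g: "N v = lroot a * g" using lroot_dvd[OF a(1) N0[OF ker]] by (auto simp: dvd_def)
      define b where "b = inverse (cnj a)"
      have b0: "b \<noteq> 0" using a by (simp add: b_def)
      have star: "lstar (A $$ (j,i)) = A $$ (i,j)" if "i < n" "j < n" for i j
        using adj_eq_iff[OF A] herm that by simp
      have "lstar (N v) = N v"
      proof -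
        have "lstar (N v) = (\<Sum>k<n. \<Sum>l<n. lconst (v l) * A $$ (l,k) * lstar (lconst (v k)))"
          unfolding N_def lstar_hom.hom_sum
          by (intro sum.cong refl) (simp add: lstar_mult star mult_ac)
        also have "\<dots> = N v" unfolding N_def by (rule sum.swap)
        finally show ?thesis .
      qed
      \<comment> \<open>\<open>N v\<close> is Hermitian and vanishes at \<open>a\<close>, hence also
        at the reflected point \<open>b\<close>; as \<open>b \<noteq> a\<close>, this zero belongs
        to \<open>g\<close>.\<close>
      then have "leval b (N v) = 0"
        using leval_lstar_gen[OF a(1), of "N v"] N0[OF ker] by (simp add: b_def)
      moreover have "leval b (N v) = (b - a) * leval b g" unfolding g leval_mult[OF b0] by simp
      moreover have "b \<noteq> a"
      proof
        assume "b = a"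
        then have "a * cnj a = 1" using a by (simp add: b_def field_simps)
        then have "(cmod a)\<^sup>2 = 1" using complex_norm_square[of a] by (metis of_real_1 of_real_eq_iff)
        then have "cmod a = 1" using power2_eq_imp_eq[of "cmod a" 1] by simp
        then show False using False by simp
      qed
      ultimately have "leval b g = 0" by simp
      then have g0: "leval (inverse (cnj a)) g = 0" by (simp only: b_def)
      show ?thesis by (rule that[OF v(1,2) ker g g0])
    qed
    obtain B A1 c where B: "B \<in> carrier_mat n n" and A1: "A1 \<in> carrier_mat n n" "adj A1 = A1"
      and AB: "A = B * A1 * adj B" and c: "c \<noteq> 0" "lconst c * det A = lroot a * lstar (lroot a) * det A1"
      using split_off_root[OF A herm a(1) v(1,2,3) g(1)[unfolded N_def] g(2)] by metis
    have dA1: "det A1 \<noteq> 0" using c dnz by auto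
    have dA1h: "lstar (det A1) = det A1" using det_adj[OF A1(1)] A1(2) by simp
    obtain k where k: "lcoeff (det A1) k \<noteq> 0" "deg_le (det A1) k" using finite_lpoly_top[OF dA1] by blast
    have "lcoeff (det A1) (- k) \<noteq> 0" using arg_cong[OF dA1h, of "\<lambda>f. lcoeff f k"] k(1) by auto
    then have k0: "0 \<le> k" using k(2) by (force simp: deg_le_def)
    \<comment> \<open>The product \<open>lroot a * lstar (lroot a)\<close> has top degree exactly 1,
      with coefficient \<open>- cnj a \<noteq> 0\<close>. So \<open>det A1\<close> has top degree
      one less than \<open>det A\<close>.\<close>
    have l1: "deg_le (lroot a) 1" "lcoeff (lroot a) 1 = 1" by (auto simp: deg_le_def lroot_def)
    have l2: "deg_le (lstar (lroot a)) 0" "lcoeff (lstar (lroot a)) 0 = - cnj a"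
      by (auto simp: deg_le_def lroot_def)
    have l3: "deg_le (lroot a * lstar (lroot a)) 1" "lcoeff (lroot a * lstar (lroot a)) 1 = - cnj a"
      using deg_le_mult[OF l1(1) l2(1)] lcoeff_mult_top[OF l1(1) l2(1)] l1 l2 by auto
    have "lcoeff (lconst c * det A) (1 + k) \<noteq> 0"
      unfolding c(2) lcoeff_mult_top[OF l3(1) k(2)] using l3 k a by simp
    moreover have "lconst c * det A = lmonom c 0 * det A" by (simp add: lconst_def)
    ultimately have "lcoeff (det A) (1 + k) \<noteq> 0" by simp
    then have kd: "1 + k \<le> int d" using deg by (force simp: deg_le_def)
    define F1 where "F1 = F \<union> {z. z \<noteq> 0 \<and> leval z (det A) = 0}"
    have F1: "finite F1" using F finite_lpoly_roots[OF dnz] by (simp add: F1_def)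
    have "lrep p q A1"
    proof (rule less.IH[of "nat k", OF _ A1 dA1 _ F1 pq])
      show "nat k < d" using kd k0 by simp
      show "deg_le (det A1) (int (nat k))" using k(2) k0 by simp
      fix z assume z: "cmod z = 1" "z \<notin> F1"
      have z0: "z \<noteq> 0" using z by auto
      interpret ez: comm_ring_hom "leval z" by (rule leval_hom[OF z0])
      have "leval z (lconst c * det A) \<noteq> 0" using z z0 c(1) by (simp add: F1_def ez.hom_mult)
      then have "leval z (det A1) \<noteq> 0" unfolding c(2) by (auto simp: ez.hom_mult)
      then have dz: "det (leval_mat z A1) \<noteq> 0" using det_leval_mat[OF z0] by simp
      have H1: "leval_mat z A1 \<in> carrier_mat n n" "hadj cnj (leval_mat z A1) = leval_mat z A1"
        using A1 hermitian_leval_mat[OF z(1)] by auto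
      have BA1: "B * A1 \<in> carrier_mat n n" using B A1 by auto
      have eq: "leval_mat z A = leval_mat z B * leval_mat z A1 * hadj cnj (leval_mat z B)"
        unfolding leval_mat_adj[OF z(1), symmetric] using B A1 BA1
        by (subst AB) (simp add: leval_mat_mult[OF z0, of _ n n _ n])
      have Bz: "leval_mat z B \<in> carrier_mat n n" using B by simp
      \<comment> \<open>Congruence gives inequalities only, but the indices of both matrices add up
        to \<open>n\<close>, so they agree.\<close>
      have "nu_pos (leval_mat z A) \<le> nu_pos (leval_mat z A1)" "nu_neg (leval_mat z A) \<le> nu_neg (leval_mat z A1)"
        using nu_congruence_le[OF H1 Bz eq hermitian_leval_mat[OF z(1) herm]] by auto
      moreover have "nu_pos (leval_mat z A1) + nu_neg (leval_mat z A1) = n" by (rule nu_pos_posdim(5)[OF H1 dz])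
      moreover have "nu_pos (leval_mat z A) = p \<and> nu_neg (leval_mat z A) = q" using nu[OF z(1)] z by (auto simp: F1_def)
      ultimately show "nu_pos (leval_mat z A1) = p \<and> nu_neg (leval_mat z A1) = q" using pq by auto
    qed
    then show ?thesis using lrep_congruence[OF A1(1) B] AB by simp
  qed
qed

section \<open>Prescribed bounds on the signature\<close>

lemma nu_one_by_one_block:
  assumes H: "H \<in> carrier_mat n n" and G: "G = four_block_mat (mat 1 1 (\<lambda>_. of_real x)) (0\<^sub>m 1 n) (0\<^sub>m n 1) H"
  shows "nu_pos G = (if x > 0 then 1 else 0) + nu_pos H" and "nu_neg G = (if x < 0 then 1 else 0) + nu_neg H"
proof -
  let ?X = "mat 1 1 (\<lambda>_. complex_of_real x)"
  have "upper_triangular ?X" by auto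
  then have "char_poly ?X = (\<Prod>a\<leftarrow>diag_mat ?X. [:- a, 1:])" by (intro char_poly_upper_triangular[of _ 1]) auto
  also have "diag_mat ?X = [complex_of_real x]" by (simp add: diag_mat_def)
  finally have cX: "char_poly ?X = (\<Prod>a\<leftarrow>[complex_of_real x]. [:- a, 1:])" .
  have "char_poly G = char_poly ?X * char_poly H"
    unfolding G by (rule char_poly_four_block_zeros_col) (use H in auto)
  moreover have "char_poly ?X \<noteq> 0" "char_poly H \<noteq> 0"
    using degree_monic_char_poly[of ?X 1] degree_monic_char_poly[OF H] by auto
  ultimately have "proots (char_poly G) = proots (char_poly ?X) + proots (char_poly H)"
    by (simp add: proots_mult)
  also have "proots (char_poly ?X) = {#complex_of_real x#}"
    unfolding cX proots_linear_factors by simp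
  finally have pr: "proots (char_poly G) = {#complex_of_real x#} + proots (char_poly H)" .
  show "nu_pos G = (if x > 0 then 1 else 0) + nu_pos H" "nu_neg G = (if x < 0 then 1 else 0) + nu_neg H"
    unfolding nu_pos_def nu_neg_def pr by auto
qed

text \<open>Both indices are lower semicontinuous, and where the determinant is nonzero their sum is
  fixed at \<open>n\<close>; hence neither can increase.\<close>

lemma nu_locally_constant:
  assumes A: "A \<in> carrier_mat n n" and herm: "adj A = A" and z: "cmod z = 1" and nz: "leval z (det A) \<noteq> 0"
  shows "\<forall>\<^sub>F t in at (0::real). nu_pos (leval_mat (z * cis t) A) = nu_pos (leval_mat z A)"
proof -
  have z0: "z \<noteq> 0" using z by auto
  have n1: "cmod (z * cis t) = 1" for t using z by (simp add: norm_mult)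
  have Hc: "leval_mat w A \<in> carrier_mat n n" for w using A by simp
  have Hh: "hadj cnj (leval_mat w A) = leval_mat w A" if "cmod w = 1" for w
    by (rule hermitian_leval_mat[OF that herm])
  have sym: "leval_mat w A $$ (i,j) = cnj (leval_mat w A $$ (j,i))" if "cmod w = 1" "i < n" "j < n" for w i j
    using arg_cong[OF Hh[OF that(1)], of "\<lambda>M. M $$ (i,j)"] that A by (simp add: leval_mat_def)
  have lim: "((\<lambda>t. leval_mat (z * cis t) A $$ (i,j)) \<longlongrightarrow> leval_mat z A $$ (i,j)) (at 0)" if "i < n" "j < n" for i j
    using that A tendsto_leval[OF tendsto_mult_cis z0] by simp
  have neg: "- leval_mat w A $$ (i,j) = cnj (- leval_mat w A $$ (j,i))" if "cmod w = 1" "i < n" "j < n" for w i j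
    using sym[OF that] by simp
  have e1: "\<forall>\<^sub>F t in at 0. posdim n (\<lambda>i j. leval_mat (z * cis t) A $$ (i,j)) (nu_pos (leval_mat z A))"
    by (rule posdim_eventually[OF nu_pos_posdim(3)[OF Hc Hh[OF z]]]) (rule sym[OF z] sym[OF n1] lim; assumption)+
  have e2: "\<forall>\<^sub>F t in at 0. posdim n (\<lambda>i j. - leval_mat (z * cis t) A $$ (i,j)) (nu_neg (leval_mat z A))"
    by (rule posdim_eventually[OF nu_pos_posdim(4)[OF Hc Hh[OF z]]])
      (rule neg[OF z] neg[OF n1] tendsto_minus[OF lim]; assumption)+
  have e3: "\<forall>\<^sub>F t in at 0. z * cis t \<notin> {w. w \<noteq> 0 \<and> leval w (det A) = 0}"
  proof (rule eventually_circle_avoids[OF z])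
    have "det A \<noteq> 0" using nz leval_zero[of z] by auto
    then show "finite {w. w \<noteq> 0 \<and> leval w (det A) = 0}" by (rule finite_lpoly_roots)
  qed
  have sum: "nu_pos (leval_mat w A) + nu_neg (leval_mat w A) = n" if "cmod w = 1" "leval w (det A) \<noteq> 0" for w
  proof (rule nu_pos_posdim(5)[OF Hc Hh[OF that(1)]])
    have "w \<noteq> 0" using that by auto
    then show "det (leval_mat w A) \<noteq> 0" using det_leval_mat[of w A] that by simp
  qed
  show ?thesis
    using e1 e2 e3
  proof eventually_elim
    case (elim t)
    have "z * cis t \<noteq> 0" using z0 by simp
    then have "leval (z * cis t) (det A) \<noteq> 0" using elim(3) by blast
    then show ?case
      using nu_pos_posdim(1)[OF Hc Hh[OF n1] elim(1)] nu_pos_posdim(2)[OF Hc Hh[OF n1] elim(2)]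
        sum[OF n1, of t] sum[OF z nz] by linarith
  qed
qed

text \<open>Induction on the number of missing dimensions, one scalar block per step. When none is
  missing, the two bounds are attained off a finite set and the signature is constant there.\<close>

theorem lrep_of_bounds:
  assumes "A \<in> carrier_mat n n" "adj A = A" "det A \<noteq> 0" "finite F"
    and "\<And>z. cmod z = 1 \<Longrightarrow> z \<notin> F \<Longrightarrow> nu_pos (leval_mat z A) \<le> m1 \<and> nu_neg (leval_mat z A) \<le> m2"
  shows "lrep m1 m2 A"
  using assms
proof (induction "m1 + m2 - n" arbitrary: n A F)
  case (0 n A F)
  note A = 0(2) and herm = 0(3) and dnz = 0(4) and F = 0(5) and nu = 0(6)
  define F' where "F' = F \<union> {z. z \<noteq> 0 \<and> leval z (det A) = 0}"
  have F': "finite F'" using F finite_lpoly_roots[OF dnz] by (simp add: F'_def)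
  have sum: "nu_pos (leval_mat z A) + nu_neg (leval_mat z A) = n" if "cmod z = 1" "z \<notin> F'" for z
  proof (rule nu_pos_posdim(5)[OF _ hermitian_leval_mat[OF that(1) herm]])
    have "z \<noteq> 0" using that by auto
    then show "det (leval_mat z A) \<noteq> 0" using det_leval_mat[of z A] that by (simp add: F'_def)
  qed (use A in simp)
  have nu': "nu_pos (leval_mat z A) \<le> m1 \<and> nu_neg (leval_mat z A) \<le> m2" if "cmod z = 1" "z \<notin> F'" for z
    using nu[OF that(1)] that(2) by (simp add: F'_def)
  obtain z where z: "cmod z = 1" "z \<notin> F'" using circle_point_avoiding[OF F'] by blast
  \<comment> \<open>Truncated subtraction gives only \<open>m1 + m2 \<le> n\<close>; the reverse
    inequality comes from the bounds at one nondegenerate point.\<close>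
  have n: "m1 + m2 = n" using sum[OF z] nu'[OF z] 0(1) by linarith
  obtain k where k: "deg_le (det A) k" using finite_lpoly_top[OF dnz] by blast
  show ?case
  proof (rule constant_signature_lrep[OF A herm dnz _ F' n])
    show "deg_le (det A) (int (nat k))" using k by (rule deg_le_mono) simp
    show "nu_pos (leval_mat z A) = m1 \<and> nu_neg (leval_mat z A) = m2" if "cmod z = 1" "z \<notin> F'" for z
      using sum[OF that] nu'[OF that] n by linarith
  qed
next
  case (Suc x n A F)
  note A = Suc.prems(1) and herm = Suc.prems(2) and dnz = Suc.prems(3) and F = Suc.prems(4) and nu = Suc.prems(5)
  define F' where "F' = F \<union> {z. z \<noteq> 0 \<and> leval z (det A) = 0}"
  have F': "finite F'" using F finite_lpoly_roots[OF dnz] by (simp add: F'_def)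
  \<comment> \<open>The new eigenvalue is positive where there is room below \<open>m1\<close>.
    Elsewhere \<open>nu_pos\<close> equals \<open>m1\<close>, so \<open>nu_neg\<close> is
    \<open>n - m1\<close>, which is less than \<open>m2\<close> because the deficit is positive, and
    a negative eigenvalue fits.\<close>
  define \<sigma> :: "complex \<Rightarrow> real" where "\<sigma> z = (if nu_pos (leval_mat z A) < m1 then 1 else - 1)" for z
  have det: "leval z (det A) \<noteq> 0" if "cmod z = 1" "z \<notin> F'" for z
    using that by (auto simp: F'_def)
  have "circle_lc \<sigma> z" if "cmod z = 1" "z \<notin> F'" for z
    using nu_locally_constant[OF A herm that(1) det[OF that]] unfolding circle_lc_def
    by eventually_elim (simp add: \<sigma>_def)
  moreover have "\<sigma> z = 1 \<or> \<sigma> z = - 1" for z by (simp add: \<sigma>_def)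
  ultimately obtain b where b: "lstar b = b" "\<forall>z. cmod z = 1 \<longrightarrow> z \<notin> F' \<longrightarrow> Re (leval z b) * \<sigma> z > 0"
    using lpoly_with_signs[OF F', of \<sigma>] by blast
  define X where "X = mat 1 1 (\<lambda>_. b)"
  have X: "X \<in> carrier_mat 1 1" by (simp add: X_def)
  define C where "C = four_block_mat X (0\<^sub>m 1 n) (0\<^sub>m n 1) A"
  have C: "C \<in> carrier_mat (Suc n) (Suc n)" using four_block_carrier_mat[OF X A] by (simp add: C_def)
  have "adj X = X" by (rule eq_matI) (auto simp: X_def b(1))
  then have Ch: "adj C = C"
    unfolding C_def by (subst hadj_four_block[of _ 1 1 _ n _ n]) (use X A herm in auto)
  have "det C = det X * det A"
    unfolding C_def by (rule det_four_block_mat_lower_left_zero_col[OF X _ refl A]) auto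
  also have "det X = b" by (subst det_single[OF X]) (simp add: X_def)
  finally have dC: "det C = b * det A" .
  obtain z0 where z0: "cmod z0 = 1" "z0 \<notin> F'" using circle_point_avoiding[OF F'] by blast
  have "b \<noteq> 0" using b(2) z0 leval_zero[of z0] by auto
  then have dC0: "det C \<noteq> 0" using dC dnz by simp
  have "nu_pos (leval_mat z C) \<le> m1 \<and> nu_neg (leval_mat z C) \<le> m2" if z: "cmod z = 1" "z \<notin> F'" for z
  proof -
    have nz: "z \<noteq> 0" using z by auto
    define y where "y = Re (leval z b)"
    have y: "leval z b = of_real y" unfolding y_def by (rule leval_hermitian_real[OF b(1) z(1)])
    have "leval_mat z C = four_block_mat (mat 1 1 (\<lambda>_. of_real y)) (0\<^sub>m 1 n) (0\<^sub>m n 1) (leval_mat z A)"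
      by (rule eq_matI) (use A in \<open>auto simp: C_def X_def leval_mat_def y leval_zero\<close>)
    note nu_one_by_one_block[OF _ this]
    then have nuC: "nu_pos (leval_mat z C) = (if y > 0 then 1 else 0) + nu_pos (leval_mat z A)"
      "nu_neg (leval_mat z C) = (if y < 0 then 1 else 0) + nu_neg (leval_mat z A)"
      using A by auto
    have sum: "nu_pos (leval_mat z A) + nu_neg (leval_mat z A) = n"
      by (rule nu_pos_posdim(5)[OF _ hermitian_leval_mat[OF z(1) herm]])
        (use A det[OF z] det_leval_mat[OF nz, of A] in auto)
    have ys: "y * \<sigma> z > 0" using b(2) z by (simp add: y_def)
    have nuA: "nu_pos (leval_mat z A) \<le> m1" "nu_neg (leval_mat z A) \<le> m2"
      using nu[OF z(1)] z(2) by (auto simp: F'_def)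
    show ?thesis
    proof (cases "nu_pos (leval_mat z A) < m1")
      case True
      then have "y > 0" using ys by (simp add: \<sigma>_def)
      then show ?thesis using nuC nuA True by simp
    next
      case False
      then have "y < 0" using ys by (simp add: \<sigma>_def)
      then show ?thesis using nuC nuA False sum Suc.hyps(2) by simp
    qed
  qed
  then have "lrep m1 m2 C"
    by (intro Suc.hyps(1)[of "Suc n" C F']) (use Suc.hyps(2) C Ch dC0 F' in auto)
  then obtain u w where uw: "\<And>i j. i < Suc n \<Longrightarrow> j < Suc n \<Longrightarrow>
     C $$ (i,j) = (\<Sum>k<m1. u k i * lstar (u k j)) - (\<Sum>k<m2. w k i * lstar (w k j))"
    using C unfolding lrep_def by auto
  \<comment> \<open>\<open>A\<close> is the lower right block of \<open>C\<close>, so dropping the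
    first coordinate of every vector gives a representation of \<open>A\<close>.\<close>
  have "A $$ (i,j) = C $$ (Suc i, Suc j)" if "i < n" "j < n" for i j
    using that A by (simp add: C_def X_def)
  then show ?case
    unfolding lrep_def using A uw
    by - (rule exI[of _ "\<lambda>k i. u k (Suc i)"], rule exI[of _ "\<lambda>k i. w k (Suc i)"], simp)
qed

section \<open>From sums of squares back to the matrix factorization\<close>

lemma sig_mat_diag: "sig_mat m1 m2 = mat_diag (m1 + m2) (\<lambda>k. if k < m1 then 1 else - 1)"
  by (rule eq_matI) (auto simp: sig_mat_def mat_diag_def)

lemma signature_product_index:
  assumes U: "U \<in> carrier_mat n (m1 + m2)" and ij: "i < n" "j < n"
  shows "(U * sig_mat m1 m2 * lp_mat_star U) $$ (i,j) =
    (\<Sum>k<m1. U $$ (i,k) * lp_star (U $$ (j,k))) - (\<Sum>k<m2. U $$ (i,m1+k) * lp_star (U $$ (j,m1+k)))"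
proof -
  have US: "U * sig_mat m1 m2 \<in> carrier_mat n (m1 + m2)"
    unfolding sig_mat_diag using U by auto
  have U': "lp_mat_star U \<in> carrier_mat (m1 + m2) n" using U by (auto simp: lp_mat_star_def)
  have "(U * sig_mat m1 m2 * lp_mat_star U) $$ (i,j) =
     (\<Sum>k<m1+m2. (U * sig_mat m1 m2) $$ (i,k) * lp_mat_star U $$ (k,j))"
    by (rule index_mult_sum[OF US U' ij])
  also have "\<dots> = (\<Sum>k<m1+m2. (if k < m1 then 1 else - 1) * (U $$ (i,k) * lp_star (U $$ (j,k))))"
    unfolding sig_mat_diag mat_diag_mult_right[OF U]
    by (intro sum.cong refl) (use U ij in \<open>auto simp: lp_mat_star_def\<close>)
  also have "{..<m1+m2} = {..<m1} \<union> {m1..<m1+m2}" by auto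
  also have "(\<Sum>k\<in>\<dots>. (if k < m1 then 1 else - 1) * (U $$ (i,k) * lp_star (U $$ (j,k)))) =
    (\<Sum>k<m1. U $$ (i,k) * lp_star (U $$ (j,k))) + (\<Sum>k=m1..<m1+m2. - (U $$ (i,k) * lp_star (U $$ (j,k))))"
    by (subst sum.union_disjoint) (auto intro!: arg_cong2[where f = "(+)"] sum.cong)
  also have "(\<Sum>k=m1..<m1+m2. - (U $$ (i,k) * lp_star (U $$ (j,k)))) = - (\<Sum>k<m2. U $$ (i,m1+k) * lp_star (U $$ (j,m1+k)))"
    unfolding sum_negf using sum.shift_bounds_nat_ivl[of "\<lambda>k. U $$ (i,k) * lp_star (U $$ (j,k))" 0 m1 m2]
    by (simp add: add.commute atLeast0LessThan)
  finally show ?thesis by simp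
qed

text \<open>The first \<open>m1\<close> columns of \<open>U\<close> are the vectors
  \<open>u k\<close>, the remaining \<open>m2\<close> columns the vectors
  \<open>w k\<close>.\<close>

lemma signature_factorization_iff_lrep:
  assumes A: "A \<in> carrier_mat n n"
  shows "(\<exists>U. U \<in> carrier_mat n (m1 + m2) \<and> is_lpoly_mat U \<and>
      map_mat fls_of A = U * sig_mat m1 m2 * lp_mat_star U) \<longleftrightarrow> lrep m1 m2 A"
proof
  assume "\<exists>U. U \<in> carrier_mat n (m1 + m2) \<and> is_lpoly_mat U \<and> map_mat fls_of A = U * sig_mat m1 m2 * lp_mat_star U"
  then obtain U where U: "U \<in> carrier_mat n (m1 + m2)" and lp: "is_lpoly_mat U"
    and eq: "map_mat fls_of A = U * sig_mat m1 m2 * lp_mat_star U" by blast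
  have inv: "fls_of (lpoly_of (U $$ (i,k))) = U $$ (i,k)" if "i < n" "k < m1 + m2" for i k
    using lp U that by (intro lpoly_of_inverse) (auto simp: is_lpoly_mat_def)
  have "A $$ (i,j) = (\<Sum>k<m1. lpoly_of (U $$ (i,k)) * lstar (lpoly_of (U $$ (j,k))))
      - (\<Sum>k<m2. lpoly_of (U $$ (i,m1+k)) * lstar (lpoly_of (U $$ (j,m1+k))))" if ij: "i < n" "j < n" for i j
  proof -
    have "fls_of (A $$ (i,j)) = (\<Sum>k<m1. U $$ (i,k) * lp_star (U $$ (j,k))) - (\<Sum>k<m2. U $$ (i,m1+k) * lp_star (U $$ (j,m1+k)))"
      using arg_cong[OF eq, of "\<lambda>M. M $$ (i,j)"] signature_product_index[OF U ij] A ij by simp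
    also have "\<dots> = fls_of ((\<Sum>k<m1. lpoly_of (U $$ (i,k)) * lstar (lpoly_of (U $$ (j,k))))
      - (\<Sum>k<m2. lpoly_of (U $$ (i,m1+k)) * lstar (lpoly_of (U $$ (j,m1+k)))))"
      using inv ij by (simp add: fls_of_hom.hom_minus fls_of_hom.hom_sum fls_of_hom.hom_mult lstar.rep_eq)
    finally show ?thesis by (simp only: fls_of_inject)
  qed
  then show "lrep m1 m2 A"
    unfolding lrep_def using A
    by - (rule exI[of _ "\<lambda>k i. lpoly_of (U $$ (i,k))"], rule exI[of _ "\<lambda>k i. lpoly_of (U $$ (i,m1+k))"], simp)
next
  assume "lrep m1 m2 A"
  then obtain u w where uw: "\<And>i j. i < n \<Longrightarrow> j < n \<Longrightarrow>
     A $$ (i,j) = (\<Sum>k<m1. u k i * lstar (u k j)) - (\<Sum>k<m2. w k i * lstar (w k j))"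
    using A unfolding lrep_def by auto
  define U where "U = mat n (m1 + m2) (\<lambda>(i,k). fls_of (if k < m1 then u k i else w (k - m1) i))"
  have U: "U \<in> carrier_mat n (m1 + m2)" by (simp add: U_def)
  have "is_lpoly_mat U" using fls_of by (auto simp: is_lpoly_mat_def U_def)
  moreover have "map_mat fls_of A = U * sig_mat m1 m2 * lp_mat_star U"
  proof (rule eq_matI)
    fix i j assume "i < dim_row (U * sig_mat m1 m2 * lp_mat_star U)" "j < dim_col (U * sig_mat m1 m2 * lp_mat_star U)"
    then have ij: "i < n" "j < n" using U by (auto simp: lp_mat_star_def)
    show "map_mat fls_of A $$ (i,j) = (U * sig_mat m1 m2 * lp_mat_star U) $$ (i,j)"
      unfolding signature_product_index[OF U ij] using A ij uw[OF ij]
      by (simp add: U_def fls_of_hom.hom_minus fls_of_hom.hom_sum fls_of_hom.hom_mult lstar.rep_eq)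
  qed (use A U in \<open>auto simp: lp_mat_star_def\<close>)
  ultimately show "\<exists>U. U \<in> carrier_mat n (m1 + m2) \<and> is_lpoly_mat U \<and> map_mat fls_of A = U * sig_mat m1 m2 * lp_mat_star U"
    using U by blast
qed

theorem theorem1p3:
  fixes A :: "complex fls mat" and n m1 m2 :: nat
  assumes "A \<in> carrier_mat n n"
    and "is_lpoly_mat A"
    and "lp_mat_star A = A"
    and "det A \<noteq> 0"
  shows "(\<exists>U. U \<in> carrier_mat n (m1 + m2) \<and> is_lpoly_mat U \<and>
              A = U * sig_mat m1 m2 * lp_mat_star U)
         \<longleftrightarrow> (m1 \<ge> Max ((\<lambda>z. nu_pos (lp_mat_eval A z)) ` unit_circle) \<and>
              m2 \<ge> Max ((\<lambda>z. nu_neg (lp_mat_eval A z)) ` unit_circle))"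
proof -
  define B where "B = map_mat lpoly_of A"
  have B: "B \<in> carrier_mat n n" using assms(1) by (simp add: B_def)
  have inv: "fls_of (B $$ (i,j)) = A $$ (i,j)" if "i < n" "j < n" for i j
    using assms(1,2) that unfolding B_def by (simp add: is_lpoly_mat_def lpoly_of_inverse)
  have AB: "A = map_mat fls_of B"
    by (rule eq_matI) (use inv B assms(1) in auto)
  have herm: "adj B = B"
    unfolding adj_eq_iff[OF B]
  proof (intro allI impI)
    fix i j assume ij: "i < n" "j < n"
    have "lp_star (A $$ (j,i)) = A $$ (i,j)"
      using arg_cong[OF assms(3), of "\<lambda>M. M $$ (i,j)"] assms(1) ij by (simp add: lp_mat_star_def)
    then have "fls_of (lstar (B $$ (j,i))) = fls_of (B $$ (i,j))"
      using inv ij by (simp add: lstar.rep_eq)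
    then show "lstar (B $$ (j,i)) = B $$ (i,j)" by (simp only: fls_of_inject)
  qed
  have "det A = fls_of (det B)" unfolding AB by (rule fls_of_hom.hom_det)
  then have dnz: "det B \<noteq> 0" using assms(4) by auto
  have ev: "lp_mat_eval A z = leval_mat z B" for z
    unfolding AB by (rule eq_matI) (auto simp: lp_mat_eval_def leval_mat_def leval.rep_eq)
  have Bz: "leval_mat z B \<in> carrier_mat n n" for z using B by simp
  \<comment> \<open>The circle is infinite, but the values are bounded by \<open>n\<close>; the
    image is thus finite and nonempty, and \<open>Max\<close> is a true maximum.\<close>
  have Max_le: "Max (f ` unit_circle) \<le> m \<longleftrightarrow> (\<forall>z. cmod z = 1 \<longrightarrow> f z \<le> m)"
    if "\<And>z. cmod z = 1 \<Longrightarrow> f z \<le> n" for f :: "complex \<Rightarrow> nat" and m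
  proof -
    have "f ` unit_circle \<subseteq> {..n}" using that by (auto simp: unit_circle_def)
    then have "finite (f ` unit_circle)" by (rule finite_subset) simp
    moreover have "(1::complex) \<in> unit_circle" by (simp add: unit_circle_def)
    then have "f ` unit_circle \<noteq> {}" by blast
    ultimately show ?thesis by (auto simp: unit_circle_def)
  qed
  have "(Max ((\<lambda>z. nu_pos (lp_mat_eval A z)) ` unit_circle) \<le> m1 \<and>
      Max ((\<lambda>z. nu_neg (lp_mat_eval A z)) ` unit_circle) \<le> m2)
    \<longleftrightarrow> (\<forall>z. cmod z = 1 \<longrightarrow> nu_pos (leval_mat z B) \<le> m1 \<and> nu_neg (leval_mat z B) \<le> m2)"
    unfolding ev
    using Max_le[of "\<lambda>z. nu_pos (leval_mat z B)" m1] Max_le[of "\<lambda>z. nu_neg (leval_mat z B)" m2]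
      nu_pos_posdim(6,7)[OF Bz hermitian_leval_mat[OF _ herm]] by auto
  also have "\<dots> \<longleftrightarrow> lrep m1 m2 B"
  proof
    assume "\<forall>z. cmod z = 1 \<longrightarrow> nu_pos (leval_mat z B) \<le> m1 \<and> nu_neg (leval_mat z B) \<le> m2"
    then show "lrep m1 m2 B" by (intro lrep_of_bounds[OF B herm dnz, of "{}"]) simp_all
  next
    assume rep: "lrep m1 m2 B"
    then show "\<forall>z. cmod z = 1 \<longrightarrow> nu_pos (leval_mat z B) \<le> m1 \<and> nu_neg (leval_mat z B) \<le> m2"
      using lrep_nu_le[OF B herm rep] by blast
  qed
  also have "\<dots> \<longleftrightarrow> (\<exists>U. U \<in> carrier_mat n (m1 + m2) \<and> is_lpoly_mat U \<and>
              A = U * sig_mat m1 m2 * lp_mat_star U)"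
    unfolding AB by (rule signature_factorization_iff_lrep[OF B, symmetric])
  finally show ?thesis by blast
qed

end
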